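(* Let $R$ be a commutative ring and let $G$ be an edge-labeled graph over $R$ that is locally regular $1$-mono. Then $R_G$ is a projective $R$-module. If $R$ is a PID, or $R$ is of the form $A[x_1,\dots,x_n]$ with $A$ a PID or a field, then $R_G$ is also free.
   Context: An edge-labeled graph $G$ over $R$ is a finite graph $(V,E)$ with a map $\alpha$ from $E$ to the set of ideals of $R$. A spline is a function $s:V\to R$ with $s(u)-s(v)\in\alpha(e_{uv})$ for every edge $e_{uv}$ joining $u$ and $v$; the splines form a ring $R_G$ under pointwise operations, which is an $R$-module via constant splines. Standing assumption: $R_G$ is a finitely generated $R$-module. For $f\in R$, $U_f=D(f)\subseteq\operatorname{Spec}(R)$, and $G_f$ is the edge-labeled graph over $R_f$ with the same underlying graph and each edge ideal $I$ replaced by $IR_f$; for a prime $\mathfrak{p}$, $G_{\mathfrak{p}}$ is defined likewise over $R_{\mathfrak{p}}$. An edge of an edge-labeled graph over a ring $B$ is trivial if its label is the unit ideal $B$. The determining subgraphs of an edge-labeled graph are the connected components having at least one edge of the graph obtained by deleting all trivial edges. An edge-labeled graph over $B$ is regular $1$-mono if for each determining subgraph $H_i$ all edges of $H_i$ are labeled by the same ideal $I_i$, and $I_i$ is generated by a single regular element (non-zero-divisor) of $B$; a graph with all edges trivial is vacuously regular $1$-mono. $G$ is locally regular $1$-mono if either there is a standard open cover $\{U_f\}$ of $\operatorname{Spec}(R)$ such that each $G_f$ is regular $1$-mono, or $G_{\mathfrak{p}}$ is regular $1$-mono for every prime ideal $\mathfrak{p}$ of $R$. *)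

theory Defs
  imports "HOL-Algebra.Module" "HOL-Algebra.Indexed_Polynomials"
begin

section \<open>Localization\<close>

definition frac_rel :: "('a, 'r) ring_scheme \<Rightarrow> 'a set \<Rightarrow> (('a \<times> 'a) \<times> ('a \<times> 'a)) set" where
  "frac_rel R S =
     {((a, s), (b, t)). a \<in> carrier R \<and> s \<in> S \<and> b \<in> carrier R \<and> t \<in> S \<and>
        (\<exists>u\<in>S. u \<otimes>\<^bsub>R\<^esub> (a \<otimes>\<^bsub>R\<^esub> t \<ominus>\<^bsub>R\<^esub> b \<otimes>\<^bsub>R\<^esub> s) = \<zero>\<^bsub>R\<^esub>)}"

definition fraction :: "('a, 'r) ring_scheme \<Rightarrow> 'a set \<Rightarrow> 'a \<Rightarrow> 'a \<Rightarrow> ('a \<times> 'a) set" where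
  "fraction R S a s = frac_rel R S `` {(a, s)}"

text \<open>
  The sum and the product are unions over all representatives; each union is over a family of
  equal classes, as \<open>localization_add\<close> and \<open>localization_mult\<close> below show.
\<close>

definition localization :: "('a, 'r) ring_scheme \<Rightarrow> 'a set \<Rightarrow> ('a \<times> 'a) set ring" where
  "localization R S =
     \<lparr>carrier = (carrier R \<times> S) // frac_rel R S,
      monoid.mult = (\<lambda>P Q. \<Union>x\<in>P. \<Union>y\<in>Q.
                (case (x, y) of ((a, s), (b, t)) \<Rightarrow> fraction R S (a \<otimes>\<^bsub>R\<^esub> b) (s \<otimes>\<^bsub>R\<^esub> t))),
      one = fraction R S \<one>\<^bsub>R\<^esub> \<one>\<^bsub>R\<^esub>,
      zero = fraction R S \<zero>\<^bsub>R\<^esub> \<one>\<^bsub>R\<^esub>,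
      add = (\<lambda>P Q. \<Union>x\<in>P. \<Union>y\<in>Q.
               (case (x, y) of ((a, s), (b, t)) \<Rightarrow>
                  fraction R S (a \<otimes>\<^bsub>R\<^esub> t \<oplus>\<^bsub>R\<^esub> b \<otimes>\<^bsub>R\<^esub> s) (s \<otimes>\<^bsub>R\<^esub> t)))\<rparr>"

context
  fixes R :: "('a, 'r) ring_scheme" (structure) and S :: "'a set"
  assumes cring: "cring R" and sub: "S \<subseteq> carrier R" and one_S: "\<one> \<in> S"
    and mult_S: "\<And>s t. s \<in> S \<Longrightarrow> t \<in> S \<Longrightarrow> s \<otimes> t \<in> S"
begin

interpretation cring R by (rule cring)

lemma frac_relI:
  assumes "a \<in> carrier R" "s \<in> S" "b \<in> carrier R" "t \<in> S" "u \<in> S"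
    and "u \<otimes> (a \<otimes> t) = u \<otimes> (b \<otimes> s)"
  shows "((a, s), (b, t)) \<in> frac_rel R S"
proof -
  have "s \<in> carrier R" "t \<in> carrier R" "u \<in> carrier R" using assms sub by auto
  then have "u \<otimes> (a \<otimes> t \<ominus> b \<otimes> s) = u \<otimes> (a \<otimes> t) \<ominus> u \<otimes> (b \<otimes> s)"
    using assms(1,3) by (simp add: r_distr r_minus minus_eq)
  also have "\<dots> = \<zero>" using assms(6) assms(1,3) \<open>s \<in> carrier R\<close> \<open>u \<in> carrier R\<close> by simp
  finally show ?thesis using assms by (auto simp: frac_rel_def)
qed

lemma frac_relE:
  assumes "((a, s), (b, t)) \<in> frac_rel R S"
  obtains u where "a \<in> carrier R" "s \<in> S" "b \<in> carrier R" "t \<in> S" "u \<in> S"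
    "u \<otimes> (a \<otimes> t) = u \<otimes> (b \<otimes> s)"
proof -
  from assms obtain u where *: "a \<in> carrier R" "s \<in> S" "b \<in> carrier R" "t \<in> S" "u \<in> S"
    and eq: "u \<otimes> (a \<otimes> t \<ominus> b \<otimes> s) = \<zero>" by (auto simp: frac_rel_def)
  have c: "s \<in> carrier R" "t \<in> carrier R" "u \<in> carrier R" using * sub by auto
  then have "u \<otimes> (a \<otimes> t \<ominus> b \<otimes> s) = u \<otimes> (a \<otimes> t) \<ominus> u \<otimes> (b \<otimes> s)"
    using * by (simp add: r_distr r_minus minus_eq)
  then have "u \<otimes> (a \<otimes> t) = u \<otimes> (b \<otimes> s)" using eq c * r_right_minus_eq[of "u \<otimes> (a \<otimes> t)" "u \<otimes> (b \<otimes> s)"] by simp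
  then show ?thesis using that * by blast
qed

lemma frac_rel_equiv: "equiv (carrier R \<times> S) (frac_rel R S)"
proof (rule equivI)
  show "frac_rel R S \<subseteq> (carrier R \<times> S) \<times> (carrier R \<times> S)" by (auto simp: frac_rel_def)
  show "refl_on (carrier R \<times> S) (frac_rel R S)"
    using one_S by (auto intro!: refl_onI intro: frac_relI)
  show "sym (frac_rel R S)"
  proof (rule symI)
    fix x y assume "(x, y) \<in> frac_rel R S"
    then show "(y, x) \<in> frac_rel R S"
      by (cases x, cases y) (auto elim!: frac_relE intro: frac_relI)
  qed
  show "trans (frac_rel R S)"
  proof (rule transI)
    fix x y z assume xy: "(x, y) \<in> frac_rel R S" and yz: "(y, z) \<in> frac_rel R S"
    obtain a s b t c w where [simp]: "x = (a, s)" "y = (b, t)" "z = (c, w)"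
      by (cases x, cases y, cases z)
    from xy obtain u where u: "a \<in> carrier R" "s \<in> S" "b \<in> carrier R" "t \<in> S" "u \<in> S"
      "u \<otimes> (a \<otimes> t) = u \<otimes> (b \<otimes> s)" by (auto elim: frac_relE)
    from yz obtain v where v: "c \<in> carrier R" "w \<in> S" "v \<in> S"
      "v \<otimes> (b \<otimes> w) = v \<otimes> (c \<otimes> t)" by (auto elim: frac_relE)
    have car: "s \<in> carrier R" "t \<in> carrier R" "u \<in> carrier R" "v \<in> carrier R" "w \<in> carrier R"
      using u v sub by auto
    have "(u \<otimes> v \<otimes> t) \<otimes> (a \<otimes> w) = (v \<otimes> w) \<otimes> (u \<otimes> (a \<otimes> t))"
      using u(1,3) v(1) car by (simp add: m_ac)
    also have "\<dots> = (u \<otimes> s) \<otimes> (v \<otimes> (b \<otimes> w))"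
      unfolding u(6) using u(1,3) v(1) car by (simp add: m_ac)
    also have "\<dots> = (u \<otimes> v \<otimes> t) \<otimes> (c \<otimes> s)"
      unfolding v(4) using u(1,3) v(1) car by (simp add: m_ac)
    finally show "(x, z) \<in> frac_rel R S"
      using u v mult_S by (auto intro!: frac_relI[of _ _ _ _ "u \<otimes> v \<otimes> t"])
  qed
qed

lemma frac_eq_iff:
  assumes "a \<in> carrier R" "s \<in> S" "b \<in> carrier R" "t \<in> S"
  shows "fraction R S a s = fraction R S b t \<longleftrightarrow> (\<exists>u\<in>S. u \<otimes> (a \<otimes> t) = u \<otimes> (b \<otimes> s))"
proof -
  have "fraction R S a s = fraction R S b t \<longleftrightarrow> ((a, s), (b, t)) \<in> frac_rel R S"
    unfolding fraction_def using frac_rel_equiv assms by (auto simp: eq_equiv_class_iff)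
  then show ?thesis using assms by (auto elim!: frac_relE intro: frac_relI)
qed

lemma frac_self: "a \<in> carrier R \<Longrightarrow> s \<in> S \<Longrightarrow> (a, s) \<in> fraction R S a s"
  unfolding fraction_def using frac_rel_equiv by (auto simp: equiv_def refl_on_def)

lemma frac_memE:
  assumes "x \<in> fraction R S a s"
  obtains b t where "x = (b, t)" "b \<in> carrier R" "t \<in> S" "a \<in> carrier R" "s \<in> S"
    "fraction R S b t = fraction R S a s"
proof -
  obtain b t where x: "x = (b, t)" by (cases x)
  then have rel: "((a, s), (b, t)) \<in> frac_rel R S" using assms by (simp add: fraction_def)
  then have "fraction R S a s = fraction R S b t"
    unfolding fraction_def using frac_rel_equiv by (simp add: equiv_class_eq)
  then show ?thesis using that x rel by (auto elim: frac_relE)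
qed

lemma frac_mult_cong:
  assumes "a \<in> carrier R" "s \<in> S" "b \<in> carrier R" "t \<in> S"
    and "a' \<in> carrier R" "s' \<in> S" "b' \<in> carrier R" "t' \<in> S"
    and "fraction R S a s = fraction R S a' s'" "fraction R S b t = fraction R S b' t'"
  shows "fraction R S (a \<otimes> b) (s \<otimes> t) = fraction R S (a' \<otimes> b') (s' \<otimes> t')"
proof -
  obtain u v where u: "u \<in> S" "u \<otimes> (a \<otimes> s') = u \<otimes> (a' \<otimes> s)"
    and v: "v \<in> S" "v \<otimes> (b \<otimes> t') = v \<otimes> (b' \<otimes> t)"
    using assms by (auto simp: frac_eq_iff)
  have car: "s \<in> carrier R" "t \<in> carrier R" "s' \<in> carrier R" "t' \<in> carrier R"
    "u \<in> carrier R" "v \<in> carrier R" using assms(2,4,6,8) u(1) v(1) sub by auto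
  have "(u \<otimes> v) \<otimes> ((a \<otimes> b) \<otimes> (s' \<otimes> t')) = (u \<otimes> (a \<otimes> s')) \<otimes> (v \<otimes> (b \<otimes> t'))"
    using assms(1,3,5,7) car by (simp add: m_ac)
  also have "\<dots> = (u \<otimes> v) \<otimes> ((a' \<otimes> b') \<otimes> (s \<otimes> t))"
    unfolding u(2) v(2) using assms(1,3,5,7) car by (simp add: m_ac)
  finally show ?thesis using assms(1-8) u(1) v(1) mult_S by (auto simp: frac_eq_iff)
qed

lemma frac_add_cong:
  assumes "a \<in> carrier R" "s \<in> S" "b \<in> carrier R" "t \<in> S"
    and "a' \<in> carrier R" "s' \<in> S" "b' \<in> carrier R" "t' \<in> S"
    and "fraction R S a s = fraction R S a' s'" "fraction R S b t = fraction R S b' t'"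
  shows "fraction R S (a \<otimes> t \<oplus> b \<otimes> s) (s \<otimes> t) = fraction R S (a' \<otimes> t' \<oplus> b' \<otimes> s') (s' \<otimes> t')"
proof -
  obtain u v where u: "u \<in> S" "u \<otimes> (a \<otimes> s') = u \<otimes> (a' \<otimes> s)"
    and v: "v \<in> S" "v \<otimes> (b \<otimes> t') = v \<otimes> (b' \<otimes> t)"
    using assms by (auto simp: frac_eq_iff)
  have car: "s \<in> carrier R" "t \<in> carrier R" "s' \<in> carrier R" "t' \<in> carrier R"
    "u \<in> carrier R" "v \<in> carrier R" using assms(2,4,6,8) u(1) v(1) sub by auto
  have "(u \<otimes> v) \<otimes> ((a \<otimes> t \<oplus> b \<otimes> s) \<otimes> (s' \<otimes> t')) =
      (v \<otimes> t \<otimes> t') \<otimes> (u \<otimes> (a \<otimes> s')) \<oplus> (u \<otimes> s \<otimes> s') \<otimes> (v \<otimes> (b \<otimes> t'))"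
    using assms(1,3,5,7) car by (simp add: m_ac l_distr r_distr)
  also have "\<dots> = (u \<otimes> v) \<otimes> ((a' \<otimes> t' \<oplus> b' \<otimes> s') \<otimes> (s \<otimes> t))"
    unfolding u(2) v(2) using assms(1,3,5,7) car by (simp add: m_ac l_distr r_distr)
  finally have "\<exists>w\<in>S. w \<otimes> ((a \<otimes> t \<oplus> b \<otimes> s) \<otimes> (s' \<otimes> t')) = w \<otimes> ((a' \<otimes> t' \<oplus> b' \<otimes> s') \<otimes> (s \<otimes> t))"
    using u(1) v(1) mult_S by blast
  moreover have "a \<otimes> t \<oplus> b \<otimes> s \<in> carrier R" "a' \<otimes> t' \<oplus> b' \<otimes> s' \<in> carrier R"
    using assms(1,3,5,7) car by auto
  ultimately show ?thesis using assms(2,4,6,8) mult_S by (auto simp: frac_eq_iff)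
qed

lemma localization_mult:
  assumes "a \<in> carrier R" "s \<in> S" "b \<in> carrier R" "t \<in> S"
  shows "fraction R S a s \<otimes>\<^bsub>localization R S\<^esub> fraction R S b t = fraction R S (a \<otimes> b) (s \<otimes> t)"
proof -
  have "(case (x, y) of ((a, s), (b, t)) \<Rightarrow> fraction R S (a \<otimes> b) (s \<otimes> t)) = fraction R S (a \<otimes> b) (s \<otimes> t)"
    if "x \<in> fraction R S a s" "y \<in> fraction R S b t" for x y
    proof -
    obtain a' s' where x: "x = (a', s')" "a' \<in> carrier R" "s' \<in> S" "fraction R S a' s' = fraction R S a s"
      using \<open>x \<in> _\<close> by (rule frac_memE)
    obtain b' t' where y: "y = (b', t')" "b' \<in> carrier R" "t' \<in> S" "fraction R S b' t' = fraction R S b t"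
      using \<open>y \<in> _\<close> by (rule frac_memE)
    show ?thesis using frac_mult_cong[OF x(2,3) y(2,3) assms x(4) y(4)] x(1) y(1) by simp
  qed
  then have "(\<Union>x\<in>fraction R S a s. \<Union>y\<in>fraction R S b t.
      (case (x, y) of ((a, s), (b, t)) \<Rightarrow> fraction R S (a \<otimes> b) (s \<otimes> t))) = fraction R S (a \<otimes> b) (s \<otimes> t)"
    using frac_self[OF assms(1,2)] frac_self[OF assms(3,4)] by blast
  then show ?thesis by (simp add: localization_def)
qed

lemma localization_add:
  assumes "a \<in> carrier R" "s \<in> S" "b \<in> carrier R" "t \<in> S"
  shows "fraction R S a s \<oplus>\<^bsub>localization R S\<^esub> fraction R S b t = fraction R S (a \<otimes> t \<oplus> b \<otimes> s) (s \<otimes> t)"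
proof -
  have "(case (x, y) of ((a, s), (b, t)) \<Rightarrow> fraction R S (a \<otimes> t \<oplus> b \<otimes> s) (s \<otimes> t)) =
      fraction R S (a \<otimes> t \<oplus> b \<otimes> s) (s \<otimes> t)"
    if "x \<in> fraction R S a s" "y \<in> fraction R S b t" for x y
    proof -
    obtain a' s' where x: "x = (a', s')" "a' \<in> carrier R" "s' \<in> S" "fraction R S a' s' = fraction R S a s"
      using \<open>x \<in> _\<close> by (rule frac_memE)
    obtain b' t' where y: "y = (b', t')" "b' \<in> carrier R" "t' \<in> S" "fraction R S b' t' = fraction R S b t"
      using \<open>y \<in> _\<close> by (rule frac_memE)
    show ?thesis using frac_add_cong[OF x(2,3) y(2,3) assms x(4) y(4)] x(1) y(1) by simp
  qed
  then have "(\<Union>x\<in>fraction R S a s. \<Union>y\<in>fraction R S b t.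
      (case (x, y) of ((a, s), (b, t)) \<Rightarrow> fraction R S (a \<otimes> t \<oplus> b \<otimes> s) (s \<otimes> t))) =
      fraction R S (a \<otimes> t \<oplus> b \<otimes> s) (s \<otimes> t)"
    using frac_self[OF assms(1,2)] frac_self[OF assms(3,4)] by blast
  then show ?thesis by (simp add: localization_def)
qed

lemma localization_carrier:
  "carrier (localization R S) = {fraction R S a s |a s. a \<in> carrier R \<and> s \<in> S}"
  by (auto simp: localization_def quotient_def fraction_def)

lemma localization_one: "\<one>\<^bsub>localization R S\<^esub> = fraction R S \<one> \<one>"
  and localization_zero: "\<zero>\<^bsub>localization R S\<^esub> = fraction R S \<zero> \<one>"
  by (simp_all add: localization_def)

lemma localization_cring: "cring (localization R S)"
proof -
  let ?L = "localization R S"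
  note loc = localization_add localization_mult localization_carrier localization_one localization_zero
  have SC: "s \<in> carrier R" if "s \<in> S" for s using that sub by auto
  have eqI: "fraction R S a s = fraction R S b t"
    if "a \<in> carrier R" "s \<in> S" "b \<in> carrier R" "t \<in> S" "a \<otimes> t = b \<otimes> s" for a s b t
    using that one_S by (auto simp: frac_eq_iff)
  have elim: thesis if "P \<in> carrier ?L"
    "\<And>a s. P = fraction R S a s \<Longrightarrow> a \<in> carrier R \<Longrightarrow> s \<in> S \<Longrightarrow> s \<in> carrier R \<Longrightarrow> thesis" for P thesis
    using that sub by (auto simp: localization_carrier)
  show ?thesis
  proof (rule cringI)
    show "abelian_group ?L"
    proof (rule abelian_groupI)
      fix P assume P: "P \<in> carrier ?L"
      then obtain a s where as: "P = fraction R S a s" "a \<in> carrier R" "s \<in> S" "s \<in> carrier R"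
        by (rule elim)
      show "\<zero>\<^bsub>?L\<^esub> \<oplus>\<^bsub>?L\<^esub> P = P" using as one_S by (simp add: loc)
      have "fraction R S (\<ominus> a) s \<oplus>\<^bsub>?L\<^esub> P = \<zero>\<^bsub>?L\<^esub>"
        using as one_S mult_S by (simp add: loc l_minus l_neg) (intro eqI, simp_all)
      then show "\<exists>Q\<in>carrier ?L. Q \<oplus>\<^bsub>?L\<^esub> P = \<zero>\<^bsub>?L\<^esub>"
        using as(2,3) by (intro bexI[of _ "fraction R S (\<ominus> a) s"]) (auto simp: localization_carrier)
    next
      fix P Q assume "P \<in> carrier ?L" "Q \<in> carrier ?L"
      then obtain a s b t where *: "P = fraction R S a s" "a \<in> carrier R" "s \<in> S" "s \<in> carrier R"
        "Q = fraction R S b t" "b \<in> carrier R" "t \<in> S" "t \<in> carrier R" by (elim elim)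
      show "P \<oplus>\<^bsub>?L\<^esub> Q = Q \<oplus>\<^bsub>?L\<^esub> P" using * by (simp add: loc m_comm a_comm)
      show "P \<oplus>\<^bsub>?L\<^esub> Q \<in> carrier ?L"
        using * mult_S unfolding *(1,5) by (simp only: localization_add) (auto simp: localization_carrier)
    next
      fix P Q T assume "P \<in> carrier ?L" "Q \<in> carrier ?L" "T \<in> carrier ?L"
      then obtain a s b t c u where *: "P = fraction R S a s" "a \<in> carrier R" "s \<in> S" "s \<in> carrier R"
        "Q = fraction R S b t" "b \<in> carrier R" "t \<in> S" "t \<in> carrier R"
        "T = fraction R S c u" "c \<in> carrier R" "u \<in> S" "u \<in> carrier R" by (elim elim)
      show "P \<oplus>\<^bsub>?L\<^esub> Q \<oplus>\<^bsub>?L\<^esub> T = P \<oplus>\<^bsub>?L\<^esub> (Q \<oplus>\<^bsub>?L\<^esub> T)"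
      proof -
        have "(a \<otimes> t \<oplus> b \<otimes> s) \<otimes> u \<oplus> c \<otimes> (s \<otimes> t) =
            a \<otimes> (t \<otimes> u) \<oplus> (b \<otimes> u \<oplus> c \<otimes> t) \<otimes> s"
          using * by algebra
        then show ?thesis using * mult_S by (simp add: loc m_assoc)
      qed
    next
      show "\<zero>\<^bsub>?L\<^esub> \<in> carrier ?L" using one_S by (auto simp: localization_zero localization_carrier)
    qed
    show "comm_monoid ?L"
    proof (rule comm_monoidI)
      show "\<one>\<^bsub>?L\<^esub> \<in> carrier ?L" using one_S by (auto simp: localization_one localization_carrier)
    next
      fix P assume "P \<in> carrier ?L"
      then obtain a s where as: "P = fraction R S a s" "a \<in> carrier R" "s \<in> S" "s \<in> carrier R"
        by (rule elim)
      show "\<one>\<^bsub>?L\<^esub> \<otimes>\<^bsub>?L\<^esub> P = P" using as one_S by (simp add: loc)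
    next
      fix P Q assume "P \<in> carrier ?L" "Q \<in> carrier ?L"
      then obtain a s b t where *: "P = fraction R S a s" "a \<in> carrier R" "s \<in> S" "s \<in> carrier R"
        "Q = fraction R S b t" "b \<in> carrier R" "t \<in> S" "t \<in> carrier R" by (elim elim)
      show "P \<otimes>\<^bsub>?L\<^esub> Q = Q \<otimes>\<^bsub>?L\<^esub> P" using * by (simp add: loc m_comm)
      show "P \<otimes>\<^bsub>?L\<^esub> Q \<in> carrier ?L"
        using * mult_S unfolding *(1,5) by (simp only: localization_mult) (auto simp: localization_carrier)
    next
      fix P Q T assume "P \<in> carrier ?L" "Q \<in> carrier ?L" "T \<in> carrier ?L"
      then obtain a s b t c u where *: "P = fraction R S a s" "a \<in> carrier R" "s \<in> S" "s \<in> carrier R"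
        "Q = fraction R S b t" "b \<in> carrier R" "t \<in> S" "t \<in> carrier R"
        "T = fraction R S c u" "c \<in> carrier R" "u \<in> S" "u \<in> carrier R" by (elim elim)
      show "P \<otimes>\<^bsub>?L\<^esub> Q \<otimes>\<^bsub>?L\<^esub> T = P \<otimes>\<^bsub>?L\<^esub> (Q \<otimes>\<^bsub>?L\<^esub> T)"
        using * mult_S by (simp add: loc m_ac)
    qed
  next
    fix P Q T assume "P \<in> carrier ?L" "Q \<in> carrier ?L" "T \<in> carrier ?L"
    then obtain a s b t c u where *: "P = fraction R S a s" "a \<in> carrier R" "s \<in> S" "s \<in> carrier R"
      "Q = fraction R S b t" "b \<in> carrier R" "t \<in> S" "t \<in> carrier R"
      "T = fraction R S c u" "c \<in> carrier R" "u \<in> S" "u \<in> carrier R" by (elim elim)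
    have "(P \<oplus>\<^bsub>?L\<^esub> Q) \<otimes>\<^bsub>?L\<^esub> T = fraction R S ((a \<otimes> t \<oplus> b \<otimes> s) \<otimes> c) (s \<otimes> t \<otimes> u)"
      using * mult_S by (simp add: loc)
    also have "\<dots> = fraction R S ((a \<otimes> c) \<otimes> (t \<otimes> u) \<oplus> (b \<otimes> c) \<otimes> (s \<otimes> u)) ((s \<otimes> u) \<otimes> (t \<otimes> u))"
      using * mult_S by (intro eqI) (simp_all add: l_distr r_distr m_ac)
    also have "\<dots> = P \<otimes>\<^bsub>?L\<^esub> T \<oplus>\<^bsub>?L\<^esub> Q \<otimes>\<^bsub>?L\<^esub> T"
      using * mult_S by (simp add: loc)
    finally show "(P \<oplus>\<^bsub>?L\<^esub> Q) \<otimes>\<^bsub>?L\<^esub> T = P \<otimes>\<^bsub>?L\<^esub> T \<oplus>\<^bsub>?L\<^esub> Q \<otimes>\<^bsub>?L\<^esub> T" .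
  qed
qed

end

definition extended_ideal :: "('a, 'r) ring_scheme \<Rightarrow> 'a set \<Rightarrow> 'a set \<Rightarrow> ('a \<times> 'a) set set" where
  "extended_ideal R S I = Idl\<^bsub>localization R S\<^esub> ((\<lambda>a. fraction R S a \<one>\<^bsub>R\<^esub>) ` I)"

definition powers_of :: "('a, 'r) ring_scheme \<Rightarrow> 'a \<Rightarrow> 'a set" where
  "powers_of R f = {f [^]\<^bsub>R\<^esub> n |n::nat. True}"

definition prime_spectrum :: "('a, 'r) ring_scheme \<Rightarrow> 'a set set" where
  "prime_spectrum R = {\<pp>. primeideal \<pp> R}"

definition basic_open :: "('a, 'r) ring_scheme \<Rightarrow> 'a \<Rightarrow> 'a set set" where
  "basic_open R f = {\<pp> \<in> prime_spectrum R. f \<notin> \<pp>}"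


section \<open>Modules\<close>

definition module_hom ::
    "('a, 'r) ring_scheme \<Rightarrow> ('a, 'm, 's) module_scheme \<Rightarrow> ('a, 'n, 't) module_scheme \<Rightarrow> ('m \<Rightarrow> 'n) set" where
  "module_hom R M N =
     {h \<in> carrier M \<rightarrow> carrier N.
        (\<forall>x\<in>carrier M. \<forall>y\<in>carrier M. h (x \<oplus>\<^bsub>M\<^esub> y) = h x \<oplus>\<^bsub>N\<^esub> h y) \<and>
        (\<forall>a\<in>carrier R. \<forall>x\<in>carrier M. h (a \<odot>\<^bsub>M\<^esub> x) = a \<odot>\<^bsub>N\<^esub> h x)}"

definition fin_gen_module :: "('a, 'r) ring_scheme \<Rightarrow> ('a, 'm, 's) module_scheme \<Rightarrow> bool" where
  "fin_gen_module R M \<longleftrightarrow> module R M \<and>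
     (\<exists>B. finite B \<and> B \<subseteq> carrier M \<and>
        (\<forall>x\<in>carrier M. \<exists>c\<in>B \<rightarrow> carrier R. x = (\<Oplus>\<^bsub>M\<^esub>b\<in>B. c b \<odot>\<^bsub>M\<^esub> b)))"

definition is_module_basis :: "('a, 'r) ring_scheme \<Rightarrow> ('a, 'm, 's) module_scheme \<Rightarrow> 'm set \<Rightarrow> bool" where
  "is_module_basis R M B \<longleftrightarrow> B \<subseteq> carrier M \<and>
     (\<forall>x\<in>carrier M. \<exists>F c. finite F \<and> F \<subseteq> B \<and> c \<in> F \<rightarrow> carrier R \<and>
        x = (\<Oplus>\<^bsub>M\<^esub>b\<in>F. c b \<odot>\<^bsub>M\<^esub> b)) \<and>
     (\<forall>F c. finite F \<and> F \<subseteq> B \<and> c \<in> F \<rightarrow> carrier R \<and> (\<Oplus>\<^bsub>M\<^esub>b\<in>F. c b \<odot>\<^bsub>M\<^esub> b) = \<zero>\<^bsub>M\<^esub> \<longrightarrow>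
        (\<forall>b\<in>F. c b = \<zero>\<^bsub>R\<^esub>))"

definition free_module :: "('a, 'r) ring_scheme \<Rightarrow> ('a, 'm, 's) module_scheme \<Rightarrow> bool" where
  "free_module R M \<longleftrightarrow> module R M \<and> (\<exists>B. is_module_basis R M B)"

text \<open>
  Projectivity is the lifting property against surjections \<open>g : N \<rightarrow> L\<close>.  HOL cannot quantify over
  the types carrying \<open>N\<close> and \<open>L\<close>, so these types are parameters; a theorem that concludes
  \<open>projective_module TYPE('n) TYPE('l) R P\<close> with free type variables asserts the lifting property
  for modules carried by arbitrary types.
\<close>

definition projective_module ::
    "'n itself \<Rightarrow> 'l itself \<Rightarrow> ('a, 'r) ring_scheme \<Rightarrow> ('a, 'm, 's) module_scheme \<Rightarrow> bool" where
  "projective_module (_ :: 'n itself) (_ :: 'l itself) R P \<longleftrightarrow> module R P \<and>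
     (\<forall>(N :: ('a, 'n) module) (L :: ('a, 'l) module) g h.
        module R N \<and> module R L \<and>
        g \<in> module_hom R N L \<and> g ` carrier N = carrier L \<and> h \<in> module_hom R P L \<longrightarrow>
        (\<exists>k\<in>module_hom R P N. \<forall>x\<in>carrier P. g (k x) = h x))"


section \<open>Polynomial rings in finitely many variables\<close>

text \<open>
  A polynomial is the function sending a monomial, i.e. a multiset of variables, to its coefficient.
  The theory \<open>HOL-Algebra.Indexed_Polynomials\<close> provides the underlying set, with its addition and
  constants, but no general product.  The variables are indexed by \<open>0, \<dots>, n - 1\<close>.
\<close>

definition mpoly_ring :: "('a, 'r) ring_scheme \<Rightarrow> nat \<Rightarrow> (nat multiset \<Rightarrow> 'a) ring" where
  "mpoly_ring A n =
     \<lparr>carrier = ring.indexed_pset A {..<n} (carrier A),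
      monoid.mult = (\<lambda>p q m. \<Oplus>\<^bsub>A\<^esub>k\<in>{k. k \<subseteq># m}. p k \<otimes>\<^bsub>A\<^esub> q (m - k)),
      one = ring.indexed_const A \<one>\<^bsub>A\<^esub>,
      zero = ring.indexed_const A \<zero>\<^bsub>A\<^esub>,
      add = ring.indexed_padd A\<rparr>"


section \<open>Edge-labeled graphs and splines\<close>

text \<open>
  Edges are abstract objects with a set of one or two endpoints, so that parallel edges and loops
  are permitted; a simple graph is the case in which \<open>ends\<close> is injective with two-element values.
\<close>

record ('v, 'e, 'b) elgraph =
  verts :: "'v set"
  edges :: "'e set"
  ends :: "'e \<Rightarrow> 'v set"
  label :: "'e \<Rightarrow> 'b set"

definition edge_labeled_graph :: "('b, 'r) ring_scheme \<Rightarrow> ('v, 'e, 'b) elgraph \<Rightarrow> bool" where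
  "edge_labeled_graph B G \<longleftrightarrow> finite (verts G) \<and> finite (edges G) \<and>
     (\<forall>e\<in>edges G. ends G e \<subseteq> verts G \<and> card (ends G e) \<in> {1, 2} \<and> ideal (label G e) B)"

definition splines :: "('b, 'r) ring_scheme \<Rightarrow> ('v, 'e, 'b) elgraph \<Rightarrow> ('v \<Rightarrow> 'b) set" where
  "splines B G =
     {s \<in> verts G \<rightarrow>\<^sub>E carrier B.
        \<forall>e\<in>edges G. \<forall>u v. ends G e = {u, v} \<longrightarrow> s u \<ominus>\<^bsub>B\<^esub> s v \<in> label G e}"

definition spline_ring :: "('b, 'r) ring_scheme \<Rightarrow> ('v, 'e, 'b) elgraph \<Rightarrow> ('b, 'v \<Rightarrow> 'b) module" where
  "spline_ring B G =
     \<lparr>carrier = splines B G,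
      monoid.mult = (\<lambda>s t. \<lambda>v\<in>verts G. s v \<otimes>\<^bsub>B\<^esub> t v),
      one = (\<lambda>v\<in>verts G. \<one>\<^bsub>B\<^esub>),
      zero = (\<lambda>v\<in>verts G. \<zero>\<^bsub>B\<^esub>),
      add = (\<lambda>s t. \<lambda>v\<in>verts G. s v \<oplus>\<^bsub>B\<^esub> t v),
      smult = (\<lambda>r s. \<lambda>v\<in>verts G. r \<otimes>\<^bsub>B\<^esub> s v)\<rparr>"

lemma spline_ring_algebra:
  assumes "cring R" and "edge_labeled_graph R G"
  shows "algebra R (spline_ring R G)"
proof -
  interpret cring R by fact
  have E: "ends G e \<subseteq> verts G" "ideal (label G e) R" if "e \<in> edges G" for e
    using assms(2) that by (auto simp: edge_labeled_graph_def)
  have val: "s v \<in> carrier R" if "s \<in> splines R G" "v \<in> verts G" for s v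
    using that by (auto simp: splines_def)
  have lab: "s u \<ominus>\<^bsub>R\<^esub> s v \<in> label G e" "u \<in> verts G" "v \<in> verts G"
    if "s \<in> splines R G" "e \<in> edges G" "ends G e = {u, v}" for s e u v
    using that E(1)[OF that(2)] by (auto simp: splines_def)
  have I: "(\<lambda>v\<in>verts G. f v) \<in> splines R G"
    if "\<And>v. v \<in> verts G \<Longrightarrow> f v \<in> carrier R"
      and "\<And>e u v. e \<in> edges G \<Longrightarrow> ends G e = {u, v} \<Longrightarrow> u \<in> verts G \<Longrightarrow> v \<in> verts G \<Longrightarrow>
             f u \<ominus>\<^bsub>R\<^esub> f v \<in> label G e" for f
    using that E(1) by (fastforce simp: splines_def)
  have ext: "(\<lambda>v\<in>verts G. f v) = s"
    if "s \<in> splines R G" "\<And>v. v \<in> verts G \<Longrightarrow> f v = s v" for f s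
  proof
    fix v show "(\<lambda>v\<in>verts G. f v) v = s v"
      using that PiE_arb[of s "verts G" _ v] by (cases "v \<in> verts G") (auto simp: splines_def)
  qed
  have const: "(\<lambda>v\<in>verts G. r) \<in> splines R G" if "r \<in> carrier R" for r
  proof (rule I)
    fix e assume "e \<in> edges G"
    then have "\<zero>\<^bsub>R\<^esub> \<in> label G e"
      using E(2) by (simp add: additive_subgroup.zero_closed ideal.axioms(1))
    then show "r \<ominus>\<^bsub>R\<^esub> r \<in> label G e" using that by (simp add: minus_eq r_neg)
  qed (use that in auto)
  have add: "(\<lambda>v\<in>verts G. s v \<oplus>\<^bsub>R\<^esub> t v) \<in> splines R G"
    if s: "s \<in> splines R G" and t: "t \<in> splines R G" for s t
  proof (rule I)
    fix e u v assume e: "e \<in> edges G" "ends G e = {u, v}" "u \<in> verts G" "v \<in> verts G"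
    have c: "s u \<in> carrier R" "s v \<in> carrier R" "t u \<in> carrier R" "t v \<in> carrier R"
      using val s t e by auto
    have "(s u \<ominus>\<^bsub>R\<^esub> s v) \<oplus>\<^bsub>R\<^esub> (t u \<ominus>\<^bsub>R\<^esub> t v) \<in> label G e"
      using lab[OF s e(1,2)] lab[OF t e(1,2)] E(2)[OF e(1)]
      by (auto intro: additive_subgroup.a_closed ideal.axioms(1))
    also have "(s u \<ominus>\<^bsub>R\<^esub> s v) \<oplus>\<^bsub>R\<^esub> (t u \<ominus>\<^bsub>R\<^esub> t v) = (s u \<oplus>\<^bsub>R\<^esub> t u) \<ominus>\<^bsub>R\<^esub> (s v \<oplus>\<^bsub>R\<^esub> t v)"
      using c by (simp add: minus_eq minus_add a_ac)
    finally show "(s u \<oplus>\<^bsub>R\<^esub> t u) \<ominus>\<^bsub>R\<^esub> (s v \<oplus>\<^bsub>R\<^esub> t v) \<in> label G e" .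
  qed (use val s t in auto)
  have mult: "(\<lambda>v\<in>verts G. s v \<otimes>\<^bsub>R\<^esub> t v) \<in> splines R G"
    if s: "s \<in> splines R G" and t: "t \<in> splines R G" for s t
  proof (rule I)
    fix e u v assume e: "e \<in> edges G" "ends G e = {u, v}" "u \<in> verts G" "v \<in> verts G"
    have c: "s u \<in> carrier R" "s v \<in> carrier R" "t u \<in> carrier R" "t v \<in> carrier R"
      using val s t e by auto
    interpret L: ideal "label G e" R by (rule E(2)[OF e(1)])
    have "s u \<otimes>\<^bsub>R\<^esub> (t u \<ominus>\<^bsub>R\<^esub> t v) \<oplus>\<^bsub>R\<^esub> (s u \<ominus>\<^bsub>R\<^esub> s v) \<otimes>\<^bsub>R\<^esub> t v \<in> label G e"
      using lab[OF s e(1,2)] lab[OF t e(1,2)] c by (auto intro: L.I_l_closed L.I_r_closed)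
    also have "s u \<otimes>\<^bsub>R\<^esub> (t u \<ominus>\<^bsub>R\<^esub> t v) \<oplus>\<^bsub>R\<^esub> (s u \<ominus>\<^bsub>R\<^esub> s v) \<otimes>\<^bsub>R\<^esub> t v
        = (s u \<otimes>\<^bsub>R\<^esub> t u) \<ominus>\<^bsub>R\<^esub> (s v \<otimes>\<^bsub>R\<^esub> t v)"
      using c by algebra
    finally show "(s u \<otimes>\<^bsub>R\<^esub> t u) \<ominus>\<^bsub>R\<^esub> (s v \<otimes>\<^bsub>R\<^esub> t v) \<in> label G e" .
  qed (use val s t in auto)
  have smult: "(\<lambda>v\<in>verts G. r \<otimes>\<^bsub>R\<^esub> s v) \<in> splines R G"
    if r: "r \<in> carrier R" and s: "s \<in> splines R G" for r s
  proof -
    have "(\<lambda>v\<in>verts G. (\<lambda>v\<in>verts G. r) v \<otimes>\<^bsub>R\<^esub> s v) \<in> splines R G" by (rule mult[OF const[OF r] s])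
    also have "(\<lambda>v\<in>verts G. (\<lambda>v\<in>verts G. r) v \<otimes>\<^bsub>R\<^esub> s v) = (\<lambda>v\<in>verts G. r \<otimes>\<^bsub>R\<^esub> s v)" by auto
    finally show ?thesis .
  qed
  note facts = const add mult smult val
  have neg: "\<exists>t\<in>splines R G. (\<lambda>v\<in>verts G. t v \<oplus>\<^bsub>R\<^esub> s v) = (\<lambda>v\<in>verts G. \<zero>\<^bsub>R\<^esub>)" if "s \<in> splines R G" for s
    using smult[OF a_inv_closed[OF one_closed] that] val[OF that]
    by (intro bexI[of _ "\<lambda>v\<in>verts G. (\<ominus>\<^bsub>R\<^esub> \<one>\<^bsub>R\<^esub>) \<otimes>\<^bsub>R\<^esub> s v"])
       (auto simp: l_minus l_neg intro!: restrict_ext)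
  have ag: "abelian_group (spline_ring R G)"
    by (rule abelian_groupI)
       (auto simp: spline_ring_def facts a_ac neg intro!: restrict_ext ext)
  have cm: "comm_monoid (spline_ring R G)"
    by (rule comm_monoidI)
       (auto simp: spline_ring_def facts m_ac intro!: restrict_ext ext)
  have cr: "cring (spline_ring R G)"
    by (rule cringI[OF ag cm]) (auto simp: spline_ring_def facts l_distr intro!: restrict_ext)
  show ?thesis
    by (rule algebraI[OF assms(1) cr])
       (auto simp: spline_ring_def facts l_distr r_distr m_assoc intro!: restrict_ext ext)
qed

definition localized_graph ::
    "('a, 'r) ring_scheme \<Rightarrow> 'a set \<Rightarrow> ('v, 'e, 'a) elgraph \<Rightarrow> ('v, 'e, ('a \<times> 'a) set) elgraph" where
  "localized_graph R S G =
     \<lparr>verts = verts G, edges = edges G, ends = ends G,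
      label = (\<lambda>e. extended_ideal R S (label G e))\<rparr>"


section \<open>Locally regular 1-mono graphs\<close>

definition delete_trivial_edges ::
    "('b, 'r) ring_scheme \<Rightarrow> ('v, 'e, 'b) elgraph \<Rightarrow> ('v, 'e, 'b) elgraph" where
  "delete_trivial_edges B G = G\<lparr>edges := {e \<in> edges G. label G e \<noteq> carrier B}\<rparr>"

definition adjacent :: "('v, 'e, 'b) elgraph \<Rightarrow> ('v \<times> 'v) set" where
  "adjacent G = {(u, v). \<exists>e\<in>edges G. ends G e = {u, v}}"

definition connected_components :: "('v, 'e, 'b) elgraph \<Rightarrow> ('v, 'e, 'b) elgraph set" where
  "connected_components G =
     {G\<lparr>verts := C, edges := {e \<in> edges G. ends G e \<subseteq> C}\<rparr> |C.
        \<exists>v\<in>verts G. C = (adjacent G)\<^sup>* `` {v}}"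

definition determining_subgraphs ::
    "('b, 'r) ring_scheme \<Rightarrow> ('v, 'e, 'b) elgraph \<Rightarrow> ('v, 'e, 'b) elgraph set" where
  "determining_subgraphs B G =
     {H \<in> connected_components (delete_trivial_edges B G). edges H \<noteq> {}}"

definition regular_element :: "('b, 'r) ring_scheme \<Rightarrow> 'b \<Rightarrow> bool" where
  "regular_element B a \<longleftrightarrow>
     a \<in> carrier B \<and> (\<forall>b\<in>carrier B. a \<otimes>\<^bsub>B\<^esub> b = \<zero>\<^bsub>B\<^esub> \<longrightarrow> b = \<zero>\<^bsub>B\<^esub>)"

definition regular_1_mono :: "('b, 'r) ring_scheme \<Rightarrow> ('v, 'e, 'b) elgraph \<Rightarrow> bool" where
  "regular_1_mono B G \<longleftrightarrow>
     (\<forall>H\<in>determining_subgraphs B G.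
        \<exists>I. (\<forall>e\<in>edges H. label H e = I) \<and> (\<exists>a. regular_element B a \<and> I = PIdl\<^bsub>B\<^esub> a))"

definition locally_regular_1_mono :: "('a, 'r) ring_scheme \<Rightarrow> ('v, 'e, 'a) elgraph \<Rightarrow> bool" where
  "locally_regular_1_mono R G \<longleftrightarrow>
     (\<exists>F \<subseteq> carrier R. (\<Union>f\<in>F. basic_open R f) = prime_spectrum R \<and>
        (\<forall>f\<in>F. regular_1_mono (localization R (powers_of R f))
                  (localized_graph R (powers_of R f) G))) \<or>
     (\<forall>\<pp>\<in>prime_spectrum R.
        regular_1_mono (localization R (carrier R - \<pp>)) (localized_graph R (carrier R - \<pp>) G))"

end

theory Submission
  imports Defs "HOL-Algebra.UnivPoly"
begin

text \<open>
  For a set \<open>W\<close> of vertices and a further vertex \<open>v\<close>, let \<open>J\<close> be the ideal of values at \<open>v\<close> of the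
  splines vanishing on \<open>W\<close>.  Near a prime \<open>\<pp>\<close> the value at \<open>v\<close> is unconstrained if the component of
  \<open>v\<close> among the edges with label inside \<open>\<pp>\<close> avoids \<open>W\<close>, and otherwise it is constrained exactly
  by the common regular generator of the labels of that component.  So \<open>J\<close> is locally generated by one
  regular element; being finitely generated, it is projective, with an explicit dual basis.  Adding
  the vertices one by one splits off these ideals, so the spline module is a direct sum of such ideals.

  If \<open>R\<close> is a unique factorization domain, each \<open>J\<close> is principal: after removing the prime divisors
  common to all its elements, a local generator \<open>x\<close> with \<open>s J \<subseteq> R x\<close> must divide \<open>s\<close>, so \<open>J = R\<close>.
  Hence the spline module is free, and the theorem of Quillen and Suslin is not needed; Gauss's lemma
  covers polynomial rings.
\<close>

section \<open>Unique factorization and Gauss's lemma\<close>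

text \<open>Over a ring that need not be Noetherian, the splines vanishing on \<open>W\<close> have
  no evident reason to form a finitely generated module, and the ideal \<open>J\<close> inherits
  that doubt; yet a multiplier that works for all of \<open>J\<close> at once is obtained from
  finitely many generators. Therefore the induction over the vertices carries a projection
  \<open>\<rho>\<close> of the whole spline module onto the current kernel. Then \<open>J\<close> is
  the image of the finitely generated spline module under evaluation at \<open>v\<close> after
  \<open>\<rho>\<close>, and the dual basis of \<open>J\<close>, lifted to the kernel, produces the
  next projection.

  No localized module is formed. A property at a prime P is expressed as one that holds after
  multiplication by some element outside P, and it becomes global because the ideal of admissible
  multipliers lies in no prime. Both alternatives of the locality hypothesis reduce to this form,
  through a multiplicative set that misses P.

  The projective and the free case share one induction; freeness is the additional condition that
  the dual basis is orthonormal.\<close>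

inductive_set prime_products :: "('a, 'r) ring_scheme \<Rightarrow> 'a set" for R (structure) where
  unit: "u \<in> Units R \<Longrightarrow> u \<in> prime_products R"
| mult: "\<lbrakk>p \<in> carrier R; ring_prime p; a \<in> prime_products R\<rbrakk> \<Longrightarrow> p \<otimes> a \<in> prime_products R"

text \<open>Existence of prime factorizations characterizes unique factorization domains, because
  factorizations into primes are automatically unique. In this form an argument about an element is
  an induction that removes one prime at a time, without gcds or multisets of factors.\<close>

definition ufd :: "('a, 'r) ring_scheme \<Rightarrow> bool" where
  "ufd R \<longleftrightarrow> domain R \<and> carrier R - {\<zero>\<^bsub>R\<^esub>} \<subseteq> prime_products R"

lemma ring_primeD:
  assumes "ring_prime\<^bsub>R\<^esub> p"
  shows "p \<noteq> \<zero>\<^bsub>R\<^esub>" "p \<notin> Units R"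
    and "\<And>a b. \<lbrakk>a \<in> carrier R; b \<in> carrier R; p divides\<^bsub>R\<^esub> (a \<otimes>\<^bsub>R\<^esub> b)\<rbrakk>
          \<Longrightarrow> p divides\<^bsub>R\<^esub> a \<or> p divides\<^bsub>R\<^esub> b"
  using assms by (auto simp: ring_prime_def prime_def)

lemma (in cring) prime_products_closed: "a \<in> prime_products R \<Longrightarrow> a \<in> carrier R"
  by (induction rule: prime_products.induct) auto

lemma (in domain) prime_products_mult:
  assumes "a \<in> prime_products R" "b \<in> prime_products R"
  shows "a \<otimes> b \<in> prime_products R"
  using assms
proof (induction rule: prime_products.induct)
  case (unit u)
  from unit(2,1) show ?case
  proof (induction rule: prime_products.induct)
    case (unit v)
    then show ?case by (auto intro: prime_products.unit)
  next
    case (mult p a)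
    then have "u \<otimes> (p \<otimes> a) = p \<otimes> (u \<otimes> a)"
      using prime_products_closed by (auto simp: m_ac)
    then show ?case using mult by (auto intro: prime_products.mult)
  qed
next
  case (mult p a)
  then have "p \<otimes> a \<otimes> b = p \<otimes> (a \<otimes> b)" using prime_products_closed by (auto simp: m_assoc)
  then show ?case using mult by (auto intro: prime_products.mult)
qed

text \<open>Factorization into irreducibles takes place in the monoid \<open>mult_of R\<close> of
  nonzero elements; irreducibles of a principal domain are prime there, and
  \<open>ring_primeI'\<close> carries primality back to \<open>R\<close>.\<close>

lemma (in principal_domain) principal_domain_ufd: "ufd R"
  unfolding ufd_def
proof (intro conjI subsetI)
  show "domain R" by (rule domain_axioms)
  fix a assume a: "a \<in> carrier R - {\<zero>}"
  show "a \<in> prime_products R"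
  proof (cases "a \<in> Units R")
    case False
    then obtain fs where fs: "set fs \<subseteq> carrier (mult_of R)" "factors (mult_of R) fs a"
      using mult_of.factors_exist[of a] a by auto
    have "foldr (\<otimes>) fs \<one> \<in> prime_products R"
      if "set fs \<subseteq> carrier (mult_of R)" "\<forall>f\<in>set fs. irreducible (mult_of R) f" for fs
      using that
    proof (induction fs)
      case Nil
      then show ?case by (auto intro: prime_products.unit)
    next
      case (Cons p fs)
      have "prime (mult_of R) p" using Cons mult_of.irreducible_prime[of p] by auto
      then have "ring_prime p" using Cons ring_primeI'[of p] by auto
      then show ?case using Cons by (auto intro: prime_products.mult)
    qed
    then show ?thesis using fs by (auto simp: factors_def)
  qed (rule prime_products.unit)
qed

section \<open>Divisibility in commutative rings\<close>

context cring
begin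

lemma divides_intro: "c \<in> carrier R \<Longrightarrow> b = a \<otimes> c \<Longrightarrow> a divides b"
  by (auto simp: factor_def)

lemma divides_add:
  assumes "p \<in> carrier R" "p divides a" "p divides b"
  shows "p divides (a \<oplus> b)"
proof -
  obtain c d where "c \<in> carrier R" "d \<in> carrier R" "a = p \<otimes> c" "b = p \<otimes> d"
    using assms by (auto simp: factor_def)
  then show ?thesis using assms by (intro divides_intro[of "c \<oplus> d"]) (auto simp: r_distr)
qed

lemma divides_mult_right:
  assumes "p \<in> carrier R" "p divides a" "b \<in> carrier R"
  shows "p divides (a \<otimes> b)" "p divides (b \<otimes> a)"
proof -
  obtain c where c: "c \<in> carrier R" "a = p \<otimes> c"
    using assms by (auto simp: factor_def)
  then show "p divides (a \<otimes> b)" "p divides (b \<otimes> a)"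
    using assms by (auto intro!: divides_intro[of "c \<otimes> b"] simp: m_ac)
qed

lemma divides_finsum:
  assumes "p \<in> carrier R" "finite A" "\<And>x. x \<in> A \<Longrightarrow> f x \<in> carrier R" "\<And>x. x \<in> A \<Longrightarrow> p divides (f x)"
  shows "p divides (\<Oplus>x\<in>A. f x)"
  using assms(2-)
proof (induction rule: finite_induct)
  case empty
  then show ?case using assms(1) by (simp add: divides_zero)
next
  case (insert x F)
  then show ?case using assms(1) by (auto intro: divides_add)
qed

lemma divides_add_cancel:
  assumes "p \<in> carrier R" "a \<in> carrier R" "b \<in> carrier R" "p divides (a \<oplus> b)" "p divides b"
  shows "p divides a"
proof -
  obtain c d where cd: "c \<in> carrier R" "d \<in> carrier R" "a \<oplus> b = p \<otimes> c" "b = p \<otimes> d"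
    using assms by (auto simp: factor_def)
  have "a = (a \<oplus> b) \<ominus> b" using assms(2,3) by algebra
  also have "\<dots> = p \<otimes> (c \<ominus> d)" using cd(3)
    by (subst cd(4)) (use cd(1,2) assms(1) in algebra)
  finally show ?thesis using cd by (intro divides_intro) auto
qed

lemma divides_unit:
  assumes "p \<in> carrier R" "p divides u" "u \<in> Units R"
  shows "p \<in> Units R"
proof -
  have "p divides (u \<otimes> inv u)"
    using assms by (intro divides_mult_right) auto
  then show ?thesis using assms divides_one by simp
qed

end

section \<open>Gauss's lemma for univariate polynomials\<close>

context UP_domain
begin

abbreviation const :: "'a \<Rightarrow> nat \<Rightarrow> 'a" where "const c \<equiv> up_ring.monom P c 0"

lemma const_closed: "c \<in> carrier R \<Longrightarrow> const c \<in> carrier P"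
  by simp

lemma coeff_const_mult:
  "\<lbrakk>c \<in> carrier R; f \<in> carrier P\<rbrakk> \<Longrightarrow> up_ring.coeff P (const c \<otimes>\<^bsub>P\<^esub> f) i = c \<otimes> up_ring.coeff P f i"
  by (simp add: monom_mult_is_smult)

lemma const_mult: "\<lbrakk>c \<in> carrier R; d \<in> carrier R\<rbrakk> \<Longrightarrow> const (c \<otimes> d) = const c \<otimes>\<^bsub>P\<^esub> const d"
  using monom_mult[of c d 0 0] by simp

lemma const_eq_zero_iff: "c \<in> carrier R \<Longrightarrow> const c = \<zero>\<^bsub>P\<^esub> \<longleftrightarrow> c = \<zero>"
  using monom_inj[of 0] by (metis inj_onD R.zero_closed monom_zero)

lemma const_divides_iff:
  assumes c: "c \<in> carrier R" and f: "f \<in> carrier P"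
  shows "const c divides\<^bsub>P\<^esub> f \<longleftrightarrow> (\<forall>i. c divides (up_ring.coeff P f i))"
proof
  assume "const c divides\<^bsub>P\<^esub> f"
  then obtain g where "g \<in> carrier P" "f = const c \<otimes>\<^bsub>P\<^esub> g" by (auto simp: factor_def)
  then show "\<forall>i. c divides (up_ring.coeff P f i)"
    using c R.divides_intro[OF coeff_closed] by (simp add: coeff_const_mult del: coeff_mult)
next
  assume *: "\<forall>i. c divides (up_ring.coeff P f i)"
  \<comment> \<open>The case split makes \<open>h\<close> vanish wherever \<open>f\<close> does,
    hence makes it a polynomial. For \<open>c = \<zero>\<close> the choice alone would not guarantee
    this.\<close>
  define h where "h i = (if up_ring.coeff P f i = \<zero> then \<zero> else SOME r. r \<in> carrier R \<and> up_ring.coeff P f i = c \<otimes> r)" for i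
  have h: "h i \<in> carrier R \<and> up_ring.coeff P f i = c \<otimes> h i" for i
  proof (cases "up_ring.coeff P f i = \<zero>")
    case False
    have "\<exists>r. r \<in> carrier R \<and> up_ring.coeff P f i = c \<otimes> r" using * by (auto simp: factor_def)
    from someI_ex[OF this] show ?thesis using False by (simp add: h_def)
  qed (simp add: h_def c)
  obtain n where n: "bound \<zero> n (up_ring.coeff P f)"
    using f R.bound_upD[of f] unfolding P_def UP_def by auto
  then have "bound \<zero> n h" by (simp add: h_def bound_def)
  then have "h \<in> up R" using conjunct1[OF h] mem_upI[of h R] by blast
  then have hP: "h \<in> carrier P" unfolding P_def UP_def by simp
  have "up_ring.coeff P h i = h i" for i using \<open>h \<in> up R\<close> unfolding P_def UP_def by simp
  then have "f = const c \<otimes>\<^bsub>P\<^esub> h"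
    using hP f c conjunct2[OF h] by (intro up_eqI) (simp_all add: coeff_const_mult del: coeff_mult)
  then show "const c divides\<^bsub>P\<^esub> f" using hP by (auto simp: factor_def)
qed

lemma const_unit:
  assumes "u \<in> Units R"
  shows "const u \<in> Units P"
proof -
  have u: "u \<in> carrier R" "inv u \<in> carrier R" using assms by auto
  then have eq: "\<one>\<^bsub>P\<^esub> = const u \<otimes>\<^bsub>P\<^esub> const (inv u)"
    by (simp only: const_mult[symmetric] R.Units_r_inv[OF assms] monom_one)
  have "const u divides\<^bsub>P\<^esub> \<one>\<^bsub>P\<^esub>" by (rule P.divides_intro[OF const_closed[OF u(2)] eq])
  then show ?thesis using P.divides_one[OF const_closed[OF u(1)]] by blast
qed

lemma const_unit_imp_unit:
  assumes "c \<in> carrier R" "const c \<in> Units P"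
  shows "c \<in> Units R"
proof -
  have "const c divides\<^bsub>P\<^esub> \<one>\<^bsub>P\<^esub>" using assms P.divides_one[OF const_closed] by blast
  then have "c divides (up_ring.coeff P \<one>\<^bsub>P\<^esub> 0)" using assms const_divides_iff[OF assms(1) P.one_closed] by blast
  then have "c divides \<one>" using coeff_one[of 0] by simp
  then show ?thesis using R.divides_one[OF assms(1)] by blast
qed

text \<open>If \<open>p\<close> divides neither factor, let \<open>i\<close> and \<open>j\<close> be
  the least indices of coefficients of \<open>f\<close> and \<open>g\<close> not divisible by
  \<open>p\<close>. In coefficient \<open>i + j\<close> of the product every term except the one at
  \<open>i\<close> has a factor of smaller index, so \<open>p\<close> would divide that remaining
  term.\<close>

lemma const_prime:
  assumes p: "p \<in> carrier R" "ring_prime p"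
  shows "ring_prime\<^bsub>P\<^esub> (const p)"
proof (rule P.ring_primeI)
  show "const p \<noteq> \<zero>\<^bsub>P\<^esub>" using const_eq_zero_iff[OF p(1)] ring_primeD(1)[OF p(2)] by blast
  show "prime P (const p)"
  proof (rule primeI)
    show "const p \<notin> Units P" using const_unit_imp_unit[OF p(1)] ring_primeD(2)[OF p(2)] by blast
    fix f g assume f: "f \<in> carrier P" and g: "g \<in> carrier P" and d: "const p divides\<^bsub>P\<^esub> (f \<otimes>\<^bsub>P\<^esub> g)"
    show "const p divides\<^bsub>P\<^esub> f \<or> const p divides\<^bsub>P\<^esub> g"
    proof (rule ccontr)
      assume "\<not> ?thesis"
      then have ex: "\<exists>i. \<not> p divides (up_ring.coeff P f i)" "\<exists>i. \<not> p divides (up_ring.coeff P g i)"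
        using const_divides_iff[OF p(1) f] const_divides_iff[OF p(1) g] by blast+
      define i where "i = (LEAST i. \<not> p divides (up_ring.coeff P f i))"
      define j where "j = (LEAST i. \<not> p divides (up_ring.coeff P g i))"
      have i: "\<not> p divides (up_ring.coeff P f i)" "\<And>k. k < i \<Longrightarrow> p divides (up_ring.coeff P f k)"
        unfolding i_def using LeastI_ex[OF ex(1)] not_less_Least by blast+
      have j: "\<not> p divides (up_ring.coeff P g j)" "\<And>k. k < j \<Longrightarrow> p divides (up_ring.coeff P g k)"
        unfolding j_def using LeastI_ex[OF ex(2)] not_less_Least by blast+
      let ?t = "\<lambda>k. up_ring.coeff P f k \<otimes> up_ring.coeff P g (i + j - k)"
      have t: "?t k \<in> carrier R" for k using f g by simp
      have "up_ring.coeff P (f \<otimes>\<^bsub>P\<^esub> g) (i + j) = (\<Oplus>k\<in>insert i ({..i+j} - {i}). ?t k)"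
        using f g by (simp add: insert_absorb)
      also have "\<dots> = ?t i \<oplus> (\<Oplus>k\<in>{..i+j} - {i}. ?t k)"
        by (subst R.finsum_insert) (use f g in auto)
      finally have tot: "p divides (?t i \<oplus> (\<Oplus>k\<in>{..i+j} - {i}. ?t k))"
        using d const_divides_iff[OF p(1) P.m_closed[OF f g]] by metis
      have rest: "p divides (\<Oplus>k\<in>{..i+j} - {i}. ?t k)"
      proof (rule R.divides_finsum)
        fix k assume k: "k \<in> {..i+j} - {i}"
        show "p divides (?t k)"
        proof (cases "k < i")
          case True
          then show ?thesis using R.divides_mult_right(1)[OF p(1) i(2)[OF True]] g by simp
        next
          case False
          then have "i + j - k < j" using k by auto
          then show ?thesis using R.divides_mult_right(2)[OF p(1) j(2)] f by simp
        qed
      qed (use p t in auto)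
      have "(\<Oplus>k\<in>{..i+j} - {i}. ?t k) \<in> carrier R" using t by (intro R.finsum_closed) blast
      from R.divides_add_cancel[OF p(1) t this tot rest] have "p divides (?t i)" .
      then have "p divides (up_ring.coeff P f i) \<or> p divides (up_ring.coeff P g j)"
        using ring_primeD(3)[OF p(2)] f g by simp
      then show False using i j by blast
    qed
  qed
qed

lemma const_prime_products: "a \<in> prime_products R \<Longrightarrow> const a \<in> prime_products P"
proof (induction rule: prime_products.induct)
  case (unit u)
  then show ?case by (intro prime_products.unit const_unit)
next
  case (mult p a)
  then show ?case using R.prime_products_closed
    by (auto simp: const_mult intro: prime_products.mult const_prime)
qed

text \<open>Content one, expressed through the primes of \<open>R\<close> so that no gcd of the
  coefficients has to be chosen.\<close>

definition primitive :: "(nat \<Rightarrow> 'a) \<Rightarrow> bool" where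
  "primitive f \<longleftrightarrow> f \<in> carrier P \<and> f \<noteq> \<zero>\<^bsub>P\<^esub> \<and>
     (\<forall>p\<in>carrier R. ring_prime p \<longrightarrow> \<not> const p divides\<^bsub>P\<^esub> f)"

text \<open>This is how Gauss's lemma is used in place of the fraction field. A prime factor of
  \<open>c\<close> stays prime in \<open>P\<close> and divides \<open>f q\<close>; as it does not
  divide the primitive \<open>f\<close>, it divides \<open>q\<close> and cancels from both
  sides.\<close>

lemma primitive_cancel_const:
  assumes f: "primitive f" and c: "c \<in> prime_products R"
    and "g \<in> carrier P" "q \<in> carrier P" "const c \<otimes>\<^bsub>P\<^esub> g = f \<otimes>\<^bsub>P\<^esub> q"
  shows "f divides\<^bsub>P\<^esub> g"
  using c assms(3-)
proof (induction arbitrary: q rule: prime_products.induct)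
  case (unit u)
  have fP: "f \<in> carrier P" using f by (simp add: primitive_def)
  have u: "u \<in> carrier R" "inv u \<in> carrier R" "inv u \<otimes> u = \<one>" using unit by auto
  have "g = const (inv u \<otimes> u) \<otimes>\<^bsub>P\<^esub> g"
    unfolding u(3) using unit by simp
  also have "\<dots> = const (inv u) \<otimes>\<^bsub>P\<^esub> (const u \<otimes>\<^bsub>P\<^esub> g)"
    unfolding const_mult[OF u(2,1)] using unit u by (intro P.m_assoc) auto
  also have "\<dots> = f \<otimes>\<^bsub>P\<^esub> (const (inv u) \<otimes>\<^bsub>P\<^esub> q)"
    unfolding unit(4) using unit(3) u fP by (simp add: P.m_lcomm)
  finally show ?case using unit u by (intro P.divides_intro) auto
next
  case (mult p a)
  have fP: "f \<in> carrier P" using f by (simp add: primitive_def)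
  have a: "a \<in> carrier R" using mult R.prime_products_closed by blast
  have eq: "const p \<otimes>\<^bsub>P\<^esub> (const a \<otimes>\<^bsub>P\<^esub> g) = f \<otimes>\<^bsub>P\<^esub> q"
    using mult a by (simp add: const_mult P.m_assoc)
  then have "const p divides\<^bsub>P\<^esub> (f \<otimes>\<^bsub>P\<^esub> q)"
    using P.divides_intro[OF _ eq[symmetric]] mult a by simp
  then have "const p divides\<^bsub>P\<^esub> q"
    using ring_primeD(3)[OF const_prime[OF mult(1,2)] fP mult.prems(2)] mult(1,2) f
    unfolding primitive_def by blast
  then obtain q' where q': "q' \<in> carrier P" "q = const p \<otimes>\<^bsub>P\<^esub> q'" by (auto simp: factor_def)
  have "const p \<otimes>\<^bsub>P\<^esub> (const a \<otimes>\<^bsub>P\<^esub> g) = const p \<otimes>\<^bsub>P\<^esub> (f \<otimes>\<^bsub>P\<^esub> q')"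
    using eq q' mult fP by (simp add: P.m_ac)
  then have "const a \<otimes>\<^bsub>P\<^esub> g = f \<otimes>\<^bsub>P\<^esub> q'"
    using ring_primeD(1)[OF const_prime[OF mult(1,2)]] mult a q' fP
    by (subst (asm) domain.m_lcancel[OF UP_domain]) auto
  then show ?case using mult.IH mult.prems q' by blast
qed

text \<open>Initially \<open>a\<close> is a coefficient of \<open>f\<close>.  Unlike that relation, the divisibility hypothesis below
  survives the removal of a prime factor from \<open>a\<close>.\<close>

lemma content_exists_aux:
  assumes "a \<in> prime_products R" "f \<in> carrier P" "f \<noteq> \<zero>\<^bsub>P\<^esub>"
    and "\<And>d. d \<in> carrier R \<Longrightarrow> const d divides\<^bsub>P\<^esub> f \<Longrightarrow> d divides a"
  shows "\<exists>d\<in>carrier R. \<exists>f'. primitive f' \<and> f = const d \<otimes>\<^bsub>P\<^esub> f'"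
  using assms
proof (induction arbitrary: f rule: prime_products.induct)
  case (unit u)
  have "primitive f" unfolding primitive_def
    using unit(2,3) unit(4) R.divides_unit[OF _ _ unit(1)] ring_primeD(2) by metis
  then show ?case using unit by (intro bexI[of _ \<one>] exI[of _ f]) auto
next
  case (mult p a)
  note p = mult.hyps(1,2) and f = mult.prems(1,2) and dvd = mult.prems(3)
  have a: "a \<in> carrier R" using mult.hyps(3) R.prime_products_closed by blast
  have p0: "p \<noteq> \<zero>" using ring_primeD(1)[OF p(2)] by blast
  have cp0: "const p \<noteq> \<zero>\<^bsub>P\<^esub>" using p0 const_eq_zero_iff[OF p(1)] by blast
  show ?case
  proof (cases "const p divides\<^bsub>P\<^esub> f")
    case True
    then obtain f1 where f1: "f1 \<in> carrier P" "f = const p \<otimes>\<^bsub>P\<^esub> f1" by (auto simp: factor_def)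
    have "\<exists>d\<in>carrier R. \<exists>f'. primitive f' \<and> f1 = const d \<otimes>\<^bsub>P\<^esub> f'"
    proof (rule mult.IH)
      show "f1 \<noteq> \<zero>\<^bsub>P\<^esub>" using f1 f p by auto
      fix d assume d: "d \<in> carrier R" "const d divides\<^bsub>P\<^esub> f1"
      then have "const (p \<otimes> d) divides\<^bsub>P\<^esub> f"
        using f1 p by (simp add: const_mult P.divides_mult)
      then have "(p \<otimes> d) divides (p \<otimes> a)" using dvd[of "p \<otimes> d"] p d by simp
      then show "d divides a" using R.mult_divides[of d a p] p d a p0 by simp
    qed (use f1 in auto)
    then obtain d f' where d: "d \<in> carrier R" "primitive f'" "f1 = const d \<otimes>\<^bsub>P\<^esub> f'" by blast
    then have "f = const (p \<otimes> d) \<otimes>\<^bsub>P\<^esub> f'"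
      using f1 p by (simp add: const_mult P.m_assoc primitive_def)
    then show ?thesis using d p R.m_closed by blast
  next
    case False
    show ?thesis
    proof (rule mult.IH)
      fix d assume d: "d \<in> carrier R" "const d divides\<^bsub>P\<^esub> f"
      then obtain e where e: "e \<in> carrier R" "p \<otimes> a = d \<otimes> e" using dvd by (auto simp: factor_def)
      have "p divides (d \<otimes> e)" by (rule R.divides_intro[OF a e(2)[symmetric]])
      \<comment> \<open>Otherwise \<open>const p\<close> would divide \<open>f\<close>. Hence
        \<open>p\<close> lies in the cofactor \<open>e\<close> and cancels, which leaves
        \<open>d divides a\<close> for the unchanged \<open>f\<close>.\<close>
      moreover have "\<not> p divides d"
      proof
        assume "p divides d"
        then obtain d' where d': "d' \<in> carrier R" "d = p \<otimes> d'" by (auto simp: factor_def)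
        obtain h where h: "h \<in> carrier P" "f = const d \<otimes>\<^bsub>P\<^esub> h" using d by (auto simp: factor_def)
        then have eq: "f = const p \<otimes>\<^bsub>P\<^esub> (const d' \<otimes>\<^bsub>P\<^esub> h)"
          using d' p by (simp add: const_mult P.m_assoc)
        then show False using False P.divides_intro[OF _ eq] h d' by simp
      qed
      ultimately have "p divides e" using ring_primeD(3)[OF p(2) d(1) e(1)] by blast
      then obtain e' where e': "e' \<in> carrier R" "e = p \<otimes> e'" by (auto simp: factor_def)
      have "p \<otimes> a = p \<otimes> (d \<otimes> e')" using e(2) e' d p by (simp add: R.m_ac)
      then have "a = d \<otimes> e'" using p0 p a d e' by (subst (asm) R.m_lcancel) auto
      then show "d divides a" using e' by (auto simp: factor_def)
    qed (use f in auto)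
  qed
qed


lemma content_exists:
  assumes "ufd R" "f \<in> carrier P" "f \<noteq> \<zero>\<^bsub>P\<^esub>"
  obtains d f' where "d \<in> prime_products R" "primitive f'" "f = const d \<otimes>\<^bsub>P\<^esub> f'"
proof -
  \<comment> \<open>Any nonzero coefficient would serve, since every constant divisor of
    \<open>f\<close> divides it.\<close>
  let ?a = "up_ring.coeff P f (deg R f)"
  have "?a \<in> carrier R - {\<zero>}" using assms lcoeff_nonzero2 by auto
  then have a: "?a \<in> prime_products R" using assms(1) by (auto simp: ufd_def)
  have div: "d divides ?a" if "d \<in> carrier R" "const d divides\<^bsub>P\<^esub> f" for d
    using that(2) const_divides_iff[OF that(1) assms(2)] by blast
  obtain d f' where d: "d \<in> carrier R" "primitive f'" "f = const d \<otimes>\<^bsub>P\<^esub> f'"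
    using content_exists_aux[OF a assms(2,3) div] by blast
  have f': "f' \<in> carrier P" using d(2) by (simp add: primitive_def)
  have "d \<noteq> \<zero>"
  proof
    assume "d = \<zero>"
    then have "f = \<zero>\<^bsub>P\<^esub> \<otimes>\<^bsub>P\<^esub> f'" using d(3) by (simp only: monom_zero)
    then show False using f' assms(3) by simp
  qed
  then have "d \<in> prime_products R" using d(1) assms(1) by (auto simp: ufd_def)
  then show ?thesis using d(2,3) by (rule that)
qed

text \<open>A nonzero constant that is not a unit has a prime factor, which primitivity
  forbids.\<close>

lemma primitive_const_unit:
  assumes "ufd R" "primitive f" "deg R f = 0"
  shows "f \<in> Units P"
proof -
  have f: "f \<in> carrier P" "f \<noteq> \<zero>\<^bsub>P\<^esub>" using assms by (auto simp: primitive_def)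
  let ?c = "up_ring.coeff P f 0"
  have c: "f = const ?c" "?c \<in> carrier R" using deg_zero_impl_monom[OF f(1) assms(3)] f by auto
  then have "?c \<noteq> \<zero>" using f(2) c(1) const_eq_zero_iff[OF c(2)] by metis
  then have "?c \<in> prime_products R" using c(2) assms(1) by (auto simp: ufd_def)
  then have "?c \<in> Units R"
  proof cases
    case (mult p a)
    then have "a \<in> carrier R" using R.prime_products_closed by blast
    then have "const p divides\<^bsub>P\<^esub> (const ?c)"
      using P.divides_intro[of "const a"] const_mult mult by simp
    then have "const p divides\<^bsub>P\<^esub> f" by (subst c(1))
    then show ?thesis using mult assms(2) by (auto simp: primitive_def)
  qed
  from const_unit[OF this] show ?thesis by (subst c(1))
qed

lemma primitive_divisor:
  assumes "primitive (f \<otimes>\<^bsub>P\<^esub> g)" "f \<in> carrier P" "g \<in> carrier P"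
  shows "primitive f" "primitive g"
proof -
  have fg: "f \<otimes>\<^bsub>P\<^esub> g \<noteq> \<zero>\<^bsub>P\<^esub>"
    and np: "\<And>p. p \<in> carrier R \<Longrightarrow> ring_prime p \<Longrightarrow> \<not> const p divides\<^bsub>P\<^esub> (f \<otimes>\<^bsub>P\<^esub> g)"
    using assms(1) by (auto simp: primitive_def)
  have "f \<noteq> \<zero>\<^bsub>P\<^esub>" "g \<noteq> \<zero>\<^bsub>P\<^esub>" using fg assms(2,3) by auto
  moreover have "\<not> const p divides\<^bsub>P\<^esub> f" "\<not> const p divides\<^bsub>P\<^esub> g"
    if "p \<in> carrier R" "ring_prime p" for p
    using np[OF that] P.divides_mult_right[OF const_closed[OF that(1)]] assms(2,3) by blast+
  ultimately show "primitive f" "primitive g"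
    unfolding primitive_def using assms(2,3) by blast+
qed

text \<open>Over a field this would be Bezout's identity for \<open>f\<close> and \<open>h\<close>.
  Here the ideal they generate need not be principal, but the primitive part \<open>k'\<close> of an
  element \<open>k\<close> of least degree divides all of it. Irreducibility of \<open>f\<close>
  then makes \<open>k'\<close> a unit, so the ideal contains a constant up to a unit, and that
  constant can be cancelled by \<open>primitive_cancel_const\<close>.\<close>

lemma primitive_irreducible_prime:
  assumes ufd: "ufd R" and f: "primitive f"
    and nonunit: "f \<notin> Units P"
    and irr: "\<And>g h. \<lbrakk>g \<in> carrier P; h \<in> carrier P; f = g \<otimes>\<^bsub>P\<^esub> h\<rbrakk> \<Longrightarrow> g \<in> Units P \<or> h \<in> Units P"
  shows "ring_prime\<^bsub>P\<^esub> f"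
proof (rule P.ring_primeI)
  have fP: "f \<in> carrier P" and f0: "f \<noteq> \<zero>\<^bsub>P\<^esub>" using f by (auto simp: primitive_def)
  show "f \<noteq> \<zero>\<^bsub>P\<^esub>" by (rule f0)
  show "prime P f"
  proof (rule primeI)
    fix g h assume g: "g \<in> carrier P" and h: "h \<in> carrier P" and d: "f divides\<^bsub>P\<^esub> (g \<otimes>\<^bsub>P\<^esub> h)"
    show "f divides\<^bsub>P\<^esub> g \<or> f divides\<^bsub>P\<^esub> h"
    proof (rule disjCI)
      assume nh: "\<not> f divides\<^bsub>P\<^esub> h"
      define I where "I = {u \<otimes>\<^bsub>P\<^esub> f \<oplus>\<^bsub>P\<^esub> v \<otimes>\<^bsub>P\<^esub> h |u v. u \<in> carrier P \<and> v \<in> carrier P}"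
      have I_I: "k \<in> I" if "u \<in> carrier P" "v \<in> carrier P" "k = u \<otimes>\<^bsub>P\<^esub> f \<oplus>\<^bsub>P\<^esub> v \<otimes>\<^bsub>P\<^esub> h" for k u v
        using that unfolding I_def by blast
      have I_E: thesis if "k \<in> I"
        "\<And>u v. \<lbrakk>u \<in> carrier P; v \<in> carrier P; k = u \<otimes>\<^bsub>P\<^esub> f \<oplus>\<^bsub>P\<^esub> v \<otimes>\<^bsub>P\<^esub> h\<rbrakk> \<Longrightarrow> thesis" for k thesis
        using that unfolding I_def by blast
      have I_mult: "w \<otimes>\<^bsub>P\<^esub> k \<in> I" if k: "k \<in> I" and w: "w \<in> carrier P" for k w
        using k
      proof (rule I_E)
        fix u v assume uv: "u \<in> carrier P" "v \<in> carrier P" "k = u \<otimes>\<^bsub>P\<^esub> f \<oplus>\<^bsub>P\<^esub> v \<otimes>\<^bsub>P\<^esub> h"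
        have "w \<otimes>\<^bsub>P\<^esub> k = (w \<otimes>\<^bsub>P\<^esub> u) \<otimes>\<^bsub>P\<^esub> f \<oplus>\<^bsub>P\<^esub> (w \<otimes>\<^bsub>P\<^esub> v) \<otimes>\<^bsub>P\<^esub> h"
          unfolding uv(3) using uv(1,2) w fP h by (simp add: P.r_distr P.m_assoc)
        then show ?thesis by (intro I_I[OF P.m_closed[OF w uv(1)] P.m_closed[OF w uv(2)]])
      qed
      have I_add: "k \<oplus>\<^bsub>P\<^esub> l \<in> I" if k: "k \<in> I" and l: "l \<in> I" for k l
        using k
      proof (rule I_E)
        fix u v assume uv: "u \<in> carrier P" "v \<in> carrier P" "k = u \<otimes>\<^bsub>P\<^esub> f \<oplus>\<^bsub>P\<^esub> v \<otimes>\<^bsub>P\<^esub> h"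
        show ?thesis using l
        proof (rule I_E)
          fix u' v' assume uv': "u' \<in> carrier P" "v' \<in> carrier P" "l = u' \<otimes>\<^bsub>P\<^esub> f \<oplus>\<^bsub>P\<^esub> v' \<otimes>\<^bsub>P\<^esub> h"
          have "k \<oplus>\<^bsub>P\<^esub> l = (u \<oplus>\<^bsub>P\<^esub> u') \<otimes>\<^bsub>P\<^esub> f \<oplus>\<^bsub>P\<^esub> (v \<oplus>\<^bsub>P\<^esub> v') \<otimes>\<^bsub>P\<^esub> h"
            unfolding uv(3) uv'(3) using uv(1,2) uv'(1,2) fP h by (simp add: P.l_distr P.a_ac)
          then show ?thesis
            by (intro I_I[OF P.a_closed[OF uv(1) uv'(1)] P.a_closed[OF uv(2) uv'(2)]])
        qed
      qed
      have I_closed: "k \<in> carrier P" if "k \<in> I" for k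
        using that by (rule I_E) (use fP h in simp)
      have fI: "f \<in> I" and hI: "h \<in> I"
        using fP h by (auto intro: I_I[OF P.one_closed P.zero_closed] I_I[OF P.zero_closed P.one_closed])
      obtain k where k: "k \<in> I" "k \<noteq> \<zero>\<^bsub>P\<^esub>"
        and kmin: "\<And>l. l \<in> I \<Longrightarrow> l \<noteq> \<zero>\<^bsub>P\<^esub> \<Longrightarrow> deg R k \<le> deg R l"
        using ex_has_least_nat[of "\<lambda>k. k \<in> I \<and> k \<noteq> \<zero>\<^bsub>P\<^esub>" f "deg R"] fI f0 by blast
      have kP: "k \<in> carrier P" using k I_closed by blast
      obtain d k' where dk: "d \<in> prime_products R" "primitive k'" "k = const d \<otimes>\<^bsub>P\<^esub> k'"
        using content_exists[OF ufd kP k(2)] by blast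
      have dR: "d \<in> carrier R" and k'P: "k' \<in> carrier P" using R.prime_products_closed[OF dk(1)] dk(2)
        unfolding primitive_def by blast+
      have k'_div: "k' divides\<^bsub>P\<^esub> l" if l: "l \<in> I" for l
      proof -
        have lP: "l \<in> carrier P" using l I_closed by blast
        \<comment> \<open>Pseudo-division: instead of inverting the leading coefficient of
          \<open>k\<close>, multiply \<open>l\<close> by a power of it. The remainder lies in
          \<open>I\<close> and has smaller degree, so it vanishes, and the power is cancelled
          because \<open>k'\<close> is primitive.\<close>
        let ?a = "up_ring.coeff P k (deg R k)"
        obtain q r and m :: nat where q: "q \<in> carrier P" "r \<in> carrier P"
            "(?a [^] m) \<odot>\<^bsub>P\<^esub> l = k \<otimes>\<^bsub>P\<^esub> q \<oplus>\<^bsub>P\<^esub> r" "r = \<zero>\<^bsub>P\<^esub> \<or> deg R r < deg R k"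
          using long_div_theorem[OF kP lP k(2)] by blast
        define c where "c = ?a [^] m"
        have a: "?a \<in> carrier R" "?a \<noteq> \<zero>" using kP k lcoeff_nonzero2 by auto
        have c: "c \<in> carrier R" using a by (simp add: c_def)
        have "c \<noteq> \<zero>" unfolding c_def using a by (induction m) (auto simp: R.integral_iff)
        then have cp: "c \<in> prime_products R" using c ufd by (auto simp: ufd_def)
        have eq: "const c \<otimes>\<^bsub>P\<^esub> l = k \<otimes>\<^bsub>P\<^esub> q \<oplus>\<^bsub>P\<^esub> r"
          using q(3) c lP unfolding c_def[symmetric] by (simp add: monom_mult_is_smult)
        have "r = const c \<otimes>\<^bsub>P\<^esub> l \<oplus>\<^bsub>P\<^esub> (\<ominus>\<^bsub>P\<^esub> q) \<otimes>\<^bsub>P\<^esub> k"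
          unfolding eq using q kP by algebra
        also have "\<dots> \<in> I"
          by (intro I_add I_mult l k(1) const_closed c P.a_inv_closed q(1))
        finally have "r \<in> I" .
        then have "r = \<zero>\<^bsub>P\<^esub>" using q(4) kmin by fastforce
        then have "const c \<otimes>\<^bsub>P\<^esub> l = k' \<otimes>\<^bsub>P\<^esub> (const d \<otimes>\<^bsub>P\<^esub> q)"
          using eq q dk(3) dR k'P by (simp add: P.m_ac)
        then show ?thesis using primitive_cancel_const[OF dk(2) cp lP P.m_closed[OF const_closed[OF dR] q(1)]] by blast
      qed
      obtain w where w: "w \<in> carrier P" "f = k' \<otimes>\<^bsub>P\<^esub> w" using k'_div[OF fI] by (auto simp: factor_def)
      obtain z where z: "z \<in> carrier P" "h = k' \<otimes>\<^bsub>P\<^esub> z" using k'_div[OF hI] by (auto simp: factor_def)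
      have "w \<notin> Units P"
      proof
        assume w': "w \<in> Units P"
        then have "f \<otimes>\<^bsub>P\<^esub> (inv\<^bsub>P\<^esub> w \<otimes>\<^bsub>P\<^esub> z) = k' \<otimes>\<^bsub>P\<^esub> (w \<otimes>\<^bsub>P\<^esub> inv\<^bsub>P\<^esub> w) \<otimes>\<^bsub>P\<^esub> z"
          unfolding w(2) using z k'P P.Units_inv_closed[OF w'] P.Units_closed[OF w'] by (simp add: P.m_assoc del: P.Units_r_inv)
        then have "f \<otimes>\<^bsub>P\<^esub> (inv\<^bsub>P\<^esub> w \<otimes>\<^bsub>P\<^esub> z) = h" using w' z k'P by simp
        then show False using nh P.divides_intro[of "inv\<^bsub>P\<^esub> w \<otimes>\<^bsub>P\<^esub> z" h f] z w' by simp
      qed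
      \<comment> \<open>Thus \<open>k\<close> is the constant \<open>d\<close> times a unit. As
        \<open>k\<close> lies in \<open>I\<close>, \<open>f\<close> divides \<open>g k\<close>,
        hence \<open>d g\<close>, and finally \<open>g\<close>.\<close>
      then have k'U: "k' \<in> Units P" using irr[OF k'P w] by blast
      have "f divides\<^bsub>P\<^esub> (g \<otimes>\<^bsub>P\<^esub> k)"
      proof -
        obtain u v where uv: "u \<in> carrier P" "v \<in> carrier P" "k = u \<otimes>\<^bsub>P\<^esub> f \<oplus>\<^bsub>P\<^esub> v \<otimes>\<^bsub>P\<^esub> h"
          using k(1) by (rule I_E)
        then have "g \<otimes>\<^bsub>P\<^esub> k = f \<otimes>\<^bsub>P\<^esub> (g \<otimes>\<^bsub>P\<^esub> u) \<oplus>\<^bsub>P\<^esub> v \<otimes>\<^bsub>P\<^esub> (g \<otimes>\<^bsub>P\<^esub> h)"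
          using fP h g by (simp add: P.r_distr P.m_ac)
        moreover have "f divides\<^bsub>P\<^esub> (f \<otimes>\<^bsub>P\<^esub> (g \<otimes>\<^bsub>P\<^esub> u))" using g uv by (intro P.divides_intro) auto
        moreover have "f divides\<^bsub>P\<^esub> (v \<otimes>\<^bsub>P\<^esub> (g \<otimes>\<^bsub>P\<^esub> h))" by (rule P.divides_mult_right(2)[OF fP d uv(2)])
        ultimately show ?thesis using fP P.divides_add by simp
      qed
      then obtain y where y: "y \<in> carrier P" "g \<otimes>\<^bsub>P\<^esub> k = f \<otimes>\<^bsub>P\<^esub> y" by (auto simp: factor_def)
      have i: "inv\<^bsub>P\<^esub> k' \<in> carrier P" using k'U by simp
      have "const d \<otimes>\<^bsub>P\<^esub> g = const d \<otimes>\<^bsub>P\<^esub> g \<otimes>\<^bsub>P\<^esub> (k' \<otimes>\<^bsub>P\<^esub> inv\<^bsub>P\<^esub> k')" using k'U g dR by simp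
      also have "\<dots> = (g \<otimes>\<^bsub>P\<^esub> k) \<otimes>\<^bsub>P\<^esub> inv\<^bsub>P\<^esub> k'"
        unfolding dk(3) using g dR i k'P by (simp add: P.m_ac del: P.Units_r_inv P.Units_l_inv)
      also have "\<dots> = f \<otimes>\<^bsub>P\<^esub> (y \<otimes>\<^bsub>P\<^esub> inv\<^bsub>P\<^esub> k')" unfolding y(2) using fP y i by (simp add: P.m_assoc)
      finally show "f divides\<^bsub>P\<^esub> g"
        using primitive_cancel_const[OF f dk(1) g P.m_closed[OF y(1) i]] by blast
    qed
  qed (rule nonunit)
qed

text \<open>A factorization of a primitive polynomial into nonunits lowers both degrees strictly,
  because a primitive polynomial of degree zero is a unit; so induction on the degree ends at
  irreducible polynomials, which are prime.\<close>

lemma primitive_prime_products: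
  assumes ufd: "ufd R"
  shows "primitive f \<Longrightarrow> f \<in> prime_products P"
proof (induction "deg R f" arbitrary: f rule: less_induct)
  case less
  have fP: "f \<in> carrier P" and f0: "f \<noteq> \<zero>\<^bsub>P\<^esub>" using less by (auto simp: primitive_def)
  consider "f \<in> Units P"
    | g h where "g \<in> carrier P" "h \<in> carrier P" "f = g \<otimes>\<^bsub>P\<^esub> h" "g \<notin> Units P" "h \<notin> Units P"
    | "f \<notin> Units P" "\<forall>g h. g \<in> carrier P \<longrightarrow> h \<in> carrier P \<longrightarrow> f = g \<otimes>\<^bsub>P\<^esub> h \<longrightarrow> g \<in> Units P \<or> h \<in> Units P"
    by blast
  then show ?case
  proof cases
    case 1
    then show ?thesis by (rule prime_products.unit)
  next
    case 2
    have prim: "primitive g" "primitive h" using primitive_divisor[of g h] less.prems 2(1-3) by blast+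
    then have "deg R g \<noteq> 0" "deg R h \<noteq> 0" using primitive_const_unit[OF ufd] 2(4,5) by blast+
    moreover have "deg R f = deg R g + deg R h"
      using prim 2(1,2) unfolding 2(3) primitive_def by (intro deg_mult) blast+
    ultimately have "deg R g < deg R f" "deg R h < deg R f" by auto
    then show ?thesis using less.hyps[OF _ prim(1)] less.hyps[OF _ prim(2)] 2(3) domain.prime_products_mult[OF UP_domain] by blast
  next
    case 3
    then have "ring_prime\<^bsub>P\<^esub> f" using primitive_irreducible_prime[OF ufd less.prems] by blast
    then have "f \<otimes>\<^bsub>P\<^esub> \<one>\<^bsub>P\<^esub> \<in> prime_products P"
      using prime_products.mult[OF fP _ prime_products.unit[OF P.Units_one_closed]] by blast
    then show ?thesis using fP by simp
  qed
qed

text \<open>The content contributes primes of \<open>R\<close>, which stay prime in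
  \<open>P\<close>; the primitive part is factored by degree.\<close>

theorem UP_ufd:
  assumes "ufd R"
  shows "ufd P"
  unfolding ufd_def
proof (intro conjI subsetI)
  show "domain P" by (rule UP_domain)
  fix f assume f: "f \<in> carrier P - {\<zero>\<^bsub>P\<^esub>}"
  then obtain d f' where "d \<in> prime_products R" "primitive f'" "f = const d \<otimes>\<^bsub>P\<^esub> f'"
    using content_exists[OF assms, of f] by blast
  then show "f \<in> prime_products P"
    using domain.prime_products_mult[OF UP_domain const_prime_products primitive_prime_products[OF assms]] by blast
qed

end

section \<open>Multivariate polynomial rings\<close>

text \<open>Preservation of zero is a separate hypothesis because \<open>S\<close> is not known to
  be a ring beforehand; its domain structure is itself transported along \<open>h\<close>.\<close>

lemma (in domain) ufd_iso:
  assumes ufd: "ufd R" and h: "h \<in> ring_iso R S" and zero: "h \<zero> = \<zero>\<^bsub>S\<^esub>"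
  shows "ufd S"
proof -
  note hc = ring_iso_memE(1)[OF h] and hm = ring_iso_memE(2)[OF h]
  have inj: "x = y" if "h x = h y" "x \<in> carrier R" "y \<in> carrier R" for x y
    using ring_iso_memE(5)[OF h] that by (auto simp: bij_betw_def inj_on_def)
  have surj: "\<exists>x\<in>carrier R. y = h x" if "y \<in> carrier S" for y
    using ring_iso_memE(5)[OF h] that by (auto simp: bij_betw_def)
  have "S \<lparr>zero := h \<zero>\<rparr> = S" by (simp add: zero)
  then have dS: "domain S" using ring_iso_imp_img_domain[OF h] by simp
  interpret S: "domain" S by (rule dS)
  have div: "h a divides\<^bsub>S\<^esub> h b \<longleftrightarrow> a divides b" if "a \<in> carrier R" "b \<in> carrier R" for a b
  proof
    assume "h a divides\<^bsub>S\<^esub> h b"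
    then obtain y where y: "y \<in> carrier S" "h b = h a \<otimes>\<^bsub>S\<^esub> y" by (auto simp: factor_def)
    then obtain x where x: "x \<in> carrier R" "y = h x" using surj by blast
    then have "h b = h (a \<otimes> x)" using y(2) hm that by simp
    then have "b = a \<otimes> x" using inj that x(1) by simp
    then show "a divides b" using divides_intro[OF x(1)] by blast
  next
    assume "a divides b"
    then obtain x where "x \<in> carrier R" "b = a \<otimes> x" by (auto simp: factor_def)
    then show "h a divides\<^bsub>S\<^esub> h b" using S.divides_intro[OF hc] hm that by blast
  qed
  have unit: "h u \<in> Units S \<longleftrightarrow> u \<in> Units R" if "u \<in> carrier R" for u
    using S.divides_one[OF hc[OF that]] divides_one[OF that] div[OF that one_closed]
      ring_iso_memE(4)[OF h] by simp
  have prime: "ring_prime\<^bsub>S\<^esub> (h p)" if p: "p \<in> carrier R" "ring_prime p" for p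
  proof (rule S.ring_primeI)
    show "h p \<noteq> \<zero>\<^bsub>S\<^esub>" using inj[of p \<zero>] zero p ring_primeD(1)[OF p(2)] by auto
    show "prime S (h p)"
    proof (rule primeI)
      show "h p \<notin> Units S" using unit p ring_primeD(2)[OF p(2)] by blast
      fix a b assume ab: "a \<in> carrier S" "b \<in> carrier S" "h p divides\<^bsub>S\<^esub> (a \<otimes>\<^bsub>S\<^esub> b)"
      obtain x y where "x \<in> carrier R" "a = h x" "y \<in> carrier R" "b = h y"
        using surj ab by blast
      then show "h p divides\<^bsub>S\<^esub> a \<or> h p divides\<^bsub>S\<^esub> b"
        using ab(3) hm div p(1) ring_primeD(3)[OF p(2)] by (metis m_closed)
    qed
  qed
  have prods: "h a \<in> prime_products S" if "a \<in> prime_products R" for a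
    using that
  proof (induction rule: prime_products.induct)
    case (unit u)
    then show ?case using \<open>\<And>u. u \<in> carrier R \<Longrightarrow> (h u \<in> Units S) = (u \<in> Units R)\<close>
      by (intro prime_products.unit) auto
  next
    case (mult p a)
    then have "h (p \<otimes> a) = h p \<otimes>\<^bsub>S\<^esub> h a" using hm prime_products_closed by blast
    then show ?case using mult hc prime by (auto intro: prime_products.mult)
  qed
  show ?thesis
    unfolding ufd_def
  proof (intro conjI subsetI dS)
    fix b assume b: "b \<in> carrier S - {\<zero>\<^bsub>S\<^esub>}"
    then obtain a where a: "a \<in> carrier R" "b = h a" using surj by blast
    then have "a \<noteq> \<zero>" using b zero by auto
    then show "b \<in> prime_products S" using a ufd prods by (auto simp: ufd_def)
  qed
qed

text \<open>Makes the convolution in \<open>mpoly_ring\<close> a genuine finite sum;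
  \<open>finsum\<close> over an infinite set would carry no information.\<close>

lemma finite_submultisets: "finite {k. k \<subseteq># m}"
proof (induction m)
  case (add x m)
  have "{k. k \<subseteq># add_mset x m} \<subseteq> {k. k \<subseteq># m} \<union> add_mset x ` {k. k \<subseteq># m}"
  proof
    fix k assume "k \<in> {k. k \<subseteq># add_mset x m}"
    moreover have "k \<subseteq># m" if "x \<notin># k" "k \<subseteq># add_mset x m"
      using that by (auto simp: subseteq_mset_def not_in_iff) (metis le0)
    ultimately show "k \<in> {k. k \<subseteq># m} \<union> add_mset x ` {k. k \<subseteq># m}"
      by (cases "x \<in># k") (auto dest!: multi_member_split)
  qed
  then show ?case by (rule finite_subset) (use add in auto)
qed auto

section \<open>Multivariate polynomials as iterated univariate polynomials\<close>

context ring
begin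

text \<open>Coefficientwise description of \<open>indexed_pset\<close>, which is generated
  inductively by constants, sums and multiplication by variables; see
  \<open>indexed_pset_eq\<close>. Closure properties are easier to check here.\<close>

definition finite_support :: "'c set \<Rightarrow> ('c multiset \<Rightarrow> 'a) set" where
  "finite_support I = {p. (\<forall>m. p m \<in> carrier R) \<and> finite {m. p m \<noteq> \<zero>} \<and>
     (\<forall>m. p m \<noteq> \<zero> \<longrightarrow> set_mset m \<subseteq> I)}"

lemma indexed_pset_subset: "p \<in> indexed_pset I (carrier R) \<Longrightarrow> p \<in> finite_support I"
proof (induction rule: indexed_pset.induct)
  case (indexed_const k)
  have "finite {m. indexed_const k m \<noteq> \<zero>}"
    by (rule finite_subset[of _ "{{#}}"]) (auto simp: indexed_const_def)
  then show ?case using indexed_const by (auto simp: finite_support_def indexed_const_def)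
next
  case (indexed_padd P Q)
  then have "finite ({m. P m \<noteq> \<zero>} \<union> {m. Q m \<noteq> \<zero>})" by (auto simp: finite_support_def)
  then have "finite {m. P m \<oplus> Q m \<noteq> \<zero>}"
    by (rule rev_finite_subset) (use indexed_padd in \<open>auto simp: finite_support_def\<close>)
  moreover have "set_mset m \<subseteq> I" if "P m \<oplus> Q m \<noteq> \<zero>" for m
  proof -
    have "P m \<noteq> \<zero> \<or> Q m \<noteq> \<zero>" using that by auto
    then show ?thesis using indexed_padd by (auto simp: finite_support_def)
  qed
  ultimately show ?case using indexed_padd by (auto simp: finite_support_def indexed_padd_def)
next
  case (indexed_pmult P i)
  then have "finite (add_mset i ` {m. P m \<noteq> \<zero>})" by (auto simp: finite_support_def)
  moreover have "{m. indexed_pmult P i m \<noteq> \<zero>} \<subseteq> add_mset i ` {m. P m \<noteq> \<zero>}"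
    by (auto simp: indexed_pmult_def split: if_splits dest!: multi_member_split)
  ultimately have "finite {m. indexed_pmult P i m \<noteq> \<zero>}" by (rule rev_finite_subset)
  moreover have "set_mset m \<subseteq> I" if "i \<in># m" "P (m - {#i#}) \<noteq> \<zero>" for m
  proof -
    have "set_mset (m - {#i#}) \<subseteq> I" using that(2) indexed_pmult by (auto simp: finite_support_def)
    then have "set_mset (add_mset i (m - {#i#})) \<subseteq> I" using indexed_pmult by simp
    then show ?thesis using that(1) by simp
  qed
  ultimately show ?case using indexed_pmult by (auto simp: finite_support_def indexed_pmult_def)
qed

lemma monomial_in_indexed_pset:
  assumes "a \<in> carrier R"
  shows "set_mset m \<subseteq> I \<Longrightarrow> (\<lambda>k. if k = m then a else \<zero>) \<in> indexed_pset I (carrier R)"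
proof (induction m)
  case empty
  then show ?case using indexed_pset.indexed_const[OF assms, of I] by (simp add: indexed_const_def)
next
  case (add i m)
  then have "indexed_pmult (\<lambda>k. if k = m then a else \<zero>) i \<in> indexed_pset I (carrier R)"
    by (intro indexed_pset.indexed_pmult) auto
  also have "indexed_pmult (\<lambda>k. if k = m then a else \<zero>) i = (\<lambda>k. if k = add_mset i m then a else \<zero>)"
    by (auto simp: indexed_pmult_def fun_eq_iff dest!: multi_member_split)
  finally show ?case .
qed

text \<open>A finitely supported function is a finite sum of monomials: the induction removes one
  monomial of the support at a time.\<close>

lemma indexed_pset_eq: "indexed_pset I (carrier R) = finite_support I"
proof (intro equalityI subsetI indexed_pset_subset)
  fix p assume "p \<in> finite_support I"
  moreover have "p \<in> indexed_pset I (carrier R)"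
    if "finite S" "{m. p m \<noteq> \<zero>} = S" "\<forall>m. p m \<in> carrier R" "\<forall>m. p m \<noteq> \<zero> \<longrightarrow> set_mset m \<subseteq> I" for S p
    using that
  proof (induction S arbitrary: p rule: finite_induct)
    case empty
    then have "p = indexed_const \<zero>" by (auto simp: indexed_const_def)
    then show ?case by (auto intro: indexed_pset.indexed_const)
  next
    case (insert m S)
    then have pm: "p m \<noteq> \<zero>" by blast
    have "p(m := \<zero>) \<in> indexed_pset I (carrier R)"
    proof (rule insert.IH)
      show "{k. (p(m := \<zero>)) k \<noteq> \<zero>} = S" using insert.prems(1) insert.hyps(2) by auto
    qed (use insert.prems in auto)
    moreover have "(\<lambda>k. if k = m then p m else \<zero>) \<in> indexed_pset I (carrier R)"
      using insert.prems pm by (intro monomial_in_indexed_pset) auto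
    ultimately have "indexed_padd (p(m := \<zero>)) (\<lambda>k. if k = m then p m else \<zero>) \<in> indexed_pset I (carrier R)"
      by (rule indexed_pset.indexed_padd)
    also have "indexed_padd (p(m := \<zero>)) (\<lambda>k. if k = m then p m else \<zero>) = p"
      using insert.prems by (auto simp: indexed_padd_def fun_eq_iff)
    finally show ?case .
  qed
  ultimately show "p \<in> indexed_pset I (carrier R)" by (auto simp: finite_support_def)
qed

lemma mpoly_ring_simps:
  "carrier (mpoly_ring R n) = finite_support {..<n}"
  "p \<otimes>\<^bsub>mpoly_ring R n\<^esub> q = (\<lambda>m. \<Oplus>k\<in>{k. k \<subseteq># m}. p k \<otimes> q (m - k))"
  "\<one>\<^bsub>mpoly_ring R n\<^esub> = indexed_const \<one>"
  "\<zero>\<^bsub>mpoly_ring R n\<^esub> = (\<lambda>m. \<zero>)"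
  "p \<oplus>\<^bsub>mpoly_ring R n\<^esub> q = (\<lambda>m. p m \<oplus> q m)"
  by (auto simp: mpoly_ring_def indexed_pset_eq indexed_const_def indexed_padd_def fun_eq_iff)

text \<open>Without variables only the empty multiset can carry a coefficient, and the convolution
  collapses to its single term at \<open>{#}\<close>.\<close>

lemma mpoly_ring_0_iso: "indexed_const \<in> ring_iso R (mpoly_ring R 0)"
proof (rule ring_iso_memI)
  show c: "indexed_const a \<in> carrier (mpoly_ring R 0)" if "a \<in> carrier R" for a
    using indexed_pset.indexed_const[OF that] by (simp add: mpoly_ring_def)
  show "indexed_const (a \<otimes> b) = indexed_const a \<otimes>\<^bsub>mpoly_ring R 0\<^esub> indexed_const b"
    if "a \<in> carrier R" "b \<in> carrier R" for a b
  proof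
    fix m :: "nat multiset"
    have "(\<Oplus>k\<in>{k. k \<subseteq># m}. indexed_const a k \<otimes> indexed_const b (m - k)) =
        (\<Oplus>k\<in>{{#}}. indexed_const a k \<otimes> indexed_const b (m - k))"
      by (rule add.finprod_mono_neutral_cong_right)
        (use that in \<open>auto simp: indexed_const_def finite_submultisets\<close>)
    also have "\<dots> = indexed_const (a \<otimes> b) m" using that by (simp add: indexed_const_def)
    finally show "indexed_const (a \<otimes> b) m = (indexed_const a \<otimes>\<^bsub>mpoly_ring R 0\<^esub> indexed_const b) m"
      by (simp add: mpoly_ring_simps)
  qed
  show "indexed_const (a \<oplus> b) = indexed_const a \<oplus>\<^bsub>mpoly_ring R 0\<^esub> indexed_const b"
    if "a \<in> carrier R" "b \<in> carrier R" for a b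
    using that by (auto simp: mpoly_ring_simps indexed_const_def)
  show "indexed_const \<one> = \<one>\<^bsub>mpoly_ring R 0\<^esub>" by (simp add: mpoly_ring_simps)
  show "bij_betw indexed_const (carrier R) (carrier (mpoly_ring R 0))"
    unfolding bij_betw_def
  proof (intro conjI equalityI subsetI)
    show "inj_on indexed_const (carrier R)"
      by (rule inj_on_inverseI[of _ "\<lambda>p. p {#}"]) (simp add: indexed_const_def)
    fix p :: "nat multiset \<Rightarrow> 'a" assume p: "p \<in> carrier (mpoly_ring R 0)"
    then have "p = indexed_const (p {#})"
      by (auto simp: mpoly_ring_simps finite_support_def indexed_const_def fun_eq_iff)
    then show "p \<in> indexed_const ` carrier R"
      using p by (auto simp: mpoly_ring_simps finite_support_def)
  qed (use c in auto)
qed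

lemma mpoly_finsum_apply:
  assumes "ring (mpoly_ring R n)" "finite F" "\<And>i. i \<in> F \<Longrightarrow> f i \<in> carrier (mpoly_ring R n)"
  shows "(\<Oplus>\<^bsub>mpoly_ring R n\<^esub>i\<in>F. f i) m = (\<Oplus>i\<in>F. f i m)"
proof -
  interpret M: ring "mpoly_ring R n" by fact
  show ?thesis using assms(2,3)
  proof (induction rule: finite_induct)
    case (insert i F)
    have "f j m \<in> carrier R" if "j \<in> insert i F" for j
      using insert.prems[OF that] by (simp add: mpoly_ring_simps finite_support_def)
    then show ?case using insert by (simp add: mpoly_ring_simps Pi_def)
  qed (simp add: mpoly_ring_simps)
qed

text \<open>The identification of A[x_0,...,x_(n-1)][x_n] with A[x_0,...,x_n] on coefficients: the
  multiplicity of \<open>n\<close> in the monomial selects the power of the last variable.\<close>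

definition join_var :: "nat \<Rightarrow> (nat \<Rightarrow> nat multiset \<Rightarrow> 'a) \<Rightarrow> nat multiset \<Rightarrow> 'a" where
  "join_var n f m = f (count m n) (filter_mset ((\<noteq>) n) m)"

lemma filter_add_replicate:
  "n \<notin># k \<Longrightarrow> filter_mset ((\<noteq>) n) (k + replicate_mset i n) = k"
  "n \<notin># k \<Longrightarrow> count (k + replicate_mset i n) n = i"
  "filter_mset ((\<noteq>) n) m + replicate_mset (count m n) n = m"
  by (auto simp: multiset_eq_iff not_in_iff)

text \<open>A submultiset of \<open>m\<close> is the same as a multiplicity \<open>i\<close> of
  \<open>n\<close> together with a submultiset of the part without \<open>n\<close>; the sets
  \<open>T i\<close> realize this partition. The outer sum is the univariate product, the inner one
  the product of the coefficient polynomials.\<close>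

lemma join_var_mult:
  fixes m :: "nat multiset"
  assumes g: "\<And>i k. g i k \<in> carrier R" and h: "\<And>i k. h i k \<in> carrier R"
  shows "(\<Oplus>i\<in>{..count m n}. \<Oplus>k\<in>{k. k \<subseteq># filter_mset ((\<noteq>) n) m}.
             g i k \<otimes> h (count m n - i) (filter_mset ((\<noteq>) n) m - k)) =
         (\<Oplus>k\<in>{k. k \<subseteq># m}. join_var n g k \<otimes> join_var n h (m - k))"
proof -
  let ?m = "filter_mset ((\<noteq>) n) m" and ?c = "count m n"
  define T where "T i = (\<lambda>k. k + replicate_mset i n) ` {k. k \<subseteq># ?m}" for i
  have nm: "n \<notin># k" if "k \<subseteq># ?m" for k
    using mset_subset_eqD[OF that, of n] by auto
  have eq: "{k. k \<subseteq># m} = (\<Union>i\<in>{..?c}. T i)"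
  proof (intro equalityI subsetI)
    fix k assume "k \<in> {k. k \<subseteq># m}"
    then have "filter_mset ((\<noteq>) n) k \<subseteq># ?m" "count k n \<le> ?c"
      by (auto intro: multiset_filter_mono mset_subset_eq_count)
    moreover have "k = filter_mset ((\<noteq>) n) k + replicate_mset (count k n) n"
      by (simp add: filter_add_replicate)
    ultimately show "k \<in> (\<Union>i\<in>{..?c}. T i)" unfolding T_def by blast
  next
    fix k assume "k \<in> (\<Union>i\<in>{..?c}. T i)"
    then obtain i k' where "i \<le> ?c" "k' \<subseteq># ?m" "k = k' + replicate_mset i n"
      by (auto simp: T_def)
    moreover from this have "replicate_mset i n \<subseteq># replicate_mset ?c n"
      by (simp add: subseteq_mset_def)
    ultimately have "k \<subseteq># ?m + replicate_mset ?c n"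
      using subset_mset.add_mono by blast
    then show "k \<in> {k. k \<subseteq># m}" by (simp add: filter_add_replicate)
  qed
  have join: "join_var n f x \<in> carrier R" if "\<And>i k. f i k \<in> carrier R" for f x
    using that by (simp add: join_var_def)
  have finT: "finite (T i)" for i unfolding T_def by (intro finite_imageI finite_submultisets)
  have disj: "pairwise (\<lambda>i j. disjnt (T i) (T j)) {..?c}"
  proof (intro pairwiseI)
    fix i j :: nat assume "i \<noteq> j"
    have "count k n = i" if "k \<in> T i" for k i using that filter_add_replicate(2)[OF nm] unfolding T_def by blast
    then show "disjnt (T i) (T j)" using \<open>i \<noteq> j\<close> by (auto simp: disjnt_def)
  qed
  have "(\<Oplus>k\<in>{k. k \<subseteq># m}. join_var n g k \<otimes> join_var n h (m - k)) =
        (\<Oplus>i\<in>{..?c}. \<Oplus>k\<in>T i. join_var n g k \<otimes> join_var n h (m - k))"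
    unfolding eq by (rule add.finprod_UN_disjoint)
      (use join g h disj finT in auto)
  also have "\<dots> = (\<Oplus>i\<in>{..?c}. \<Oplus>k\<in>{k. k \<subseteq># ?m}. g i k \<otimes> h (?c - i) (?m - k))"
  proof (rule finsum_cong')
    fix i assume i: "i \<in> {..?c}"
    have "(\<Oplus>k\<in>T i. join_var n g k \<otimes> join_var n h (m - k)) =
      (\<Oplus>k\<in>{k. k \<subseteq># ?m}. join_var n g (k + replicate_mset i n) \<otimes> join_var n h (m - (k + replicate_mset i n)))"
      unfolding T_def by (rule finsum_reindex) (use join g h in \<open>auto simp: inj_on_def\<close>)
    also have "\<dots> = (\<Oplus>k\<in>{k. k \<subseteq># ?m}. g i k \<otimes> h (?c - i) (?m - k))"
    proof (rule finsum_cong')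
      fix k assume k: "k \<in> {k. k \<subseteq># ?m}"
      have eq: "m - (k + replicate_mset i n) = (?m - k) + replicate_mset (?c - i) n"
      proof (rule multiset_eqI)
        fix x
        have "count k x \<le> count ?m x" using k by (intro mset_subset_eq_count) simp
        moreover have "n \<notin># k" using k nm by blast
        ultimately show "count (m - (k + replicate_mset i n)) x = count ((?m - k) + replicate_mset (?c - i) n) x"
          using i by (auto simp: not_in_iff)
      qed
      have nk: "n \<notin># k" using k nm by blast
      have nmk: "n \<notin># ?m - k" by (auto dest: in_diffD)
      show "join_var n g (k + replicate_mset i n) \<otimes> join_var n h (m - (k + replicate_mset i n))
          = g i k \<otimes> h (?c - i) (?m - k)"
        by (simp only: eq join_var_def filter_add_replicate(1,2)[OF nk] filter_add_replicate(1,2)[OF nmk])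
    qed (use g h in auto)
    finally show "(\<Oplus>k\<in>T i. join_var n g k \<otimes> join_var n h (m - k)) =
        (\<Oplus>k\<in>{k. k \<subseteq># ?m}. g i k \<otimes> h (?c - i) (?m - k))" .
  qed (use g h in auto)
  finally show ?thesis by simp
qed

lemma mpoly_ring_Suc_iso:
  assumes ring: "ring (mpoly_ring R n)"
  shows "join_var n \<in> ring_iso (UP (mpoly_ring R n)) (mpoly_ring R (Suc n))"
proof -
  let ?M = "mpoly_ring R n" and ?U = "UP (mpoly_ring R n)"
  interpret M: ring ?M by (rule ring)
  have U: "carrier ?U = up ?M" by (simp add: UP_def)
  have coeff: "f i \<in> finite_support {..<n}" if "f \<in> up ?M" for f i
    using that by (metis mem_upD mpoly_ring_simps(1))
  have coeff': "f i k \<in> carrier R" if "f \<in> up ?M" for f i k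
    using coeff[OF that] by (simp add: finite_support_def)
  have bnd: "\<exists>b. \<forall>i>b. f i = (\<lambda>m. \<zero>)" if "f \<in> up ?M" for f
    using M.bound_upD[OF that] by (auto simp: bound_def mpoly_ring_simps)
  have free: "f i k = \<zero>" if "f \<in> up ?M" "n \<in># k" for f i k
    using coeff[OF that(1), of i] that(2) by (force simp: finite_support_def)
  {
    fix f assume "f \<in> carrier ?U"
    then have f: "f \<in> up ?M" by (simp add: U)
    obtain b where b: "\<And>i. i > b \<Longrightarrow> f i = (\<lambda>m. \<zero>)" using bnd[OF f] by blast
    \<comment> \<open>The degree bound \<open>b\<close> leaves finitely many coefficient
      polynomials, each with finite support.\<close>
    have "{m. join_var n f m \<noteq> \<zero>} \<subseteq> (\<Union>i\<in>{..b}. (\<lambda>k. k + replicate_mset i n) ` {k. f i k \<noteq> \<zero>})"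
    proof
      fix m assume "m \<in> {m. join_var n f m \<noteq> \<zero>}"
      then have "f (count m n) (filter_mset ((\<noteq>) n) m) \<noteq> \<zero>" by (simp add: join_var_def)
      moreover from this have "count m n \<le> b" using b by (meson not_le)
      moreover have "m = filter_mset ((\<noteq>) n) m + replicate_mset (count m n) n"
        by (simp add: filter_add_replicate)
      ultimately show "m \<in> (\<Union>i\<in>{..b}. (\<lambda>k. k + replicate_mset i n) ` {k. f i k \<noteq> \<zero>})" by blast
    qed
    moreover have "finite (\<Union>i\<in>{..b}. (\<lambda>k. k + replicate_mset i n) ` {k. f i k \<noteq> \<zero>})"
      using coeff[OF f] by (auto simp: finite_support_def)
    ultimately have "finite {m. join_var n f m \<noteq> \<zero>}" by (rule finite_subset)
    moreover have "set_mset m \<subseteq> {..<Suc n}" if "join_var n f m \<noteq> \<zero>" for m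
    proof
      fix x assume x: "x \<in># m"
      have "set_mset (filter_mset ((\<noteq>) n) m) \<subseteq> {..<n}"
        using coeff[OF f, of "count m n"] that unfolding finite_support_def join_var_def by blast
      then show "x \<in> {..<Suc n}" using x by (cases "x = n") auto
    qed
    ultimately have "join_var n f \<in> carrier (mpoly_ring R (Suc n))"
      using coeff'[OF f] by (simp add: mpoly_ring_simps finite_support_def join_var_def)
  } note join_closed = this
  show ?thesis
  proof (rule ring_iso_memI)
    show "join_var n f \<in> carrier (mpoly_ring R (Suc n))" if "f \<in> carrier ?U" for f
      by (rule join_closed[OF that])
  next
    fix f g assume "f \<in> carrier ?U" "g \<in> carrier ?U"
    then have fg: "f \<in> up ?M" "g \<in> up ?M" by (simp_all add: U)
    show "join_var n (f \<otimes>\<^bsub>?U\<^esub> g) = join_var n f \<otimes>\<^bsub>mpoly_ring R (Suc n)\<^esub> join_var n g"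
    proof
      fix m
      let ?m = "filter_mset ((\<noteq>) n) m" and ?c = "count m n"
      have "join_var n (f \<otimes>\<^bsub>?U\<^esub> g) m = (\<Oplus>\<^bsub>?M\<^esub>i\<in>{..?c}. f i \<otimes>\<^bsub>?M\<^esub> g (?c - i)) ?m"
        using fg by (simp add: join_var_def UP_def)
      also have "\<dots> = (\<Oplus>i\<in>{..?c}. (f i \<otimes>\<^bsub>?M\<^esub> g (?c - i)) ?m)"
        using fg by (intro mpoly_finsum_apply[OF ring]) auto
      also have "\<dots> = (f' \<otimes>\<^bsub>mpoly_ring R (Suc n)\<^esub> g') m"
        if "f' = join_var n f" "g' = join_var n g" for f' g'
        unfolding that mpoly_ring_simps(2) by (rule join_var_mult) (use coeff' fg in auto)
      finally show "join_var n (f \<otimes>\<^bsub>?U\<^esub> g) m = (join_var n f \<otimes>\<^bsub>mpoly_ring R (Suc n)\<^esub> join_var n g) m"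
        by simp
    qed
    show "join_var n (f \<oplus>\<^bsub>?U\<^esub> g) = join_var n f \<oplus>\<^bsub>mpoly_ring R (Suc n)\<^esub> join_var n g"
      using fg by (auto simp: join_var_def UP_def mpoly_ring_simps fun_eq_iff)
  next
    show "join_var n \<one>\<^bsub>?U\<^esub> = \<one>\<^bsub>mpoly_ring R (Suc n)\<^esub>"
    proof
      fix m
      have "m = {#}" if "count m n = 0" "filter_mset ((\<noteq>) n) m = {#}"
      proof -
        have "m = filter_mset ((\<noteq>) n) m + replicate_mset (count m n) n"
          by (rule filter_add_replicate(3)[symmetric])
        also have "\<dots> = {#}" unfolding that by simp
        finally show ?thesis .
      qed
      then show "join_var n \<one>\<^bsub>?U\<^esub> m = \<one>\<^bsub>mpoly_ring R (Suc n)\<^esub> m"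
        by (auto simp: join_var_def UP_def mpoly_ring_simps indexed_const_def)
    qed
  next
    \<comment> \<open>The inverse map. A coefficient polynomial does not involve the variable
      \<open>n\<close>, which dictates the value zero on monomials containing it.\<close>
    define split where "split p i k = (if n \<in># k then \<zero> else p (k + replicate_mset i n))"
      for p :: "nat multiset \<Rightarrow> 'a" and i k
    have split_join: "split (join_var n f) = f" if "f \<in> carrier ?U" for f
    proof (intro ext)
      fix i k
      show "split (join_var n f) i k = f i k"
      proof (cases "n \<in># k")
        case True
        then show ?thesis using free[of f k i] that unfolding U split_def by simp
      next
        case False
        then show ?thesis unfolding split_def join_var_def filter_add_replicate(1,2)[OF False] by simp
      qed
    qed
    have join_split: "join_var n (split p) = p" for p
      unfolding join_var_def split_def filter_add_replicate(3) by (simp add: fun_eq_iff)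
    have split_up: "split p \<in> up ?M" if p: "p \<in> finite_support {..<Suc n}" for p
    proof (rule mem_upI)
      have fin: "finite {m. p m \<noteq> \<zero>}" using p by (simp add: finite_support_def)
      fix i
      have "{k. split p i k \<noteq> \<zero>} \<subseteq> filter_mset ((\<noteq>) n) ` {m. p m \<noteq> \<zero>}"
      proof
        fix k assume "k \<in> {k. split p i k \<noteq> \<zero>}"
        then have "n \<notin># k" "p (k + replicate_mset i n) \<noteq> \<zero>" by (auto simp: split_def split: if_splits)
        then show "k \<in> filter_mset ((\<noteq>) n) ` {m. p m \<noteq> \<zero>}"
          using filter_add_replicate(1)[of n k i] by (metis (mono_tags) image_eqI mem_Collect_eq)
      qed
      then have "finite {k. split p i k \<noteq> \<zero>}" by (rule finite_subset) (use fin in simp)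
      moreover have "set_mset k \<subseteq> {..<n}" if k: "split p i k \<noteq> \<zero>" for k
      proof -
        have "n \<notin># k" "p (k + replicate_mset i n) \<noteq> \<zero>" using k by (auto simp: split_def split: if_splits)
        then have "set_mset (k + replicate_mset i n) \<subseteq> {..<Suc n}" using p unfolding finite_support_def by blast
        then show ?thesis using \<open>n \<notin># k\<close> by (auto simp: less_Suc_eq)
      qed
      ultimately show "split p i \<in> carrier ?M"
        using p by (auto simp: mpoly_ring_simps finite_support_def split_def)
    next
      \<comment> \<open>The largest exponent of the variable \<open>n\<close> among the finitely
        many monomials of \<open>p\<close> bounds the degree.\<close>
      have "finite ((\<lambda>m. count m n) ` {m. p m \<noteq> \<zero>})" using p by (simp add: finite_support_def)
      then obtain b where b: "\<And>m. p m \<noteq> \<zero> \<Longrightarrow> count m n \<le> b"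
        by (auto simp: finite_nat_set_iff_bounded_le)
      have "split p i = (\<lambda>m. \<zero>)" if "i > b" for i
      proof
        fix k
        show "split p i k = \<zero>"
          using b[of "k + replicate_mset i n"] that by (auto simp: split_def)
      qed
      then show "\<exists>b. bound \<zero>\<^bsub>?M\<^esub> b (split p)"
        by (intro exI[of _ b]) (simp add: bound_def mpoly_ring_simps)
    qed
    show "bij_betw (join_var n) (carrier ?U) (carrier (mpoly_ring R (Suc n)))"
      unfolding bij_betw_def
    proof (intro conjI equalityI subsetI)
      show "inj_on (join_var n) (carrier ?U)" by (rule inj_on_inverseI) (rule split_join)
      fix p assume "p \<in> carrier (mpoly_ring R (Suc n))"
      then have "split p \<in> carrier ?U" using split_up by (simp add: U mpoly_ring_simps)
      then show "p \<in> join_var n ` carrier ?U" using join_split by (metis image_eqI)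
    qed (use join_closed in auto)
  qed
qed

end

text \<open>The induction also supplies the ring axioms for \<open>mpoly_ring A n\<close>: they are
  contained in \<open>ufd\<close> and are transported along \<open>join_var\<close> from the
  univariate polynomial ring.\<close>

theorem mpoly_ring_ufd:
  assumes "principal_domain A"
  shows "ufd (mpoly_ring A n)"
proof -
  interpret A: principal_domain A by fact
  show ?thesis
  proof (induction n)
    case 0
    show ?case
      by (rule A.ufd_iso[OF A.principal_domain_ufd A.mpoly_ring_0_iso]) (simp add: A.mpoly_ring_simps A.indexed_const_def)
  next
    case (Suc n)
    then interpret M: "domain" "mpoly_ring A n" by (simp add: ufd_def)
    interpret U: UP_domain "mpoly_ring A n" "UP (mpoly_ring A n)" by unfold_locales
    show ?case
    proof (rule domain.ufd_iso[OF U.UP_domain U.UP_ufd[OF Suc] A.mpoly_ring_Suc_iso[OF M.ring_axioms]])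
      show "A.join_var n \<zero>\<^bsub>UP (mpoly_ring A n)\<^esub> = \<zero>\<^bsub>mpoly_ring A (Suc n)\<^esub>"
        by (simp add: A.join_var_def UP_def A.mpoly_ring_simps fun_eq_iff)
    qed
  qed
qed

corollary ufd_if_iso_mpoly_ring:
  assumes "cring R" "principal_domain A" "R \<simeq> mpoly_ring A n"
  shows "ufd R"
proof -
  interpret R: cring R by fact
  obtain h where h: "h \<in> ring_iso R (mpoly_ring A n)" using assms(3) by (auto simp: is_ring_iso_def)
  interpret M: "domain" "mpoly_ring A n" using mpoly_ring_ufd[OF assms(2), of n] by (simp add: ufd_def)
  let ?g = "inv_into (carrier R) h"
  have g: "?g \<in> ring_iso (mpoly_ring A n) R" by (rule ring_iso_set_sym[OF R.ring_axioms h])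
  then have "?g \<zero>\<^bsub>mpoly_ring A n\<^esub> = \<zero>\<^bsub>R\<^esub>"
    using ring_hom_zero[of ?g "mpoly_ring A n" R] M.ring_axioms R.ring_axioms by (simp add: ring_iso_def)
  then show ?thesis by (rule M.ufd_iso[OF mpoly_ring_ufd[OF assms(2)] g])
qed

section \<open>Locally principal ideals\<close>

text \<open>Zorn's lemma gives a maximal ideal, which is prime. This is the local-global principle
  of the development: an ideal of multipliers that is contained in no prime contains one.\<close>

lemma (in cring) proper_ideal_below_prime:
  assumes I: "ideal I R" and one: "\<one> \<notin> I"
  obtains P where "primeideal P R" "I \<subseteq> P"
proof -
  let ?A = "{J. ideal J R \<and> I \<subseteq> J \<and> \<one> \<notin> J}"
  have "\<exists>M\<in>?A. \<forall>E\<in>?A. M \<subseteq> E \<longrightarrow> E = M"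
  proof (rule subset_Zorn_nonempty)
    show "?A \<noteq> {}" using assms by blast
    fix C assume C: "C \<noteq> {}" "subset.chain ?A C"
    then have CA: "C \<subseteq> ?A" by (auto simp: subset_chain_def)
    have "subset.chain {J. ideal J R} C" using C(2) by (auto simp: subset_chain_def)
    from chain_Union_is_ideal[OF this] have "ideal (\<Union>C) R" using C(1) by simp
    then show "\<Union>C \<in> ?A" using CA C(1) by blast
  qed
  then obtain M where "M \<in> ?A" and max: "\<forall>K\<in>?A. M \<subseteq> K \<longrightarrow> K = M" by (rule bexE)
  then have M: "ideal M R" "I \<subseteq> M" "\<one> \<notin> M" by simp_all
  have "maximalideal M R"
  proof (rule maximalidealI[OF M(1)])
    show "carrier R \<noteq> M" using M(3) one_closed by blast
    fix J assume J: "ideal J R" "M \<subseteq> J" "J \<subseteq> carrier R"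
    show "J = M \<or> J = carrier R"
    proof (cases "\<one> \<in> J")
      case True
      then show ?thesis using ideal.one_imp_carrier[OF J(1)] by blast
    next
      case False
      then have "J \<in> ?A" using J(1,2) M(2) by simp
      then show ?thesis using max J(2) by blast
    qed
  qed
  then show ?thesis using that maximalideal_prime M(2) by blast
qed

text \<open>For a finitely generated ideal \<open>J\<close> this says that every localization of \<open>J\<close> at a prime is
  generated by a single regular element.\<close>

definition locally_principal :: "('a, 'r) ring_scheme \<Rightarrow> 'a set \<Rightarrow> bool" where
  "locally_principal R J \<longleftrightarrow> ideal J R \<and>
     (\<forall>P. primeideal P R \<longrightarrow> (\<exists>x\<in>J. \<exists>s\<in>carrier R - P.
        (\<forall>y\<in>J. \<exists>r\<in>carrier R. s \<otimes>\<^bsub>R\<^esub> y = r \<otimes>\<^bsub>R\<^esub> x) \<and>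
        (\<forall>r\<in>carrier R. r \<otimes>\<^bsub>R\<^esub> x = \<zero>\<^bsub>R\<^esub> \<longrightarrow> (\<exists>t\<in>carrier R - P. t \<otimes>\<^bsub>R\<^esub> r = \<zero>\<^bsub>R\<^esub>))))"

definition linear_on :: "('a, 'r) ring_scheme \<Rightarrow> 'a set \<Rightarrow> ('a \<Rightarrow> 'a) \<Rightarrow> bool" where
  "linear_on R J \<psi> \<longleftrightarrow> (\<forall>y\<in>J. \<psi> y \<in> carrier R) \<and>
     (\<forall>y\<in>J. \<forall>z\<in>J. \<psi> (y \<oplus>\<^bsub>R\<^esub> z) = \<psi> y \<oplus>\<^bsub>R\<^esub> \<psi> z) \<and>
     (\<forall>r\<in>carrier R. \<forall>y\<in>J. \<psi> (r \<otimes>\<^bsub>R\<^esub> y) = r \<otimes>\<^bsub>R\<^esub> \<psi> y)"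

text \<open>Zero is excluded from \<open>E\<close> so that preimages of its members under an
  evaluation stay outside the kernel of that evaluation, as \<open>splitting\<close>
  demands.\<close>

definition ideal_dual_basis :: "('a, 'r) ring_scheme \<Rightarrow> 'a set \<Rightarrow> 'a set \<Rightarrow> ('a \<Rightarrow> 'a \<Rightarrow> 'a) \<Rightarrow> bool" where
  "ideal_dual_basis R J E \<psi> \<longleftrightarrow> finite E \<and> E \<subseteq> J - {\<zero>\<^bsub>R\<^esub>} \<and> (\<forall>x\<in>E. linear_on R J (\<psi> x)) \<and>
     (\<forall>y\<in>J. y = (\<Oplus>\<^bsub>R\<^esub>x\<in>E. \<psi> x y \<otimes>\<^bsub>R\<^esub> x))"

text \<open>The condition that turns a dual basis, which certifies projectivity, into the
  coordinates of a basis.\<close>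

definition orthonormal :: "('a, 'r) ring_scheme \<Rightarrow> 'b set \<Rightarrow> ('b \<Rightarrow> 'b \<Rightarrow> 'a) \<Rightarrow> bool" where
  "orthonormal R B \<phi> \<longleftrightarrow> (\<forall>b\<in>B. \<forall>b'\<in>B. \<phi> b b' = (if b = b' then \<one>\<^bsub>R\<^esub> else \<zero>\<^bsub>R\<^esub>))"

lemma locally_principalE:
  assumes "locally_principal R J" "primeideal P R"
  obtains x s where "x \<in> J" "s \<in> carrier R" "s \<notin> P"
    "\<And>y. y \<in> J \<Longrightarrow> \<exists>r\<in>carrier R. s \<otimes>\<^bsub>R\<^esub> y = r \<otimes>\<^bsub>R\<^esub> x"
    "\<And>r. \<lbrakk>r \<in> carrier R; r \<otimes>\<^bsub>R\<^esub> x = \<zero>\<^bsub>R\<^esub>\<rbrakk> \<Longrightarrow> \<exists>t\<in>carrier R - P. t \<otimes>\<^bsub>R\<^esub> r = \<zero>\<^bsub>R\<^esub>"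
  using assms unfolding locally_principal_def by (metis DiffE)

lemma (in cring) idealI_simple:
  assumes "I \<subseteq> carrier R" "\<zero> \<in> I" "\<And>a b. a \<in> I \<Longrightarrow> b \<in> I \<Longrightarrow> a \<oplus> b \<in> I"
    and "\<And>a r. a \<in> I \<Longrightarrow> r \<in> carrier R \<Longrightarrow> r \<otimes> a \<in> I"
  shows "ideal I R"
proof (rule idealI)
  show "subgroup I (add_monoid R)"
  proof (rule add.subgroupI)
    fix a assume a: "a \<in> I"
    then have "(\<ominus> \<one>) \<otimes> a \<in> I" using assms(4) by simp
    moreover have "(\<ominus> \<one>) \<otimes> a = \<ominus> a" using a assms(1) by (simp add: l_minus subset_iff)
    ultimately show "\<ominus> a \<in> I" by simp
  qed (use assms in auto)
  fix a r assume "a \<in> I" "r \<in> carrier R"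
  then show "r \<otimes> a \<in> I" "a \<otimes> r \<in> I" using assms(4)[of a r] m_comm[of r a] assms(1) by auto
qed (rule ring_axioms)

context cring
begin

text \<open>If \<open>r\<close> is nonzero, its annihilator is proper and lies in some prime P. The
  local generator at P is killed by \<open>r\<close>, so regularity yields an element outside P that
  kills \<open>r\<close>, a contradiction.\<close>

lemma locally_principal_annihilator:
  assumes J: "locally_principal R J" and r: "r \<in> carrier R" and ann: "\<And>x. x \<in> J \<Longrightarrow> r \<otimes> x = \<zero>"
  shows "r = \<zero>"
proof (rule ccontr)
  assume "r \<noteq> \<zero>"
  let ?A = "{t \<in> carrier R. t \<otimes> r = \<zero>}"
  have "ideal ?A R" by (rule idealI_simple) (use r in \<open>auto simp: l_distr m_assoc\<close>)
  moreover have "\<one> \<notin> ?A" using \<open>r \<noteq> \<zero>\<close> r by simp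
  ultimately obtain P where P: "primeideal P R" "?A \<subseteq> P" by (rule proper_ideal_below_prime)
  obtain x where x: "x \<in> J" "r \<otimes> x = \<zero> \<Longrightarrow> \<exists>t\<in>carrier R - P. t \<otimes> r = \<zero>"
    using locally_principalE[OF J P(1)] r by metis
  show False using x(2)[OF ann[OF x(1)]] P(2) by blast
qed

text \<open>If \<open>x\<close> were zero, regularity applied to \<open>r = \<one>\<close> would
  give \<open>t = \<zero>\<close> for some \<open>t\<close> outside \<open>P\<close>.\<close>

lemma locally_principal_generator_nonzero:
  assumes "primeideal P R"
    and "\<And>r. \<lbrakk>r \<in> carrier R; r \<otimes> x = \<zero>\<rbrakk> \<Longrightarrow> \<exists>t\<in>carrier R - P. t \<otimes> r = \<zero>"
  shows "x \<noteq> \<zero>"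
proof
  assume "x = \<zero>"
  then have "\<exists>t\<in>carrier R - P. t \<otimes> \<one> = \<zero>" using assms(2)[of \<one>] by simp
  moreover have "\<zero> \<in> P" using assms(1) by (simp add: additive_subgroup.zero_closed ideal.axioms(1) primeideal.axioms(1))
  ultimately show False by auto
qed

lemma linear_on_zero: "ideal J R \<Longrightarrow> linear_on R J (\<lambda>_. \<zero>)"
  by (auto simp: linear_on_def)

lemma linear_on_add:
  assumes "J \<subseteq> carrier R" "linear_on R J f" "linear_on R J g"
  shows "linear_on R J (\<lambda>y. f y \<oplus> g y)"
  using assms unfolding linear_on_def by (auto simp: r_distr a_ac)

lemma linear_on_smult:
  assumes "J \<subseteq> carrier R" "linear_on R J f" "a \<in> carrier R"
  shows "linear_on R J (\<lambda>y. a \<otimes> f y)"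
  using assms unfolding linear_on_def by (auto simp: r_distr m_lcomm)

text \<open>If \<open>s J \<subseteq> R x\<close>, then \<open>y \<mapsto> s r\<close>, where \<open>s y = r x\<close>, is well defined because \<open>J\<close> has zero
  annihilator, although \<open>r\<close> itself is not determined by \<open>y\<close>.\<close>

lemma locally_principal_linear:
  assumes J: "locally_principal R J" and x: "x \<in> J" and s: "s \<in> carrier R"
    and ex: "\<And>y. y \<in> J \<Longrightarrow> \<exists>r\<in>carrier R. s \<otimes> y = r \<otimes> x"
  obtains \<psi> where "linear_on R J \<psi>" "\<And>y. y \<in> J \<Longrightarrow> (s \<otimes> s) \<otimes> y = \<psi> y \<otimes> x"
proof -
  interpret J: ideal J R using J by (simp add: locally_principal_def)
  have JR: "J \<subseteq> carrier R" by (rule J.a_subset)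
  have xR: "x \<in> carrier R" using x JR by blast
  define q where "q y = (SOME r. r \<in> carrier R \<and> s \<otimes> y = r \<otimes> x)" for y
  have q: "q y \<in> carrier R" "s \<otimes> y = q y \<otimes> x" if "y \<in> J" for y
    using someI_ex[of "\<lambda>r. r \<in> carrier R \<and> s \<otimes> y = r \<otimes> x"] ex[OF that] unfolding q_def by blast+
  have uniq: "s \<otimes> r = s \<otimes> r'"
    if r: "r \<in> carrier R" "r' \<in> carrier R" and eq: "r \<otimes> x = r' \<otimes> x" for r r'
  proof -
    let ?d = "s \<otimes> (r \<ominus> r')"
    have d: "?d \<in> carrier R" using r s by simp
    have "?d \<otimes> z = \<zero>" if z: "z \<in> J" for z
    proof -
      have zR: "z \<in> carrier R" using z JR by blast
      \<comment> \<open>The factor \<open>s\<close> moves to \<open>z\<close> and makes it a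
        multiple of \<open>x\<close>, on which \<open>r\<close> and \<open>r'\<close> agree.\<close>
      have "?d \<otimes> z = (r \<ominus> r') \<otimes> (s \<otimes> z)" using r s zR by algebra
      also have "\<dots> = q z \<otimes> (r \<otimes> x \<ominus> r' \<otimes> x)"
        unfolding q(2)[OF z] using q(1)[OF z] xR r by algebra
      also have "\<dots> = \<zero>" unfolding eq using q(1)[OF z] xR r by algebra
      finally show ?thesis .
    qed
    then have "?d = \<zero>" by (rule locally_principal_annihilator[OF J d])
    moreover have "s \<otimes> r \<ominus> s \<otimes> r' = ?d" using r s by algebra
    ultimately show ?thesis using r s r_right_minus_eq[of "s \<otimes> r" "s \<otimes> r'"] by simp
  qed
  show ?thesis
  proof (rule that[of "\<lambda>y. s \<otimes> q y"])
    show "linear_on R J (\<lambda>y. s \<otimes> q y)"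
      unfolding linear_on_def
    proof (intro conjI ballI)
      fix y assume y: "y \<in> J"
      then show "s \<otimes> q y \<in> carrier R" using q s by simp
      have yR: "y \<in> carrier R" using y JR by blast
      {
        fix z assume z: "z \<in> J"
        have zR: "z \<in> carrier R" using z JR by blast
        have yz: "y \<oplus> z \<in> J" using y z by (rule J.a_closed)
        have "q (y \<oplus> z) \<otimes> x = s \<otimes> y \<oplus> s \<otimes> z"
          using q(2)[OF yz] s yR zR by (simp add: r_distr)
        also have "\<dots> = (q y \<oplus> q z) \<otimes> x" using q[OF y] q[OF z] xR by (simp add: l_distr)
        finally have "s \<otimes> q (y \<oplus> z) = s \<otimes> (q y \<oplus> q z)"
          using q(1)[OF y] q(1)[OF z] q(1)[OF yz] by (intro uniq) auto
        then show "s \<otimes> q (y \<oplus> z) = s \<otimes> q y \<oplus> s \<otimes> q z"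
          using q(1)[OF y] q(1)[OF z] s by (simp add: r_distr)
      }
    next
      fix r y assume r: "r \<in> carrier R" and y: "y \<in> J"
      have yR: "y \<in> carrier R" using y JR by blast
      have ry: "r \<otimes> y \<in> J" using r y by (intro J.I_l_closed)
      have "q (r \<otimes> y) \<otimes> x = r \<otimes> (s \<otimes> y)"
        using q(2)[OF ry] s yR r by (simp add: m_lcomm)
      also have "\<dots> = (r \<otimes> q y) \<otimes> x" using q[OF y] xR r by (simp add: m_assoc)
      finally have "s \<otimes> q (r \<otimes> y) = s \<otimes> (r \<otimes> q y)"
        using q(1)[OF y] q(1)[OF ry] r by (intro uniq) auto
      then show "s \<otimes> q (r \<otimes> y) = r \<otimes> (s \<otimes> q y)"
        using q(1)[OF y] r s by (simp add: m_lcomm)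
    qed
    fix y assume y: "y \<in> J"
    then have "y \<in> carrier R" using JR by blast
    then have "s \<otimes> s \<otimes> y = s \<otimes> (q y \<otimes> x)" unfolding q(2)[OF y, symmetric] using s by (simp add: m_assoc)
    then show "s \<otimes> s \<otimes> y = s \<otimes> q y \<otimes> x" using q(1)[OF y] s xR by (simp add: m_assoc)
  qed
qed

text \<open>Let \<open>T\<close> consist of the \<open>t\<close> for which multiplication by
  \<open>t\<close> on \<open>J\<close> has the form of a dual basis expansion. It is an ideal, and
  at each prime it contains the square of the local multiplier \<open>s\<close>, by
  \<open>locally_principal_linear\<close>. So it contains one. No finite cover or partition of unity
  has to be chosen.\<close>

lemma locally_principal_dual_basis:
  assumes J: "locally_principal R J"
  shows "\<exists>E \<psi>. ideal_dual_basis R J E \<psi>"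
proof -
  interpret J: ideal J R using J by (simp add: locally_principal_def)
  have JR: "J \<subseteq> carrier R" by (rule J.a_subset)
  \<comment> \<open>The forms are set to zero off \<open>E\<close> so that an expansion may be
    summed over any larger finite set; two expansions are then added over the union of their index
    sets.\<close>
  define rep where "rep t E \<psi> \<longleftrightarrow> finite E \<and> E \<subseteq> J - {\<zero>} \<and> (\<forall>x. linear_on R J (\<psi> x)) \<and>
      (\<forall>x. x \<notin> E \<longrightarrow> \<psi> x = (\<lambda>_. \<zero>)) \<and> (\<forall>y\<in>J. t \<otimes> y = (\<Oplus>x\<in>E. \<psi> x y \<otimes> x))" for t E \<psi>
  define T where "T = {t \<in> carrier R. \<exists>E \<psi>. rep t E \<psi>}"
  have psi: "\<psi> x y \<in> carrier R" if "rep t E \<psi>" "y \<in> J" for t E \<psi> x y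
    using that unfolding rep_def linear_on_def by blast
  have XR: "E \<subseteq> carrier R" if "rep t E \<psi>" for t E \<psi> using that JR unfolding rep_def by blast
  have enlarge: "t \<otimes> y = (\<Oplus>x\<in>Z. \<psi> x y \<otimes> x)"
    if rep: "rep t E \<psi>" and Z: "finite Z" "E \<subseteq> Z" "Z \<subseteq> carrier R" and y: "y \<in> J" for t E \<psi> Z y
  proof -
    have "(\<Oplus>x\<in>E. \<psi> x y \<otimes> x) = (\<Oplus>x\<in>Z. \<psi> x y \<otimes> x)"
    proof (rule add.finprod_mono_neutral_cong_left[OF Z(1,2)])
      show "\<psi> x y \<otimes> x = \<zero>" if "x \<in> Z - E" for x
        using rep that Z(3) unfolding rep_def by auto
      show "(\<lambda>x. \<psi> x y \<otimes> x) \<in> Z \<rightarrow> carrier R" using psi[OF rep y] Z(3) by auto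
    qed auto
    then show ?thesis using rep y unfolding rep_def by auto
  qed
  have "ideal T R"
  proof (rule idealI_simple)
    show "T \<subseteq> carrier R" by (auto simp: T_def)
    have "rep \<zero> {} (\<lambda>_ _. \<zero>)"
      using JR linear_on_zero[OF J.ideal_axioms] by (auto simp: rep_def)
    then show "\<zero> \<in> T" by (auto simp: T_def)
  next
    fix t t' assume "t \<in> T" "t' \<in> T"
    then obtain E \<psi> E' \<psi>' where t: "t \<in> carrier R" "rep t E \<psi>" and t': "t' \<in> carrier R" "rep t' E' \<psi>'"
      by (auto simp: T_def)
    let ?Z = "E \<union> E'"
    have Z: "finite ?Z" "?Z \<subseteq> J - {\<zero>}" using t t' unfolding rep_def by auto
    then have ZR: "?Z \<subseteq> carrier R" using JR by auto
    have "rep (t \<oplus> t') ?Z (\<lambda>x y. \<psi> x y \<oplus> \<psi>' x y)"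
      unfolding rep_def
    proof (intro conjI allI ballI impI)
      show "linear_on R J (\<lambda>y. \<psi> x y \<oplus> \<psi>' x y)" for x
        using t(2) t'(2) JR by (intro linear_on_add) (auto simp: rep_def)
      show "(\<lambda>y. \<psi> x y \<oplus> \<psi>' x y) = (\<lambda>_. \<zero>)" if "x \<notin> ?Z" for x
        using t(2) t'(2) that unfolding rep_def by auto
      fix y assume y: "y \<in> J"
      then have yR: "y \<in> carrier R" using JR by blast
      have "(t \<oplus> t') \<otimes> y = (\<Oplus>x\<in>?Z. \<psi> x y \<otimes> x) \<oplus> (\<Oplus>x\<in>?Z. \<psi>' x y \<otimes> x)"
        using enlarge[OF t(2) Z(1) _ ZR y] enlarge[OF t'(2) Z(1) _ ZR y] t(1) t'(1) yR by (simp add: l_distr)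
      also have "\<dots> = (\<Oplus>x\<in>?Z. \<psi> x y \<otimes> x \<oplus> \<psi>' x y \<otimes> x)"
        using psi[OF t(2) y] psi[OF t'(2) y] ZR by (intro finsum_addf[symmetric]) auto
      also have "\<dots> = (\<Oplus>x\<in>?Z. (\<psi> x y \<oplus> \<psi>' x y) \<otimes> x)"
        using psi[OF t(2) y] psi[OF t'(2) y] ZR by (intro finsum_cong') (auto simp: l_distr subset_iff)
      finally show "(t \<oplus> t') \<otimes> y = (\<Oplus>x\<in>?Z. (\<psi> x y \<oplus> \<psi>' x y) \<otimes> x)" .
    qed (use Z in auto)
    then show "t \<oplus> t' \<in> T" using t t' by (auto simp: T_def)
  next
    fix t r assume "t \<in> T" and r: "r \<in> carrier R"
    then obtain E \<psi> where t: "t \<in> carrier R" "rep t E \<psi>" by (auto simp: T_def)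
    have "rep (r \<otimes> t) E (\<lambda>x y. r \<otimes> \<psi> x y)"
      unfolding rep_def
    proof (intro conjI allI ballI impI)
      show "linear_on R J (\<lambda>y. r \<otimes> \<psi> x y)" for x
        using t(2) JR r by (intro linear_on_smult) (auto simp: rep_def)
      show "(\<lambda>y. r \<otimes> \<psi> x y) = (\<lambda>_. \<zero>)" if "x \<notin> E" for x
        using t(2) that r unfolding rep_def by auto
      fix y assume y: "y \<in> J"
      then have yR: "y \<in> carrier R" using JR by blast
      have "r \<otimes> t \<otimes> y = r \<otimes> (\<Oplus>x\<in>E. \<psi> x y \<otimes> x)"
        using t y r yR unfolding rep_def by (simp add: m_assoc)
      also have "\<dots> = (\<Oplus>x\<in>E. r \<otimes> (\<psi> x y \<otimes> x))"
        using t(2) r psi[OF t(2) y] XR[OF t(2)] by (intro finsum_rdistr) (auto simp: rep_def)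
      also have "\<dots> = (\<Oplus>x\<in>E. r \<otimes> \<psi> x y \<otimes> x)"
        using r psi[OF t(2) y] XR[OF t(2)] by (intro finsum_cong') (auto simp: m_assoc subset_iff)
      finally show "r \<otimes> t \<otimes> y = (\<Oplus>x\<in>E. r \<otimes> \<psi> x y \<otimes> x)" .
    qed (use t in \<open>auto simp: rep_def\<close>)
    then show "r \<otimes> t \<in> T" using t r by (auto simp: T_def)
  qed
  moreover have "\<not> T \<subseteq> P" if P: "primeideal P R" for P
  proof -
    obtain x s where xs: "x \<in> J" "s \<in> carrier R" "s \<notin> P"
      "\<And>y. y \<in> J \<Longrightarrow> \<exists>r\<in>carrier R. s \<otimes> y = r \<otimes> x"
      and reg: "\<And>r. \<lbrakk>r \<in> carrier R; r \<otimes> x = \<zero>\<rbrakk> \<Longrightarrow> \<exists>t\<in>carrier R - P. t \<otimes> r = \<zero>"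
      using locally_principalE[OF J P] by blast
    obtain \<psi> where \<psi>: "linear_on R J \<psi>" "\<And>y. y \<in> J \<Longrightarrow> s \<otimes> s \<otimes> y = \<psi> y \<otimes> x"
      using locally_principal_linear[OF J xs(1,2,4)] by blast
    have "x \<noteq> \<zero>" using locally_principal_generator_nonzero[OF P reg] by blast
    moreover have "x \<in> carrier R" using xs JR by blast
    ultimately have "rep (s \<otimes> s) {x} (\<lambda>z. if z = x then \<psi> else (\<lambda>_. \<zero>))"
      using xs \<psi> linear_on_zero[OF J.ideal_axioms] by (auto simp: rep_def linear_on_def)
    then have "s \<otimes> s \<in> T" using xs by (auto simp: T_def)
    moreover have "s \<otimes> s \<notin> P" using primeideal.I_prime[OF P xs(2,2)] xs(3) by blast
    ultimately show ?thesis by blast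
  qed
  ultimately have "\<one> \<in> T" using proper_ideal_below_prime by blast
  then obtain E \<psi> where rep: "rep \<one> E \<psi>" by (auto simp: T_def)
  have "ideal_dual_basis R J E \<psi>"
    unfolding ideal_dual_basis_def
  proof (intro conjI ballI)
    fix y assume y: "y \<in> J"
    then show "y = (\<Oplus>x\<in>E. \<psi> x y \<otimes> x)" using rep JR unfolding rep_def by auto
  qed (use rep in \<open>auto simp: rep_def\<close>)
  then show ?thesis by blast
qed

end

section \<open>Locally principal ideals in unique factorization domains\<close>

lemma (in domain) principal_dual_basis:
  assumes c: "c \<in> carrier R" "c \<noteq> \<zero>" "c \<in> J" and J: "ideal J R"
    and gen: "\<And>y. y \<in> J \<Longrightarrow> c divides y"
  shows "\<exists>E \<psi>. ideal_dual_basis R J E \<psi> \<and> orthonormal R E \<psi>"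
proof -
  interpret J: ideal J R by (rule J)
  note add = J.a_closed and mult = J.I_l_closed
  \<comment> \<open>Division by the generator \<open>c\<close> is the only coordinate form;
    \<open>q c = \<one>\<close> is the orthonormality.\<close>
  define q where "q y = (SOME r. r \<in> carrier R \<and> y = c \<otimes> r)" for y
  have q: "q y \<in> carrier R" "y = c \<otimes> q y" if "y \<in> J" for y
    using someI_ex[of "\<lambda>r. r \<in> carrier R \<and> y = c \<otimes> r"] gen[OF that] unfolding q_def factor_def by blast+
  have q_eq: "q (c \<otimes> r) = r" if "r \<in> carrier R" "c \<otimes> r \<in> J" for r
    using q[OF that(2)] m_lcancel[of c r "q (c \<otimes> r)"] c that by auto
  have "linear_on R J q"
    unfolding linear_on_def
  proof (intro conjI ballI)
    fix y z assume y: "y \<in> J" and z: "z \<in> J"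
    have "y \<oplus> z = c \<otimes> (q y \<oplus> q z)" using q[OF y] q[OF z] c by (metis r_distr)
    then show "q (y \<oplus> z) = q y \<oplus> q z"
      using q_eq[of "q y \<oplus> q z"] q[OF y] q[OF z] add[OF y z] by simp
  next
    fix r y assume r: "r \<in> carrier R" and y: "y \<in> J"
    have "r \<otimes> y = c \<otimes> (r \<otimes> q y)" using q[OF y] c r by (metis m_lcomm)
    then show "q (r \<otimes> y) = r \<otimes> q y"
      using q_eq[of "r \<otimes> q y"] q[OF y] mult[OF y r] r by simp
  qed (rule q(1))
  moreover have "y = (\<Oplus>x\<in>{c}. q y \<otimes> x)" if "y \<in> J" for y
  proof -
    have "y = c \<otimes> q y" by (rule q(2)[OF that])
    also have "\<dots> = q y \<otimes> c" using q(1)[OF that] c(1) by (rule m_comm[rotated])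
    also have "\<dots> = (\<Oplus>x\<in>{c}. q y \<otimes> x)" using q(1)[OF that] c(1) by simp
    finally show ?thesis .
  qed
  moreover have "q c = \<one>" using q_eq[of \<one>] c by simp
  ultimately have "ideal_dual_basis R J {c} (\<lambda>_. q)" "orthonormal R {c} (\<lambda>_. q)"
    using c by (auto simp: ideal_dual_basis_def orthonormal_def)
  then show ?thesis by blast
qed


text \<open>A prime factor \<open>p\<close> of \<open>x\<close> divides \<open>s y\<close> for every
  \<open>y\<close> in \<open>J\<close>, and some \<open>y\<close> is not divisible by
  \<open>p\<close>; so \<open>p\<close> divides \<open>s\<close> and can be removed from
  \<open>x\<close> and \<open>s\<close> together.\<close>

lemma (in domain) ufd_generator_divides_multiplier:
  assumes J: "J \<subseteq> carrier R"
    and np: "\<And>p. \<lbrakk>p \<in> carrier R; ring_prime p\<rbrakk> \<Longrightarrow> \<exists>y\<in>J. \<not> p divides y"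
    and x: "x \<in> prime_products R" and s: "s \<in> carrier R"
    and ex: "\<And>y. y \<in> J \<Longrightarrow> \<exists>r\<in>carrier R. s \<otimes> y = r \<otimes> x"
  shows "x divides s"
  using x s ex
proof (induction arbitrary: s rule: prime_products.induct)
  case (unit u)
  then have "u divides \<one>" by (metis divides_one Units_closed)
  then show ?case using divides_mult_right(1)[of u \<one> s] unit Units_closed[OF unit(1)] by simp
next
  case (mult p a)
  note p = mult.hyps(1,2) and s = mult.prems(1) and ex = mult.prems(2)
  have a: "a \<in> carrier R" using mult.hyps(3) prime_products_closed by blast
  have p0: "p \<noteq> \<zero>" using ring_primeD(1)[OF p(2)] .
  obtain y where y: "y \<in> J" "\<not> p divides y" using np[OF p] by blast
  have yR: "y \<in> carrier R" using y J by blast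
  obtain r where r: "r \<in> carrier R" "s \<otimes> y = r \<otimes> (p \<otimes> a)" using ex[OF y(1)] by blast
  have "s \<otimes> y = p \<otimes> (r \<otimes> a)" unfolding r(2) using r(1) p a by (simp add: m_lcomm)
  then have "p divides (s \<otimes> y)" using divides_intro[of "r \<otimes> a"] r(1) a by simp
  then have "p divides s" using ring_primeD(3)[OF p(2) s yR] y(2) by blast
  then obtain t where t: "t \<in> carrier R" "s = p \<otimes> t" by (auto simp: factor_def)
  have "a divides t"
  proof (rule mult.IH[OF t(1)])
    fix z assume z: "z \<in> J"
    then have zR: "z \<in> carrier R" using J by blast
    obtain r where r: "r \<in> carrier R" "s \<otimes> z = r \<otimes> (p \<otimes> a)" using ex[OF z] by blast
    have "p \<otimes> (t \<otimes> z) = s \<otimes> z" unfolding t(2) using p t(1) zR by (simp add: m_assoc)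
    also have "\<dots> = p \<otimes> (r \<otimes> a)" unfolding r(2) using r(1) p a by (simp add: m_lcomm)
    finally have "t \<otimes> z = r \<otimes> a" using m_lcancel[of p] p0 p t(1) zR r(1) a by simp
    then show "\<exists>r\<in>carrier R. t \<otimes> z = r \<otimes> a" using r(1) by blast
  qed
  then show ?case unfolding t(2) using divides_mult[OF a p(1)] by blast
qed

text \<open>The element \<open>a\<close> is a common multiple of all common divisors of
  \<open>J\<close> and measures how much can still be divided out. If \<open>p\<close> divides all
  of \<open>J\<close>, both \<open>J\<close> and \<open>a\<close> lose the factor \<open>p\<close>;
  otherwise \<open>a\<close> loses it and \<open>J\<close> stays. When \<open>a\<close> has become a
  unit, no prime divides all of \<open>J\<close>, and \<open>J\<close> must be the whole
  ring.\<close>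

lemma (in domain) ufd_locally_principal_aux:
  assumes ufd: "ufd R" and a: "a \<in> prime_products R" and J: "locally_principal R J"
    and "\<And>d. \<lbrakk>d \<in> carrier R; \<And>y. y \<in> J \<Longrightarrow> d divides y\<rbrakk> \<Longrightarrow> d divides a"
  shows "\<exists>c\<in>J. \<forall>y\<in>J. c divides y"
  using a J assms(4)
proof (induction arbitrary: J rule: prime_products.induct)
  case (unit u)
  interpret J: ideal J R using unit by (simp add: locally_principal_def)
  have np: "\<exists>y\<in>J. \<not> p divides y" if "p \<in> carrier R" "ring_prime p" for p
    using unit(3)[OF that(1)] divides_unit[OF that(1) _ unit(1)] ring_primeD(2)[OF that(2)] by blast
  \<comment> \<open>Otherwise \<open>J\<close> lies in a prime \<open>P\<close>. The local generator
    at \<open>P\<close> divides its multiplier \<open>s\<close>, so \<open>s\<close> belongs to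
    \<open>J\<close> and to \<open>P\<close>.\<close>
  have "\<one> \<in> J"
  proof (rule ccontr)
    assume "\<one> \<notin> J"
    then obtain P where P: "primeideal P R" "J \<subseteq> P" by (rule proper_ideal_below_prime[OF J.ideal_axioms])
    obtain x s where xs: "x \<in> J" "s \<in> carrier R" "s \<notin> P"
      "\<And>y. y \<in> J \<Longrightarrow> \<exists>r\<in>carrier R. s \<otimes> y = r \<otimes> x"
      and reg: "\<And>r. \<lbrakk>r \<in> carrier R; r \<otimes> x = \<zero>\<rbrakk> \<Longrightarrow> \<exists>t\<in>carrier R - P. t \<otimes> r = \<zero>"
      using locally_principalE[OF unit(2) P(1)] by blast
    have "x \<noteq> \<zero>" using locally_principal_generator_nonzero[OF P(1) reg] by blast
    then have "x \<in> prime_products R" using xs(1) J.a_subset ufd by (auto simp: ufd_def)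
    then have "x divides s"
      using ufd_generator_divides_multiplier[OF J.a_subset np _ xs(2,4)] by blast
    then obtain t where "t \<in> carrier R" "s = x \<otimes> t" by (auto simp: factor_def)
    then have "s \<in> J" using J.I_r_closed[OF xs(1)] by simp
    then show False using xs(3) P(2) by blast
  qed
  then show ?case using one_divides J.a_subset by blast
next
  case (mult p a)
  interpret J: ideal J R using mult.prems by (simp add: locally_principal_def)
  note p = mult.hyps(1,2)
  have a: "a \<in> carrier R" using mult.hyps(3) prime_products_closed by blast
  have p0: "p \<noteq> \<zero>" using ring_primeD(1)[OF p(2)] .
  show ?case
  proof (cases "\<forall>y\<in>J. p divides y")
    case True
    \<comment> \<open>This is \<open>J\<close> divided by \<open>p\<close>. Cancelling
      \<open>p\<close> shows that the same multiplier \<open>s\<close> works for it, with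
      \<open>x\<close> divided by \<open>p\<close> as local generator.\<close>
    define K where "K = {z \<in> carrier R. p \<otimes> z \<in> J}"
    have KR: "z \<in> carrier R" if "z \<in> K" for z using that by (simp add: K_def)
    have JK: "\<exists>z\<in>K. y = p \<otimes> z" if "y \<in> J" for y
      using True that by (auto simp: K_def factor_def)
    have "ideal K R"
      by (rule idealI_simple) (use p in \<open>auto simp: K_def r_distr m_lcomm intro: J.I_l_closed\<close>)
    moreover have "\<exists>x\<in>K. \<exists>s\<in>carrier R - P. (\<forall>y\<in>K. \<exists>r\<in>carrier R. s \<otimes> y = r \<otimes> x) \<and>
        (\<forall>r\<in>carrier R. r \<otimes> x = \<zero> \<longrightarrow> (\<exists>t\<in>carrier R - P. t \<otimes> r = \<zero>))"
      if P: "primeideal P R" for P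
    proof -
      obtain x s where xs: "x \<in> J" "s \<in> carrier R" "s \<notin> P"
        "\<And>y. y \<in> J \<Longrightarrow> \<exists>r\<in>carrier R. s \<otimes> y = r \<otimes> x"
        and reg: "\<And>r. \<lbrakk>r \<in> carrier R; r \<otimes> x = \<zero>\<rbrakk> \<Longrightarrow> \<exists>t\<in>carrier R - P. t \<otimes> r = \<zero>"
        using locally_principalE[OF mult.prems(1) P] by blast
      obtain z where z: "z \<in> K" "x = p \<otimes> z" using JK[OF xs(1)] by blast
      have "\<exists>r\<in>carrier R. s \<otimes> y = r \<otimes> z" if y: "y \<in> K" for y
      proof -
        obtain r where r: "r \<in> carrier R" "s \<otimes> (p \<otimes> y) = r \<otimes> (p \<otimes> z)"
          using xs(4)[of "p \<otimes> y"] y z(2) by (auto simp: K_def)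
        then have "p \<otimes> (s \<otimes> y) = p \<otimes> (r \<otimes> z)" using p xs(2) KR[OF y] KR[OF z(1)] by (simp add: m_lcomm)
        then have "s \<otimes> y = r \<otimes> z" using p p0 xs(2) KR[OF y] KR[OF z(1)] r(1) m_lcancel[of p] by simp
        then show ?thesis using r(1) by blast
      qed
      moreover have "\<exists>t\<in>carrier R - P. t \<otimes> r = \<zero>" if "r \<in> carrier R" "r \<otimes> z = \<zero>" for r
        using reg[OF that(1)] that p KR[OF z(1)] z(2) by (simp add: m_lcomm)
      ultimately show ?thesis using z(1) xs(2,3) by blast
    qed
    ultimately have K: "locally_principal R K" by (auto simp: locally_principal_def)
    have "\<exists>c\<in>K. \<forall>y\<in>K. c divides y"
    proof (rule mult.IH[OF K])
      fix d assume d: "d \<in> carrier R" "\<And>y. y \<in> K \<Longrightarrow> d divides y"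
      have "(p \<otimes> d) divides y" if "y \<in> J" for y
        using JK[OF that] d divides_mult[OF d(1) p(1)] by blast
      then have "(p \<otimes> d) divides (p \<otimes> a)" using mult.prems(2)[of "p \<otimes> d"] p d(1) by simp
      then show "d divides a" using mult_divides[of d a p] p p0 d(1) a by simp
    qed
    then obtain c where c: "c \<in> K" "\<And>y. y \<in> K \<Longrightarrow> c divides y" by blast
    have "(p \<otimes> c) divides y" if "y \<in> J" for y
      using JK[OF that] c(2) divides_mult[OF KR[OF c(1)] p(1)] by blast
    moreover have "p \<otimes> c \<in> J" using c(1) by (simp add: K_def)
    ultimately show ?thesis by blast
  next
    case False
    show ?thesis
    proof (rule mult.IH[OF mult.prems(1)])
      fix d assume d: "d \<in> carrier R" "\<And>y. y \<in> J \<Longrightarrow> d divides y"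
      then obtain e where e: "e \<in> carrier R" "p \<otimes> a = d \<otimes> e"
        using mult.prems(2)[OF d] by (auto simp: factor_def)
      have "p divides (d \<otimes> e)" by (rule divides_intro[OF a e(2)[symmetric]])
      \<comment> \<open>If \<open>p\<close> divided \<open>d\<close>, it would divide all of
        \<open>J\<close>. So \<open>p\<close> cancels from the cofactor \<open>e\<close>.\<close>
      moreover have "\<not> p divides d"
        using False d(2) divides_trans[OF _ _ p(1)] by blast
      ultimately have "p divides e" using ring_primeD(3)[OF p(2) d(1) e(1)] by blast
      then obtain e' where e': "e' \<in> carrier R" "e = p \<otimes> e'" by (auto simp: factor_def)
      have "p \<otimes> a = p \<otimes> (d \<otimes> e')" using e(2) e' d p by (simp add: m_lcomm)
      then have "a = d \<otimes> e'" using p0 p a d e' m_lcancel[of p] by simp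
      then show "d divides a" using e' by (auto simp: factor_def)
    qed
  qed
qed

lemma (in domain) locally_principal_nonzero_element:
  assumes "locally_principal R J"
  obtains x where "x \<in> J" "x \<noteq> \<zero>"
  using locally_principal_annihilator[OF assms, of \<one>] one_not_zero assms
  unfolding locally_principal_def by (metis ideal.Icarr l_one one_closed)

lemma (in domain) ufd_locally_principal:
  assumes ufd: "ufd R" and J: "locally_principal R J"
  shows "\<exists>E \<psi>. ideal_dual_basis R J E \<psi> \<and> orthonormal R E \<psi>"
proof -
  interpret J: ideal J R using J by (simp add: locally_principal_def)
  \<comment> \<open>A nonzero element of \<open>J\<close> is a multiple of every common divisor of
    \<open>J\<close>, which starts the induction.\<close>
  obtain x where x: "x \<in> J" "x \<noteq> \<zero>" using locally_principal_nonzero_element[OF J] .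
  then have "x \<in> prime_products R" using ufd J.a_subset by (auto simp: ufd_def)
  then obtain c where c: "c \<in> J" "\<And>y. y \<in> J \<Longrightarrow> c divides y"
    using ufd_locally_principal_aux[OF ufd _ J, of x] x(1) by blast
  have "c \<noteq> \<zero>" using c(2)[OF x(1)] x(2) zero_divides by blast
  then show ?thesis using principal_dual_basis[of c J] c J.ideal_axioms J.Icarr by blast
qed

section \<open>Dual bases of modules\<close>

lemma finsum_additive_map:
  assumes M: "abelian_group M" and N: "abelian_group N"
    and closed: "\<And>x. x \<in> carrier M \<Longrightarrow> h x \<in> carrier N"
    and add: "\<And>x y. \<lbrakk>x \<in> carrier M; y \<in> carrier M\<rbrakk> \<Longrightarrow> h (x \<oplus>\<^bsub>M\<^esub> y) = h x \<oplus>\<^bsub>N\<^esub> h y"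
    and "finite A" and "\<And>i. i \<in> A \<Longrightarrow> f i \<in> carrier M"
  shows "h (\<Oplus>\<^bsub>M\<^esub>i\<in>A. f i) = (\<Oplus>\<^bsub>N\<^esub>i\<in>A. h (f i))"
proof -
  interpret M: abelian_group M by fact
  interpret N: abelian_group N by fact
  have zero: "h \<zero>\<^bsub>M\<^esub> = \<zero>\<^bsub>N\<^esub>"
    using add[OF M.zero_closed M.zero_closed] closed[OF M.zero_closed]
    by (metis M.r_zero M.zero_closed N.add.l_cancel_one')
  show ?thesis using assms(5,6)
  proof (induction rule: finite_induct)
    case (insert i A)
    have "(\<Oplus>\<^bsub>M\<^esub>j\<in>insert i A. f j) = f i \<oplus>\<^bsub>M\<^esub> (\<Oplus>\<^bsub>M\<^esub>j\<in>A. f j)"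
      using insert by (intro M.finsum_insert) auto
    moreover have "(\<Oplus>\<^bsub>N\<^esub>j\<in>insert i A. h (f j)) = h (f i) \<oplus>\<^bsub>N\<^esub> (\<Oplus>\<^bsub>N\<^esub>j\<in>A. h (f j))"
      using insert closed by (intro N.finsum_insert) auto
    moreover have "(\<Oplus>\<^bsub>M\<^esub>j\<in>A. f j) \<in> carrier M" using insert by (intro M.finsum_closed) auto
    ultimately show ?case using insert add by simp
  qed (simp add: zero)
qed

definition linear_form :: "('a, 'r) ring_scheme \<Rightarrow> ('a, 'm, 's) module_scheme \<Rightarrow> ('m \<Rightarrow> 'a) \<Rightarrow> bool" where
  "linear_form R M f \<longleftrightarrow> (\<forall>x\<in>carrier M. f x \<in> carrier R) \<and>
     (\<forall>x\<in>carrier M. \<forall>y\<in>carrier M. f (x \<oplus>\<^bsub>M\<^esub> y) = f x \<oplus>\<^bsub>R\<^esub> f y) \<and>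
     (\<forall>a\<in>carrier R. \<forall>x\<in>carrier M. f (a \<odot>\<^bsub>M\<^esub> x) = a \<otimes>\<^bsub>R\<^esub> f x)"

lemma linear_formD:
  assumes "linear_form R M f"
  shows "x \<in> carrier M \<Longrightarrow> f x \<in> carrier R"
    and "\<lbrakk>x \<in> carrier M; y \<in> carrier M\<rbrakk> \<Longrightarrow> f (x \<oplus>\<^bsub>M\<^esub> y) = f x \<oplus>\<^bsub>R\<^esub> f y"
    and "\<lbrakk>a \<in> carrier R; x \<in> carrier M\<rbrakk> \<Longrightarrow> f (a \<odot>\<^bsub>M\<^esub> x) = a \<otimes>\<^bsub>R\<^esub> f x"
  using assms by (auto simp: linear_form_def)

lemma module_homD:
  assumes "h \<in> module_hom R M N"
  shows "x \<in> carrier M \<Longrightarrow> h x \<in> carrier N"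
    and "\<lbrakk>x \<in> carrier M; y \<in> carrier M\<rbrakk> \<Longrightarrow> h (x \<oplus>\<^bsub>M\<^esub> y) = h x \<oplus>\<^bsub>N\<^esub> h y"
    and "\<lbrakk>a \<in> carrier R; x \<in> carrier M\<rbrakk> \<Longrightarrow> h (a \<odot>\<^bsub>M\<^esub> x) = a \<odot>\<^bsub>N\<^esub> h x"
  using assms by (auto simp: module_hom_def)

definition dual_basis :: "('a, 'r) ring_scheme \<Rightarrow> ('a, 'm, 's) module_scheme \<Rightarrow> 'm set \<Rightarrow> ('m \<Rightarrow> 'm \<Rightarrow> 'a) \<Rightarrow> bool" where
  "dual_basis R M B \<phi> \<longleftrightarrow> finite B \<and> B \<subseteq> carrier M \<and> (\<forall>b\<in>B. linear_form R M (\<phi> b)) \<and>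
     (\<forall>x\<in>carrier M. x = (\<Oplus>\<^bsub>M\<^esub>b\<in>B. \<phi> b x \<odot>\<^bsub>M\<^esub> b))"

context module
begin

lemma linear_form_finsum:
  assumes "linear_form R M f" "finite A" "\<And>i. i \<in> A \<Longrightarrow> g i \<in> carrier M"
  shows "f (\<Oplus>\<^bsub>M\<^esub>i\<in>A. g i) = (\<Oplus>i\<in>A. f (g i))"
  by (rule finsum_additive_map[OF M.abelian_group_axioms R.abelian_group_axioms])
    (use assms linear_formD[OF assms(1)] in auto)

lemma linear_form_zero:
  assumes "linear_form R M f" shows "f \<zero>\<^bsub>M\<^esub> = \<zero>"
  using linear_form_finsum[OF assms, of "{}"] by simp

text \<open>Used twice: for the lift that proves projectivity and for the section in
  \<open>splitting_step\<close>.\<close>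

lemma linear_combination_hom:
  assumes N: "module R N" and B: "finite B" and \<phi>: "\<And>b. b \<in> B \<Longrightarrow> linear_form R M (\<phi> b)"
    and n: "\<And>b. b \<in> B \<Longrightarrow> n b \<in> carrier N"
  shows "(\<lambda>x. \<Oplus>\<^bsub>N\<^esub>b\<in>B. \<phi> b x \<odot>\<^bsub>N\<^esub> n b) \<in> module_hom R M N"
proof -
  interpret N: module R N by (rule N)
  have t: "\<phi> b x \<odot>\<^bsub>N\<^esub> n b \<in> carrier N" if "b \<in> B" "x \<in> carrier M" for b x
    using linear_formD(1)[OF \<phi>] n that by auto
  show ?thesis
    unfolding module_hom_def
  proof (intro CollectI conjI ballI funcsetI)
    fix x assume x: "x \<in> carrier M"
    show "(\<Oplus>\<^bsub>N\<^esub>b\<in>B. \<phi> b x \<odot>\<^bsub>N\<^esub> n b) \<in> carrier N" using t x by (intro N.finsum_closed) auto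
    fix y assume y: "y \<in> carrier M"
    have "(\<Oplus>\<^bsub>N\<^esub>b\<in>B. \<phi> b (x \<oplus>\<^bsub>M\<^esub> y) \<odot>\<^bsub>N\<^esub> n b) = (\<Oplus>\<^bsub>N\<^esub>b\<in>B. \<phi> b x \<odot>\<^bsub>N\<^esub> n b \<oplus>\<^bsub>N\<^esub> \<phi> b y \<odot>\<^bsub>N\<^esub> n b)"
      using t x y n linear_formD[OF \<phi>] by (intro N.finsum_cong') (auto simp: N.smult_l_distr)
    also have "\<dots> = (\<Oplus>\<^bsub>N\<^esub>b\<in>B. \<phi> b x \<odot>\<^bsub>N\<^esub> n b) \<oplus>\<^bsub>N\<^esub> (\<Oplus>\<^bsub>N\<^esub>b\<in>B. \<phi> b y \<odot>\<^bsub>N\<^esub> n b)"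
      using t x y by (intro N.finsum_addf) auto
    finally show "(\<Oplus>\<^bsub>N\<^esub>b\<in>B. \<phi> b (x \<oplus>\<^bsub>M\<^esub> y) \<odot>\<^bsub>N\<^esub> n b) =
      (\<Oplus>\<^bsub>N\<^esub>b\<in>B. \<phi> b x \<odot>\<^bsub>N\<^esub> n b) \<oplus>\<^bsub>N\<^esub> (\<Oplus>\<^bsub>N\<^esub>b\<in>B. \<phi> b y \<odot>\<^bsub>N\<^esub> n b)" .
  next
    fix a x assume a: "a \<in> carrier R" and x: "x \<in> carrier M"
    have "a \<odot>\<^bsub>N\<^esub> (\<Oplus>\<^bsub>N\<^esub>b\<in>B. \<phi> b x \<odot>\<^bsub>N\<^esub> n b) = (\<Oplus>\<^bsub>N\<^esub>b\<in>B. a \<odot>\<^bsub>N\<^esub> (\<phi> b x \<odot>\<^bsub>N\<^esub> n b))"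
      by (rule finsum_additive_map[OF N.M.abelian_group_axioms N.M.abelian_group_axioms])
        (use a x t B in \<open>auto simp: N.smult_r_distr\<close>)
    also have "\<dots> = (\<Oplus>\<^bsub>N\<^esub>b\<in>B. \<phi> b (a \<odot>\<^bsub>M\<^esub> x) \<odot>\<^bsub>N\<^esub> n b)"
      using a x n linear_formD[OF \<phi>] by (intro N.finsum_cong') (auto simp: N.smult_assoc1)
    finally show "(\<Oplus>\<^bsub>N\<^esub>b\<in>B. \<phi> b (a \<odot>\<^bsub>M\<^esub> x) \<odot>\<^bsub>N\<^esub> n b) = a \<odot>\<^bsub>N\<^esub> (\<Oplus>\<^bsub>N\<^esub>b\<in>B. \<phi> b x \<odot>\<^bsub>N\<^esub> n b)"
      by simp
  qed
qed

text \<open>Choose preimages of the finitely many values \<open>h b\<close> and recombine them with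
  the coordinate forms. The construction is uniform in the types carrying \<open>N\<close> and
  \<open>L\<close>.\<close>

lemma dual_basis_projective:
  assumes "dual_basis R M B \<phi>"
  shows "projective_module TYPE('n) TYPE('l) R M"
  unfolding projective_module_def
proof (intro conjI allI impI)
  show "module R M" by (rule module_axioms)
  fix N :: "('a, 'n) module" and L :: "('a, 'l) module" and g h
  assume *: "module R N \<and> module R L \<and> g \<in> module_hom R N L \<and> g ` carrier N = carrier L \<and>
    h \<in> module_hom R M L"
  then interpret N: module R N by simp
  interpret L: module R L using * by simp
  have g: "g \<in> module_hom R N L" "g ` carrier N = carrier L" and h: "h \<in> module_hom R M L" using * by auto
  have B: "finite B" "B \<subseteq> carrier M" and \<phi>: "\<And>b. b \<in> B \<Longrightarrow> linear_form R M (\<phi> b)"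
    and rep: "\<And>x. x \<in> carrier M \<Longrightarrow> x = (\<Oplus>\<^bsub>M\<^esub>b\<in>B. \<phi> b x \<odot>\<^bsub>M\<^esub> b)"
    using assms by (auto simp: dual_basis_def)
  have "\<exists>n. n \<in> carrier N \<and> g n = h b" if "b \<in> B" for b
  proof -
    have "h b \<in> g ` carrier N" using module_homD(1)[OF h] B(2) that g(2) by blast
    then show ?thesis by auto
  qed
  then obtain n where n: "\<And>b. b \<in> B \<Longrightarrow> n b \<in> carrier N \<and> g (n b) = h b" by metis
  let ?k = "\<lambda>x. \<Oplus>\<^bsub>N\<^esub>b\<in>B. \<phi> b x \<odot>\<^bsub>N\<^esub> n b"
  have "?k \<in> module_hom R M N"
    using n by (intro linear_combination_hom[OF N.module_axioms B(1) \<phi>]) auto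
  moreover have "g (?k x) = h x" if x: "x \<in> carrier M" for x
  proof -
    have \<phi>x: "\<phi> b x \<in> carrier R" if "b \<in> B" for b using linear_formD(1)[OF \<phi>[OF that] x] .
    have "g (?k x) = (\<Oplus>\<^bsub>L\<^esub>b\<in>B. g (\<phi> b x \<odot>\<^bsub>N\<^esub> n b))"
      by (rule finsum_additive_map[OF N.M.abelian_group_axioms L.M.abelian_group_axioms])
        (use module_homD[OF g(1)] B(1) \<phi>x n in auto)
    also have "\<dots> = (\<Oplus>\<^bsub>L\<^esub>b\<in>B. h (\<phi> b x \<odot>\<^bsub>M\<^esub> b))"
      using module_homD[OF g(1)] module_homD[OF h] B(2) \<phi>x n
      by (intro L.finsum_cong') (auto simp: subset_iff)
    also have "\<dots> = h (\<Oplus>\<^bsub>M\<^esub>b\<in>B. \<phi> b x \<odot>\<^bsub>M\<^esub> b)"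
      by (rule finsum_additive_map[OF M.abelian_group_axioms L.M.abelian_group_axioms, symmetric])
        (use module_homD[OF h] B \<phi>x in auto)
    also have "\<dots> = h x" using rep[OF x] by simp
    finally show ?thesis .
  qed
  ultimately show "\<exists>k\<in>module_hom R M N. \<forall>x\<in>carrier M. g (k x) = h x"
    by (intro bexI[of _ ?k] ballI)
qed

text \<open>Applying the form \<open>\<phi> b\<close> to a linear relation isolates the coefficient
  of \<open>b\<close>.\<close>

lemma dual_basis_free:
  assumes db: "dual_basis R M B \<phi>" and orth: "orthonormal R B \<phi>"
  shows "free_module R M"
proof -
  have B: "finite B" "B \<subseteq> carrier M" and \<phi>: "\<And>b. b \<in> B \<Longrightarrow> linear_form R M (\<phi> b)"
    and rep: "\<And>x. x \<in> carrier M \<Longrightarrow> x = (\<Oplus>\<^bsub>M\<^esub>b\<in>B. \<phi> b x \<odot>\<^bsub>M\<^esub> b)"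
    using db by (auto simp: dual_basis_def)
  have "is_module_basis R M B"
    unfolding is_module_basis_def
  proof (intro conjI ballI allI impI B(2))
    fix x assume x: "x \<in> carrier M"
    show "\<exists>F c. finite F \<and> F \<subseteq> B \<and> c \<in> F \<rightarrow> carrier R \<and> x = (\<Oplus>\<^bsub>M\<^esub>b\<in>F. c b \<odot>\<^bsub>M\<^esub> b)"
      using B(1) rep[OF x] linear_formD(1)[OF \<phi> x]
      by (intro exI[of _ B] exI[of _ "\<lambda>b. \<phi> b x"] conjI) auto
  next
    fix F c b
    assume *: "finite F \<and> F \<subseteq> B \<and> c \<in> F \<rightarrow> carrier R \<and> (\<Oplus>\<^bsub>M\<^esub>b\<in>F. c b \<odot>\<^bsub>M\<^esub> b) = \<zero>\<^bsub>M\<^esub>" and b: "b \<in> F"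
    have F: "finite F" "F \<subseteq> carrier M" and c: "\<And>b. b \<in> F \<Longrightarrow> c b \<in> carrier R" and bB: "b \<in> B"
      using * b B by auto
    have "\<zero> = \<phi> b (\<Oplus>\<^bsub>M\<^esub>b'\<in>F. c b' \<odot>\<^bsub>M\<^esub> b')" using * linear_form_zero[OF \<phi>[OF bB]] by simp
    also have "\<dots> = (\<Oplus>b'\<in>F. \<phi> b (c b' \<odot>\<^bsub>M\<^esub> b'))"
      using F c by (intro linear_form_finsum[OF \<phi>[OF bB]]) auto
    also have "\<dots> = (\<Oplus>b'\<in>F. if b = b' then c b' else \<zero>)"
      using F c linear_formD(3)[OF \<phi>[OF bB]] orth bB *
      by (intro R.finsum_cong') (auto simp: orthonormal_def subset_iff)
    also have "\<dots> = c b" using R.finsum_singleton[OF b F(1), of c] c by auto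
    finally show "c b = \<zero>" by simp
  qed
  then show ?thesis using module_axioms by (auto simp: free_module_def)
qed

section \<open>Splitting off one coordinate at a time\<close>

definition kernel_of :: "('v \<Rightarrow> 'c \<Rightarrow> 'a) \<Rightarrow> 'v set \<Rightarrow> 'c set" where
  "kernel_of e W = {x \<in> carrier M. \<forall>v\<in>W. e v x = \<zero>}"

text \<open>A decomposition of the module into a part with a dual basis and the kernel of the
  coordinates in \<open>W\<close>, with \<open>\<rho>\<close> as the projection onto that kernel.
  Members of \<open>B\<close> serve as their own indices, so \<open>B\<close> must avoid the kernel:
  vectors found there later are then different from the old ones.\<close>

definition splitting :: "('v \<Rightarrow> 'c \<Rightarrow> 'a) \<Rightarrow> 'v set \<Rightarrow> 'c set \<Rightarrow> ('c \<Rightarrow> 'c \<Rightarrow> 'a) \<Rightarrow> ('c \<Rightarrow> 'c) \<Rightarrow> bool" where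
  "splitting e W B \<phi> \<rho> \<longleftrightarrow> finite B \<and> B \<subseteq> carrier M \<and> B \<inter> kernel_of e W = {} \<and>
     (\<forall>b\<in>B. linear_form R M (\<phi> b)) \<and> \<rho> \<in> module_hom R M M \<and>
     (\<forall>x\<in>carrier M. \<rho> x \<in> kernel_of e W) \<and>
     (\<forall>x\<in>carrier M. x = (\<Oplus>\<^bsub>M\<^esub>b\<in>B. \<phi> b x \<odot>\<^bsub>M\<^esub> b) \<oplus>\<^bsub>M\<^esub> \<rho> x) \<and>
     (\<forall>b\<in>B. \<forall>x\<in>kernel_of e W. \<phi> b x = \<zero>)"

text \<open>The coordinate forms vanish on the kernel, so only the \<open>\<rho>\<close> term of the
  expansion remains.\<close>

lemma splitting_kernel:
  assumes "splitting e W B \<phi> \<rho>" "x \<in> kernel_of e W"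
  shows "\<rho> x = x"
proof -
  have x: "x \<in> carrier M" using assms(2) by (simp add: kernel_of_def)
  have B: "B \<subseteq> carrier M" and zero: "\<And>b. b \<in> B \<Longrightarrow> \<phi> b x = \<zero>"
    and rep: "x = (\<Oplus>\<^bsub>M\<^esub>b\<in>B. \<phi> b x \<odot>\<^bsub>M\<^esub> b) \<oplus>\<^bsub>M\<^esub> \<rho> x"
    and \<rho>: "\<rho> x \<in> carrier M"
    using assms x unfolding splitting_def kernel_of_def by blast+
  have "(\<Oplus>\<^bsub>M\<^esub>b\<in>B. \<phi> b x \<odot>\<^bsub>M\<^esub> b) = \<zero>\<^bsub>M\<^esub>"
    by (rule M.add.finprod_one_eqI) (use B zero in auto)
  then have "x = \<zero>\<^bsub>M\<^esub> \<oplus>\<^bsub>M\<^esub> \<rho> x" using rep by (rule back_subst[where P = "\<lambda>z. x = z \<oplus>\<^bsub>M\<^esub> \<rho> x", rotated])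
  then show ?thesis using \<rho> by simp
qed

text \<open>By orthonormality the coordinate sum of \<open>b\<close> is already \<open>b\<close>,
  which leaves nothing for \<open>\<rho>\<close>.\<close>

lemma splitting_orthonormal_zero:
  assumes "splitting e W B \<phi> \<rho>" "orthonormal R B \<phi>" "b \<in> B"
  shows "\<rho> b = \<zero>\<^bsub>M\<^esub>"
proof -
  have B: "finite B" "B \<subseteq> carrier M" and b: "b \<in> carrier M"
    and rep: "b = (\<Oplus>\<^bsub>M\<^esub>b'\<in>B. \<phi> b' b \<odot>\<^bsub>M\<^esub> b') \<oplus>\<^bsub>M\<^esub> \<rho> b"
    and \<rho>: "\<rho> b \<in> carrier M"
    using assms(1,3) unfolding splitting_def kernel_of_def by blast+
  have "(\<Oplus>\<^bsub>M\<^esub>b'\<in>B. \<phi> b' b \<odot>\<^bsub>M\<^esub> b') = (\<Oplus>\<^bsub>M\<^esub>b'\<in>B. if b = b' then b' else \<zero>\<^bsub>M\<^esub>)"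
    using B assms(2,3) by (intro M.finsum_cong') (auto simp: orthonormal_def subset_iff)
  also have "\<dots> = b" using M.finsum_singleton[OF assms(3) B(1), of "\<lambda>b. b"] B(2) by auto
  finally have "b = b \<oplus>\<^bsub>M\<^esub> \<rho> b" using rep by (rule back_subst[where P = "\<lambda>z. b = z \<oplus>\<^bsub>M\<^esub> \<rho> b", rotated])
  then show ?thesis using M.add.l_cancel_one'[OF b \<rho>] by blast
qed

lemma kernel_of_closed:
  assumes "\<And>v. v \<in> W \<Longrightarrow> linear_form R M (e v)"
  shows "x \<in> kernel_of e W \<Longrightarrow> y \<in> kernel_of e W \<Longrightarrow> x \<oplus>\<^bsub>M\<^esub> y \<in> kernel_of e W"
    and "a \<in> carrier R \<Longrightarrow> x \<in> kernel_of e W \<Longrightarrow> a \<odot>\<^bsub>M\<^esub> x \<in> kernel_of e W"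
    and "\<zero>\<^bsub>M\<^esub> \<in> kernel_of e W"
    and "\<lbrakk>finite I; \<And>i. i \<in> I \<Longrightarrow> f i \<in> kernel_of e W\<rbrakk> \<Longrightarrow> (\<Oplus>\<^bsub>M\<^esub>i\<in>I. f i) \<in> kernel_of e W"
proof -
  show add: "x \<oplus>\<^bsub>M\<^esub> y \<in> kernel_of e W" if "x \<in> kernel_of e W" "y \<in> kernel_of e W" for x y
    using that linear_formD(2)[OF assms] by (simp add: kernel_of_def)
  show "a \<odot>\<^bsub>M\<^esub> x \<in> kernel_of e W" if "a \<in> carrier R" "x \<in> kernel_of e W"
    using that linear_formD(3)[OF assms] by (simp add: kernel_of_def)
  show zero: "\<zero>\<^bsub>M\<^esub> \<in> kernel_of e W" using linear_form_zero[OF assms] by (simp add: kernel_of_def)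
  assume "finite I" "\<And>i. i \<in> I \<Longrightarrow> f i \<in> kernel_of e W"
  then show "(\<Oplus>\<^bsub>M\<^esub>i\<in>I. f i) \<in> kernel_of e W"
  proof (induction rule: finite_induct)
    case (insert i I)
    then have "(\<Oplus>\<^bsub>M\<^esub>j\<in>insert i I. f j) = f i \<oplus>\<^bsub>M\<^esub> (\<Oplus>\<^bsub>M\<^esub>j\<in>I. f j)"
      by (intro M.finsum_insert) (auto simp: kernel_of_def)
    then show ?case using insert add by simp
  qed (simp add: zero)
qed

text \<open>Evaluation at \<open>v\<close> maps the current kernel onto an ideal with a dual basis,
  hence onto a projective module, and such a surjection splits. Lifting the dual basis makes the
  splitting explicit; its image joins the first summand, and the kernel of the evaluation becomes
  the second.\<close>

lemma splitting_step:
  assumes lin: "\<And>w. w \<in> insert v W \<Longrightarrow> linear_form R M (e w)"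
    and split: "splitting e W B \<phi> \<rho>"
    and db: "ideal_dual_basis R (e v ` kernel_of e W) E \<psi>"
  shows "\<exists>B' \<phi>' \<rho>'. splitting e (insert v W) B' \<phi>' \<rho>' \<and>
     (orthonormal R B \<phi> \<and> orthonormal R E \<psi> \<longrightarrow> orthonormal R B' \<phi>')"
proof -
  define K where "K = kernel_of e W"
  have KM: "K \<subseteq> carrier M" by (auto simp: K_def kernel_of_def)
  have K': "kernel_of e (insert v W) = {x \<in> K. e v x = \<zero>}" by (auto simp: K_def kernel_of_def)
  have B: "finite B" "B \<subseteq> carrier M" "B \<inter> K = {}"
    and \<phi>: "\<And>b. b \<in> B \<Longrightarrow> linear_form R M (\<phi> b)"
    and \<rho>: "\<rho> \<in> module_hom R M M" "\<And>x. x \<in> carrier M \<Longrightarrow> \<rho> x \<in> K"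
    and rep: "\<And>x. x \<in> carrier M \<Longrightarrow> x = (\<Oplus>\<^bsub>M\<^esub>b\<in>B. \<phi> b x \<odot>\<^bsub>M\<^esub> b) \<oplus>\<^bsub>M\<^esub> \<rho> x"
    and \<phi>0: "\<And>b x. \<lbrakk>b \<in> B; x \<in> K\<rbrakk> \<Longrightarrow> \<phi> b x = \<zero>"
    using split unfolding splitting_def K_def by blast+
  note \<rho>D = module_homD[OF \<rho>(1)]
  have \<rho>K: "\<rho> x = x" if "x \<in> K" for x using splitting_kernel[OF split] that by (simp add: K_def)
  have ev: "linear_form R M (e v)" using lin by blast
  note evD = linear_formD[OF ev]
  have E: "finite E" "E \<subseteq> e v ` K - {\<zero>}" and \<psi>: "\<And>x. x \<in> E \<Longrightarrow> linear_on R (e v ` K) (\<psi> x)"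
    and \<psi>rep: "\<And>y. y \<in> e v ` K \<Longrightarrow> y = (\<Oplus>x\<in>E. \<psi> x y \<otimes> x)"
    using db unfolding ideal_dual_basis_def K_def by blast+
  \<comment> \<open>Lifts of the dual basis elements into the kernel. Since \<open>e v\<close>
    inverts \<open>m\<close> on \<open>E\<close>, distinct elements have distinct lifts.\<close>
  define m where "m c = (SOME x. x \<in> K \<and> e v x = c)" for c
  have m: "m c \<in> K" "e v (m c) = c" if "c \<in> E" for c
    using someI_ex[of "\<lambda>x. x \<in> K \<and> e v x = c"] E(2) that unfolding m_def by blast+
  have mM: "m c \<in> carrier M" if "c \<in> E" for c using m(1)[OF that] KM by blast
  have inj: "inj_on m E" by (rule inj_on_inverseI[of _ "e v"]) (rule m(2))
  have disj: "B \<inter> m ` E = {}" using B(3) m(1) by blast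
  \<comment> \<open>Old vectors keep their forms. For a lift, the index \<open>c\<close> is
    recovered as \<open>e v b\<close>, and its form is composed with the projection
    \<open>\<rho>\<close>, because \<open>\<psi> c\<close> is meaningful only on values taken in the
    kernel.\<close>
  define \<phi>' where "\<phi>' b = (if b \<in> B then \<phi> b else (\<lambda>y. \<psi> (e v b) (e v (\<rho> y))))" for b
  have \<phi>'B: "\<phi>' b = \<phi> b" if "b \<in> B" for b using that by (simp add: \<phi>'_def)
  have \<phi>'E: "\<phi>' (m c) = (\<lambda>y. \<psi> c (e v (\<rho> y)))" if "c \<in> E" for c
    using that disj m(2) by (auto simp: \<phi>'_def)
  have zK: "\<zero>\<^bsub>M\<^esub> \<in> K" unfolding K_def using lin by (intro kernel_of_closed(3)) auto
  have \<psi>0: "\<psi> c \<zero> = \<zero>" if "c \<in> E" for c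
  proof -
    have z: "\<zero> \<in> e v ` K" by (rule image_eqI[of _ "e v", OF linear_form_zero[OF ev, symmetric] zK])
    then have "\<psi> c (\<zero> \<otimes> \<zero>) = \<zero> \<otimes> \<psi> c \<zero>" "\<psi> c \<zero> \<in> carrier R"
      using \<psi>[OF that] unfolding linear_on_def by blast+
    then show ?thesis by simp
  qed
  have lin_new: "linear_form R M (\<lambda>y. \<psi> c (e v (\<rho> y)))" if c: "c \<in> E" for c
    using \<psi>[OF c] \<rho>(2) \<rho>D evD unfolding linear_form_def linear_on_def by simp
  \<comment> \<open>The projection \<open>\<rho>\<close>, followed by evaluation at \<open>v\<close>
    and the section of that evaluation given by the lifts. So \<open>\<sigma> y\<close> and
    \<open>\<rho> y\<close> have the same value at \<open>v\<close>, and their difference lies in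
    the smaller kernel.\<close>
  define \<sigma> where "\<sigma> y = (\<Oplus>\<^bsub>M\<^esub>c\<in>E. \<psi> c (e v (\<rho> y)) \<odot>\<^bsub>M\<^esub> m c)" for y
  have \<sigma>: "\<sigma> \<in> module_hom R M M" unfolding \<sigma>_def
    using lin_new mM by (intro linear_combination_hom[OF module_axioms E(1)])
  note \<sigma>D = module_homD[OF \<sigma>]
  have t: "\<psi> c (e v (\<rho> y)) \<odot>\<^bsub>M\<^esub> m c \<in> K" if "c \<in> E" "y \<in> carrier M" for c y
    unfolding K_def using lin m(1)[OF that(1)] linear_formD(1)[OF lin_new[OF that(1)] that(2)]
    by (intro kernel_of_closed(2)) (auto simp: K_def)
  have \<sigma>K: "\<sigma> y \<in> K" if "y \<in> carrier M" for y
    unfolding \<sigma>_def K_def using lin t that E(1) by (intro kernel_of_closed(4)) (auto simp: K_def)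
  have e\<sigma>: "e v (\<sigma> y) = e v (\<rho> y)" if y: "y \<in> carrier M" for y
  proof -
    have "e v (\<sigma> y) = (\<Oplus>c\<in>E. e v (\<psi> c (e v (\<rho> y)) \<odot>\<^bsub>M\<^esub> m c))"
      unfolding \<sigma>_def using t y KM by (intro linear_form_finsum[OF ev E(1)]) auto
    also have "\<dots> = (\<Oplus>c\<in>E. \<psi> c (e v (\<rho> y)) \<otimes> c)"
      using evD(1)[OF mM] evD(3)[OF linear_formD(1)[OF lin_new y] mM] m(2) linear_formD(1)[OF lin_new y]
      by (intro R.finsum_cong') auto
    also have "\<dots> = e v (\<rho> y)" using \<psi>rep[of "e v (\<rho> y)"] \<rho>(2)[OF y] by simp
    finally show ?thesis .
  qed
  define \<rho>' where "\<rho>' y = \<rho> y \<ominus>\<^bsub>M\<^esub> \<sigma> y" for y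
  \<comment> \<open>Subtraction is rewritten as addition of a scalar multiple, so that the closure
    properties of the kernel and the linearity of \<open>e v\<close> apply.\<close>
  have \<rho>'_alt: "\<rho>' y = \<rho> y \<oplus>\<^bsub>M\<^esub> (\<ominus> \<one>) \<odot>\<^bsub>M\<^esub> \<sigma> y" if "y \<in> carrier M" for y
    using \<sigma>D(1)[OF that] by (simp add: \<rho>'_def M.minus_eq smult_l_minus)
  have \<rho>'_hom: "\<rho>' \<in> module_hom R M M"
    unfolding module_hom_def
  proof (intro CollectI conjI ballI funcsetI)
    fix x assume x: "x \<in> carrier M"
    show "\<rho>' x \<in> carrier M" using \<rho>D(1)[OF x] \<sigma>D(1)[OF x] by (simp add: \<rho>'_def)
    fix y assume y: "y \<in> carrier M"
    show "\<rho>' (x \<oplus>\<^bsub>M\<^esub> y) = \<rho>' x \<oplus>\<^bsub>M\<^esub> \<rho>' y"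
      using \<rho>D(1)[OF x] \<rho>D(1)[OF y] \<sigma>D(1)[OF x] \<sigma>D(1)[OF y] \<rho>D(2)[OF x y] \<sigma>D(2)[OF x y]
      by (simp add: \<rho>'_def M.minus_eq M.minus_add M.a_ac)
  next
    fix a x assume a: "a \<in> carrier R" and x: "x \<in> carrier M"
    show "\<rho>' (a \<odot>\<^bsub>M\<^esub> x) = a \<odot>\<^bsub>M\<^esub> \<rho>' x"
      using \<rho>D(1)[OF x] \<sigma>D(1)[OF x] \<rho>D(3)[OF a x] \<sigma>D(3)[OF a x] a
      by (simp add: \<rho>'_def M.minus_eq smult_r_distr smult_r_minus)
  qed
  have \<rho>'_in: "\<rho>' x \<in> kernel_of e (insert v W)" if x: "x \<in> carrier M" for x
  proof -
    have "\<rho>' x \<in> K" unfolding \<rho>'_alt[OF x] K_def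
      using lin \<rho>(2)[OF x] \<sigma>K[OF x] by (intro kernel_of_closed(1,2)) (auto simp: K_def)
    moreover have "e v (\<rho>' x) = \<zero>"
      using evD(1)[OF \<rho>D(1)[OF x]] evD(2)[OF \<rho>D(1)[OF x]] evD(3)[OF _ \<sigma>D(1)[OF x]] \<sigma>D(1)[OF x] e\<sigma>[OF x]
      by (simp add: \<rho>'_alt[OF x] R.l_minus R.r_neg)
    ultimately show ?thesis by (simp add: K')
  qed
  let ?B = "B \<union> m ` E"
  have \<phi>'_lin: "linear_form R M (\<phi>' b)" if "b \<in> ?B" for b
    using that \<phi> lin_new \<phi>'B \<phi>'E by auto
  have BM: "?B \<subseteq> carrier M" using B(2) mM by blast
  have \<phi>'_zero: "\<phi>' b x = \<zero>" if b: "b \<in> ?B" and x: "x \<in> kernel_of e (insert v W)" for b x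
    using b
  proof
    assume "b \<in> B" then show ?thesis using \<phi>'B \<phi>0 x by (simp add: K')
  next
    assume "b \<in> m ` E"
    then obtain c where "c \<in> E" "b = m c" by blast
    then show ?thesis using \<phi>'E \<psi>0 \<rho>K x by (simp add: K')
  qed
  have \<phi>'_rep: "x = (\<Oplus>\<^bsub>M\<^esub>b\<in>?B. \<phi>' b x \<odot>\<^bsub>M\<^esub> b) \<oplus>\<^bsub>M\<^esub> \<rho>' x" if x: "x \<in> carrier M" for x
  proof -
    have tm: "\<phi>' b x \<odot>\<^bsub>M\<^esub> b \<in> carrier M" if "b \<in> ?B" for b
      using linear_formD(1)[OF \<phi>'_lin[OF that] x] BM that by blast
    have tmB: "\<phi> b x \<odot>\<^bsub>M\<^esub> b \<in> carrier M" if "b \<in> B" for b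
      using linear_formD(1)[OF \<phi>[OF that] x] B(2) that by blast
    have S1: "(\<Oplus>\<^bsub>M\<^esub>b\<in>?B. \<phi>' b x \<odot>\<^bsub>M\<^esub> b) =
        (\<Oplus>\<^bsub>M\<^esub>b\<in>B. \<phi>' b x \<odot>\<^bsub>M\<^esub> b) \<oplus>\<^bsub>M\<^esub> (\<Oplus>\<^bsub>M\<^esub>b\<in>m ` E. \<phi>' b x \<odot>\<^bsub>M\<^esub> b)"
      using tm E(1) by (intro M.finsum_Un_disjoint[OF B(1) _ disj]) auto
    have S2: "(\<Oplus>\<^bsub>M\<^esub>b\<in>B. \<phi>' b x \<odot>\<^bsub>M\<^esub> b) = (\<Oplus>\<^bsub>M\<^esub>b\<in>B. \<phi> b x \<odot>\<^bsub>M\<^esub> b)"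
      using tmB \<phi>'B by (intro M.finsum_cong') auto
    have "(\<Oplus>\<^bsub>M\<^esub>b\<in>m ` E. \<phi>' b x \<odot>\<^bsub>M\<^esub> b) = (\<Oplus>\<^bsub>M\<^esub>c\<in>E. \<phi>' (m c) x \<odot>\<^bsub>M\<^esub> m c)"
      using tm by (intro M.finsum_reindex[OF _ inj]) auto
    also have "\<dots> = \<sigma> x" unfolding \<sigma>_def
      using t x KM \<phi>'E by (intro M.finsum_cong') auto
    finally have S3: "(\<Oplus>\<^bsub>M\<^esub>b\<in>m ` E. \<phi>' b x \<odot>\<^bsub>M\<^esub> b) = \<sigma> x" .
    have c: "(\<Oplus>\<^bsub>M\<^esub>b\<in>B. \<phi> b x \<odot>\<^bsub>M\<^esub> b) \<in> carrier M"
      using tmB by (intro M.finsum_closed) auto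
    have "(\<Oplus>\<^bsub>M\<^esub>b\<in>?B. \<phi>' b x \<odot>\<^bsub>M\<^esub> b) \<oplus>\<^bsub>M\<^esub> \<rho>' x =
        (\<Oplus>\<^bsub>M\<^esub>b\<in>B. \<phi> b x \<odot>\<^bsub>M\<^esub> b) \<oplus>\<^bsub>M\<^esub> \<rho> x"
      unfolding S1 S2 S3 \<rho>'_def using c \<sigma>D(1)[OF x] \<rho>D(1)[OF x]
      by (simp add: M.minus_eq M.a_assoc M.a_lcomm[of "\<sigma> x"] M.r_neg)
    then show ?thesis using rep[OF x] by (rule trans[rotated, OF sym])
  qed
  have disj': "?B \<inter> kernel_of e (insert v W) = {}"
    using B(3) m(2) E(2) by (auto simp: K')
  have "splitting e (insert v W) ?B \<phi>' \<rho>'"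
    unfolding splitting_def
    using B(1) E(1) BM disj' \<phi>'_lin \<rho>'_hom \<rho>'_in \<phi>'_rep \<phi>'_zero by (intro conjI ballI) auto
  moreover have "orthonormal R ?B \<phi>'" if o: "orthonormal R B \<phi>" "orthonormal R E \<psi>"
    unfolding orthonormal_def
  proof (intro ballI)
    fix b b' assume b: "b \<in> ?B" and b': "b' \<in> ?B"
    \<comment> \<open>In the mixed cases, old forms vanish on lifts because these lie in the kernel,
      and new forms vanish on old vectors because \<open>\<rho>\<close> kills them. On lifts
      \<open>\<rho>\<close> is the identity, so the last case is orthonormality of
      \<open>\<psi>\<close>.\<close>
    consider "b \<in> B" "b' \<in> B" | c' where "b \<in> B" "c' \<in> E" "b' = m c'"
      | c where "c \<in> E" "b = m c" "b' \<in> B" | c c' where "c \<in> E" "b = m c" "c' \<in> E" "b' = m c'"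
      using b b' by blast
    then show "\<phi>' b b' = (if b = b' then \<one> else \<zero>)"
    proof cases
      case 1
      then show ?thesis using o(1) \<phi>'B by (simp add: orthonormal_def)
    next
      case 2
      then have "b \<noteq> b'" using disj by blast
      then show ?thesis using 2 \<phi>'B \<phi>0 m(1) by simp
    next
      case 3
      then have "b \<noteq> b'" using disj by blast
      moreover have "\<rho> b' = \<zero>\<^bsub>M\<^esub>" by (rule splitting_orthonormal_zero[OF split o(1) 3(3)])
      ultimately show ?thesis using 3 \<phi>'E \<psi>0 linear_form_zero[OF ev] by simp
    next
      case 4
      have "\<phi>' b b' = \<psi> c c'" using 4 \<phi>'E \<rho>K m by simp
      moreover have "b = b' \<longleftrightarrow> c = c'" using 4 inj by (auto simp: inj_on_def)
      ultimately show ?thesis using 4 o(2) by (simp add: orthonormal_def)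
    qed
  qed
  ultimately show ?thesis by blast
qed

text \<open>For empty \<open>W\<close> the kernel is the whole module and \<open>\<rho>\<close> is
  the identity; for \<open>W = V\<close> the coordinates separate points, so the kernel is zero and
  \<open>\<rho>\<close> drops out. The hypothesis \<open>step\<close> is handed the current
  splitting, since its projection supplies the finite generation of the next ideal. The flag
  \<open>orth\<close> covers projectivity and freeness at once.\<close>

theorem dual_basis_exists:
  assumes V: "finite V" and lin: "\<And>v. v \<in> V \<Longrightarrow> linear_form R M (e v)"
    and inj: "\<And>x. \<lbrakk>x \<in> carrier M; \<And>v. v \<in> V \<Longrightarrow> e v x = \<zero>\<rbrakk> \<Longrightarrow> x = \<zero>\<^bsub>M\<^esub>"
    and step: "\<And>v W B \<phi> \<rho>. \<lbrakk>W \<subseteq> V; v \<in> V - W; splitting e W B \<phi> \<rho>\<rbrakk> \<Longrightarrow>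
      \<exists>E \<psi>. ideal_dual_basis R (e v ` kernel_of e W) E \<psi> \<and> (orth \<longrightarrow> orthonormal R E \<psi>)"
  shows "\<exists>B \<phi>. dual_basis R M B \<phi> \<and> (orth \<longrightarrow> orthonormal R B \<phi>)"
proof -
  have "\<exists>B \<phi> \<rho>. splitting e W B \<phi> \<rho> \<and> (orth \<longrightarrow> orthonormal R B \<phi>)" if "W \<subseteq> V" for W
    using finite_subset[OF that V] that
  proof (induction W rule: finite_induct)
    case empty
    have "splitting e {} {} (\<lambda>_ _. \<zero>) (\<lambda>x. x)"
      by (auto simp: splitting_def kernel_of_def module_hom_def)
    moreover have "orthonormal R {} (\<lambda>_ _. \<zero>)" by (simp add: orthonormal_def)
    ultimately show ?case by blast
  next
    case (insert v W)
    then obtain B \<phi> \<rho> where 1: "splitting e W B \<phi> \<rho>" "orth \<longrightarrow> orthonormal R B \<phi>" by blast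
    then obtain E \<psi> where 2: "ideal_dual_basis R (e v ` kernel_of e W) E \<psi>" "orth \<longrightarrow> orthonormal R E \<psi>"
      using step[of W v] insert by blast
    show ?case using splitting_step[OF _ 1(1) 2(1)] 1(2) 2(2) lin insert.prems by blast
  qed
  then obtain B \<phi> \<rho> where s: "splitting e V B \<phi> \<rho>" and o: "orth \<longrightarrow> orthonormal R B \<phi>" by blast
  have "dual_basis R M B \<phi>"
    unfolding dual_basis_def
  proof (intro conjI ballI)
    fix x assume x: "x \<in> carrier M"
    have "\<rho> x \<in> kernel_of e V" and rep: "x = (\<Oplus>\<^bsub>M\<^esub>b\<in>B. \<phi> b x \<odot>\<^bsub>M\<^esub> b) \<oplus>\<^bsub>M\<^esub> \<rho> x"
      using s x unfolding splitting_def by blast+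
    then have "\<rho> x = \<zero>\<^bsub>M\<^esub>" using inj by (simp add: kernel_of_def)
    moreover have "(\<Oplus>\<^bsub>M\<^esub>b\<in>B. \<phi> b x \<odot>\<^bsub>M\<^esub> b) \<in> carrier M"
    proof (intro M.finsum_closed funcsetI)
      fix b assume "b \<in> B"
      then have "linear_form R M (\<phi> b)" "b \<in> carrier M" using s unfolding splitting_def by blast+
      then show "\<phi> b x \<odot>\<^bsub>M\<^esub> b \<in> carrier M" using linear_formD(1)[OF _ x] by blast
    qed
    ultimately have "(\<Oplus>\<^bsub>M\<^esub>b\<in>B. \<phi> b x \<odot>\<^bsub>M\<^esub> b) \<oplus>\<^bsub>M\<^esub> \<rho> x = (\<Oplus>\<^bsub>M\<^esub>b\<in>B. \<phi> b x \<odot>\<^bsub>M\<^esub> b)" by simp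
    with rep show "x = (\<Oplus>\<^bsub>M\<^esub>b\<in>B. \<phi> b x \<odot>\<^bsub>M\<^esub> b)" by (rule trans)
  qed (use s in \<open>auto simp: splitting_def\<close>)
  then show ?thesis using o by blast
qed

end

section \<open>Localization\<close>

text \<open>Finitely many conditions stable under multiples are met by the product of the individual
  multipliers, which stays outside a prime ideal.\<close>

lemma (in cring) common_multiplier:
  assumes P: "primeideal P R" and "finite F"
    and ex: "\<And>i. i \<in> F \<Longrightarrow> \<exists>t\<in>carrier R - P. Q i t"
    and mult: "\<And>i t u. \<lbrakk>i \<in> F; t \<in> carrier R; u \<in> carrier R; Q i t\<rbrakk> \<Longrightarrow> Q i (u \<otimes> t)"
  shows "\<exists>t\<in>carrier R - P. \<forall>i\<in>F. Q i t"
  using \<open>finite F\<close> ex mult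
proof (induction rule: finite_induct)
  case empty
  have "\<one> \<notin> P" using primeideal.I_notcarr[OF P] ideal.one_imp_carrier[OF primeideal.axioms(1)[OF P]] by blast
  then show ?case by blast
next
  case (insert i F)
  obtain t where t: "t \<in> carrier R - P" "\<forall>j\<in>F. Q j t"
    using insert.IH insert.prems by (metis insertCI)
  obtain u where u: "u \<in> carrier R - P" "Q i u" using insert.prems(1) by blast
  have "u \<otimes> t \<in> carrier R - P" using primeideal.I_prime[OF P, of u t] t(1) u(1) by blast
  moreover have "Q i (u \<otimes> t)" using insert.prems(2)[of i u t] t u m_comm by auto
  moreover have "Q j (u \<otimes> t)" if "j \<in> F" for j using insert.prems(2)[of j t u] t u that by auto
  ultimately show ?case by blast
qed

text \<open>Says that \<open>c\<close> becomes a non-zero-divisor in the localization at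
  \<open>P\<close>, without forming that localization.\<close>

definition regular_at :: "('a, 'r) ring_scheme \<Rightarrow> 'a set \<Rightarrow> 'a \<Rightarrow> bool" where
  "regular_at R P c \<longleftrightarrow> c \<in> carrier R \<and>
     (\<forall>r\<in>carrier R. r \<otimes>\<^bsub>R\<^esub> c = \<zero>\<^bsub>R\<^esub> \<longrightarrow> (\<exists>t\<in>carrier R - P. t \<otimes>\<^bsub>R\<^esub> r = \<zero>\<^bsub>R\<^esub>))"

context module
begin

lemma linear_form_image_ideal:
  assumes f: "linear_form R M f"
  shows "ideal (f ` carrier M) R"
proof (rule R.idealI_simple)
  show "\<zero> \<in> f ` carrier M" using linear_form_zero[OF f] by (rule image_eqI[of _ f, OF sym]) simp
  fix a assume "a \<in> f ` carrier M"
  then obtain x where x: "a = f x" "x \<in> carrier M" by (rule imageE)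
  note x = x(2,1)
  {
    fix b assume "b \<in> f ` carrier M"
    then obtain y where y: "b = f y" "y \<in> carrier M" by (rule imageE)
    note y = y(2,1)
    show "a \<oplus> b \<in> f ` carrier M"
      unfolding x(2) y(2) linear_formD(2)[OF f x(1) y(1), symmetric] using x(1) y(1) by (intro imageI) simp
  next
    fix r assume r: "r \<in> carrier R"
    show "r \<otimes> a \<in> f ` carrier M"
      unfolding x(2) linear_formD(3)[OF f r x(1), symmetric] using r x(1) by (intro imageI) simp
  }
qed (use linear_formD(1)[OF f] in auto)

text \<open>Finite generation turns multipliers depending on the element into a uniform one.\<close>

lemma fin_gen_locally_principal:
  assumes fg: "fin_gen_module R M" and f: "linear_form R M f"
    and loc: "\<And>P. primeideal P R \<Longrightarrow> \<exists>c\<in>f ` carrier M. regular_at R P c \<and>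
      (\<forall>x\<in>carrier M. \<exists>s\<in>carrier R - P. c divides (s \<otimes> f x))"
  shows "locally_principal R (f ` carrier M)"
  unfolding locally_principal_def
proof (intro conjI allI impI linear_form_image_ideal[OF f])
  fix P assume P: "primeideal P R"
  obtain c where c: "c \<in> f ` carrier M" "regular_at R P c"
    "\<And>x. x \<in> carrier M \<Longrightarrow> \<exists>s\<in>carrier R - P. c divides (s \<otimes> f x)"
    using loc[OF P] by blast
  have cR: "c \<in> carrier R" using c(2) by (simp add: regular_at_def)
  obtain B where B: "finite B" "B \<subseteq> carrier M"
    "\<And>x. x \<in> carrier M \<Longrightarrow> \<exists>k\<in>B \<rightarrow> carrier R. x = (\<Oplus>\<^bsub>M\<^esub>b\<in>B. k b \<odot>\<^bsub>M\<^esub> b)"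
    using fg unfolding fin_gen_module_def by blast
  have "\<exists>s\<in>carrier R - P. \<forall>b\<in>B. c divides (s \<otimes> f b)"
  proof (rule R.common_multiplier[OF P B(1)])
    fix b s u assume b: "b \<in> B" and s: "s \<in> carrier R" "u \<in> carrier R" "c divides (s \<otimes> f b)"
    have "f b \<in> carrier R" using linear_formD(1)[OF f] b B(2) by blast
    then show "c divides (u \<otimes> s \<otimes> f b)"
      using R.divides_mult_right(2)[OF cR s(3,2)] s by (simp add: R.m_assoc)
  qed (use B(2) c(3) in blast)
  then obtain s where s: "s \<in> carrier R" "s \<notin> P" "\<And>b. b \<in> B \<Longrightarrow> c divides (s \<otimes> f b)" by blast
  have "\<exists>r\<in>carrier R. s \<otimes> y = r \<otimes> c" if y: "y \<in> f ` carrier M" for y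
  proof -
    obtain x where x: "y = f x" "x \<in> carrier M" using y by (rule imageE)
    note x = x(2,1)
    obtain k where "k \<in> B \<rightarrow> carrier R" "x = (\<Oplus>\<^bsub>M\<^esub>b\<in>B. k b \<odot>\<^bsub>M\<^esub> b)"
      using B(3)[OF x(1)] by (rule bexE)
    then have k: "\<And>b. b \<in> B \<Longrightarrow> k b \<in> carrier R" "x = (\<Oplus>\<^bsub>M\<^esub>b\<in>B. k b \<odot>\<^bsub>M\<^esub> b)"
      by (blast dest: funcset_mem)+
    have fb: "f b \<in> carrier R" if "b \<in> B" for b using linear_formD(1)[OF f] B(2) that by blast
    have "f x = (\<Oplus>b\<in>B. f (k b \<odot>\<^bsub>M\<^esub> b))"
      unfolding k(2) using B(2) k(1) by (intro linear_form_finsum[OF f B(1)]) auto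
    also have "\<dots> = (\<Oplus>b\<in>B. k b \<otimes> f b)"
      using B(2) k(1) fb linear_formD(3)[OF f] by (intro R.finsum_cong') auto
    finally have "s \<otimes> y = (\<Oplus>b\<in>B. s \<otimes> (k b \<otimes> f b))"
      unfolding x(2) using k(1) fb B(1) s(1) by (simp add: R.finsum_rdistr)
    moreover have "c divides (\<Oplus>b\<in>B. s \<otimes> (k b \<otimes> f b))"
    proof (rule R.divides_finsum[OF cR B(1)])
      fix b assume b: "b \<in> B"
      show "s \<otimes> (k b \<otimes> f b) \<in> carrier R" using k(1) fb s(1) b by simp
      have "s \<otimes> (k b \<otimes> f b) = k b \<otimes> (s \<otimes> f b)" using k(1)[OF b] fb[OF b] s(1) by (simp add: R.m_lcomm)
      then show "c divides (s \<otimes> (k b \<otimes> f b))" using R.divides_mult_right(2)[OF cR s(3)[OF b] k(1)[OF b]] by simp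
    qed
    ultimately obtain r where r: "r \<in> carrier R" "s \<otimes> y = c \<otimes> r" by (auto simp: factor_def)
    then show ?thesis using R.m_comm[OF cR r(1)] by auto
  qed
  then show "\<exists>x\<in>f ` carrier M. \<exists>s\<in>carrier R - P.
      (\<forall>y\<in>f ` carrier M. \<exists>r\<in>carrier R. s \<otimes> y = r \<otimes> x) \<and>
      (\<forall>r\<in>carrier R. r \<otimes> x = \<zero> \<longrightarrow> (\<exists>t\<in>carrier R - P. t \<otimes> r = \<zero>))"
    using c(1,2) s(1,2) unfolding regular_at_def by (intro bexI[of _ c] bexI[of _ s] conjI) auto
qed

end

section \<open>From labels over a localization to labels near a prime\<close>

locale localization_setup = cring +
  fixes S
  assumes sub: "S \<subseteq> carrier R" and one_S: "\<one> \<in> S"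
    and mult_S: "\<And>s t. s \<in> S \<Longrightarrow> t \<in> S \<Longrightarrow> s \<otimes> t \<in> S"
begin

abbreviation "L \<equiv> localization R S"

lemma loc_mult: "\<lbrakk>a \<in> carrier R; s \<in> S; b \<in> carrier R; t \<in> S\<rbrakk> \<Longrightarrow>
    fraction R S a s \<otimes>\<^bsub>L\<^esub> fraction R S b t = fraction R S (a \<otimes> b) (s \<otimes> t)"
  by (rule localization_mult[OF is_cring sub one_S]) (rule mult_S)

lemma loc_add: "\<lbrakk>a \<in> carrier R; s \<in> S; b \<in> carrier R; t \<in> S\<rbrakk> \<Longrightarrow>
    fraction R S a s \<oplus>\<^bsub>L\<^esub> fraction R S b t = fraction R S (a \<otimes> t \<oplus> b \<otimes> s) (s \<otimes> t)"
  by (rule localization_add[OF is_cring sub one_S]) (rule mult_S)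

lemma loc_carrier: "carrier L = {fraction R S a s |a s. a \<in> carrier R \<and> s \<in> S}"
  by (rule localization_carrier[OF is_cring sub one_S]) (rule mult_S)

lemma loc_zero: "\<zero>\<^bsub>L\<^esub> = fraction R S \<zero> \<one>"
  by (rule localization_zero[OF is_cring sub one_S]) (rule mult_S)

lemma loc_eq_iff: "\<lbrakk>a \<in> carrier R; s \<in> S; b \<in> carrier R; t \<in> S\<rbrakk> \<Longrightarrow>
    fraction R S a s = fraction R S b t \<longleftrightarrow> (\<exists>u\<in>S. u \<otimes> (a \<otimes> t) = u \<otimes> (b \<otimes> s))"
  by (rule frac_eq_iff[OF is_cring sub one_S]) (rule mult_S)

lemma loc_cring: "cring L"
  by (rule localization_cring[OF is_cring sub one_S]) (rule mult_S)

sublocale L: cring L by (rule loc_cring)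

lemma S_closed: "s \<in> S \<Longrightarrow> s \<in> carrier R" using sub by blast

lemma fraction_closed: "\<lbrakk>a \<in> carrier R; s \<in> S\<rbrakk> \<Longrightarrow> fraction R S a s \<in> carrier L"
  by (auto simp: loc_carrier)

lemma extended_ideal_self:
  assumes "I \<subseteq> carrier R" "a \<in> I"
  shows "fraction R S a \<one> \<in> extended_ideal R S I"
proof -
  have "(\<lambda>a. fraction R S a \<one>) ` I \<subseteq> carrier L" using assms(1) one_S fraction_closed by blast
  from L.genideal_self[OF this] show ?thesis unfolding extended_ideal_def using assms(2) by blast
qed

text \<open>The fractions with numerator in \<open>I\<close> already form an ideal and contain the
  generators, so they exhaust the extended ideal. Equality of fractions then supplies the factor
  \<open>\<sigma>\<close>.\<close>

lemma extended_ideal_fraction: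
  assumes I: "ideal I R" and a: "a \<in> carrier R" "s \<in> S" and mem: "fraction R S a s \<in> extended_ideal R S I"
  shows "\<exists>\<sigma>\<in>S. \<sigma> \<otimes> a \<in> I"
proof -
  interpret I: ideal I R by (rule I)
  let ?T = "{fraction R S b t |b t. b \<in> I \<and> t \<in> S}"
  have "ideal ?T L"
  proof (rule L.idealI_simple)
    show "?T \<subseteq> carrier L" using fraction_closed by auto
    show "\<zero>\<^bsub>L\<^esub> \<in> ?T" using loc_zero one_S additive_subgroup.zero_closed[OF I.additive_subgroup_axioms] by blast
    fix x y assume "x \<in> ?T" "y \<in> ?T"
    then obtain b t b' t' where *: "x = fraction R S b t" "b \<in> I" "t \<in> S" "y = fraction R S b' t'" "b' \<in> I" "t' \<in> S"
      by blast
    have "x \<oplus>\<^bsub>L\<^esub> y = fraction R S (b \<otimes> t' \<oplus> b' \<otimes> t) (t \<otimes> t')"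
      unfolding *(1,4) using * by (intro loc_add) auto
    moreover have "b \<otimes> t' \<oplus> b' \<otimes> t \<in> I" using * S_closed by (intro I.a_closed I.I_r_closed) auto
    ultimately show "x \<oplus>\<^bsub>L\<^esub> y \<in> ?T" using mult_S[OF *(3,6)] by blast
  next
    fix x r assume "x \<in> ?T" "r \<in> carrier L"
    then obtain b t b' t' where *: "x = fraction R S b t" "b \<in> I" "t \<in> S" "r = fraction R S b' t'" "b' \<in> carrier R" "t' \<in> S"
      unfolding loc_carrier by blast
    have "r \<otimes>\<^bsub>L\<^esub> x = fraction R S (b' \<otimes> b) (t' \<otimes> t)"
      unfolding *(1,4) using * by (intro loc_mult) auto
    moreover have "b' \<otimes> b \<in> I" using * by (intro I.I_l_closed) auto
    ultimately show "r \<otimes>\<^bsub>L\<^esub> x \<in> ?T" using mult_S[OF *(6,3)] by blast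
  qed
  moreover have "(\<lambda>a. fraction R S a \<one>) ` I \<subseteq> ?T" using one_S by blast
  ultimately have "extended_ideal R S I \<subseteq> ?T"
    unfolding extended_ideal_def by (rule L.genideal_minimal)
  then obtain b t where b: "fraction R S a s = fraction R S b t" "b \<in> I" "t \<in> S" using mem by blast
  then obtain u where u: "u \<in> S" "u \<otimes> (a \<otimes> t) = u \<otimes> (b \<otimes> s)" using loc_eq_iff[OF a, of b t] by auto
  have "u \<otimes> t \<otimes> a = u \<otimes> (a \<otimes> t)" using u(1) b(3) a S_closed by (simp add: m_ac)
  also have "\<dots> \<in> I" unfolding u(2) using u(1) b a S_closed by (intro I.I_l_closed I.I_r_closed) auto
  finally show ?thesis using mult_S[OF u(1) b(3)] by blast
qed

end

text \<open>An ideal extends to a proper ideal of the localization at \<open>P\<close> exactly when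
  it lies in \<open>P\<close>. So this is adjacency in the graph localized at \<open>P\<close> after
  deletion of its trivial edges.\<close>

definition edge_adjacency :: "('v, 'e, 'a) elgraph \<Rightarrow> 'a set \<Rightarrow> ('v \<times> 'v) set" where
  "edge_adjacency G P = {(u, w). \<exists>e\<in>edges G. label G e \<subseteq> P \<and> ends G e = {u, w}}"

text \<open>The part of the locally regular 1-mono condition that the proof uses, free of localizations:
  near \<open>P\<close> all labels in the component of \<open>v\<close> are generated by the same regular element.\<close>

definition mono_at :: "('a, 'r) ring_scheme \<Rightarrow> ('v, 'e, 'a) elgraph \<Rightarrow> 'a set \<Rightarrow> 'v \<Rightarrow> 'a \<Rightarrow> bool" where
  "mono_at R G P v \<alpha> \<longleftrightarrow> regular_at R P \<alpha> \<and>
     (\<forall>e\<in>edges G. label G e \<subseteq> P \<longrightarrow> ends G e \<subseteq> (edge_adjacency G P)\<^sup>* `` {v} \<longrightarrow>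
        (\<forall>y\<in>label G e. \<exists>s\<in>carrier R - P. \<alpha> divides\<^bsub>R\<^esub> (s \<otimes>\<^bsub>R\<^esub> y)) \<and>
        (\<exists>\<tau>\<in>carrier R - P. \<tau> \<otimes>\<^bsub>R\<^esub> \<alpha> \<in> label G e))"

context localization_setup
begin

text \<open>A label inside \<open>P\<close> stays proper over \<open>L\<close>, since otherwise it
  would contain an element of \<open>S\<close>. Hence the component of \<open>v\<close> near
  \<open>P\<close> lies in a single determining subgraph over \<open>L\<close>. The numerator of its
  regular generator is the required \<open>\<alpha>\<close>, because the denominator is a
  unit.\<close>

lemma regular_1_mono_mono_at:
  assumes P: "primeideal P R" and SP: "S \<inter> P = {}" and G: "edge_labeled_graph R G"
    and mono: "regular_1_mono L (localized_graph R S G)" and v: "v \<in> verts G"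
  shows "\<exists>\<alpha>. mono_at R G P v \<alpha>"
proof (cases "\<exists>e\<in>edges G. label G e \<subseteq> P \<and> ends G e \<subseteq> (edge_adjacency G P)\<^sup>* `` {v}")
  case False
  \<comment> \<open>Without such an edge at \<open>v\<close> the condition on labels is vacuous and
    any regular element serves.\<close>
  have "\<one> \<in> carrier R - P" using SP one_S by auto
  then have "regular_at R P \<one>" by (auto simp: regular_at_def)
  then have "mono_at R G P v \<one>" using False unfolding mono_at_def by blast
  then show ?thesis by blast
next
  case True
  then obtain e0 where e0: "e0 \<in> edges G" "label G e0 \<subseteq> P" "ends G e0 \<subseteq> (edge_adjacency G P)\<^sup>* `` {v}" by blast
  define D where "D = delete_trivial_edges L (localized_graph R S G)"
  have lab: "ideal (label G e) R" if "e \<in> edges G" for e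
    using G that by (simp add: edge_labeled_graph_def)
  have D: "verts D = verts G" "edges D = {e \<in> edges G. extended_ideal R S (label G e) \<noteq> carrier L}"
    "ends D = ends G" "label D e = extended_ideal R S (label G e)" for e
    by (simp_all add: D_def delete_trivial_edges_def localized_graph_def)
  have nontrivial: "e \<in> edges D" if e: "e \<in> edges G" "label G e \<subseteq> P" for e
  proof -
    have "extended_ideal R S (label G e) \<noteq> carrier L"
    proof
      assume "extended_ideal R S (label G e) = carrier L"
      then have "fraction R S \<one> \<one> \<in> extended_ideal R S (label G e)" using fraction_closed one_S by simp
      then obtain \<sigma> where "\<sigma> \<in> S" "\<sigma> \<otimes> \<one> \<in> label G e"
        using extended_ideal_fraction[OF lab[OF e(1)] one_closed one_S] by blast
      then show False using SP e(2) S_closed by auto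
    qed
    then show ?thesis using e(1) by (simp add: D)
  qed
  define C where "C = (adjacent D)\<^sup>* `` {v}"
  define H where "H = D\<lparr>verts := C, edges := {e \<in> edges D. ends D e \<subseteq> C}\<rparr>"
  \<comment> \<open>The inclusion may be strict when \<open>S\<close> is smaller than the complement
    of \<open>P\<close>. It suffices, since all labels of the larger component over \<open>L\<close>
    are still equal.\<close>
  have "edge_adjacency G P \<subseteq> adjacent D"
    using nontrivial by (auto simp: edge_adjacency_def adjacent_def D(3))
  then have sub: "(edge_adjacency G P)\<^sup>* `` {v} \<subseteq> C"
    unfolding C_def using rtrancl_mono by blast
  have inH: "e \<in> edges H" if "e \<in> edges G" "label G e \<subseteq> P" "ends G e \<subseteq> (edge_adjacency G P)\<^sup>* `` {v}" for e
    using nontrivial[OF that(1,2)] that(3) sub by (auto simp: H_def D(3))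
  have "H \<in> connected_components D"
    unfolding connected_components_def H_def C_def using v D(1) by blast
  then have Hdet: "H \<in> determining_subgraphs L (localized_graph R S G)"
    using inH[OF e0] unfolding determining_subgraphs_def D_def[symmetric] by blast
  have "\<exists>I. (\<forall>e\<in>edges H. label H e = I) \<and> (\<exists>a. regular_element L a \<and> I = PIdl\<^bsub>L\<^esub> a)"
    using mono Hdet unfolding regular_1_mono_def by (rule bspec)
  then obtain I where I: "\<And>e. e \<in> edges H \<Longrightarrow> label H e = I"
    and "\<exists>a. regular_element L a \<and> I = PIdl\<^bsub>L\<^esub> a" by blast
  then obtain a where a: "regular_element L a" and Ia: "I = PIdl\<^bsub>L\<^esub> a" by blast
  obtain \<alpha> s where \<alpha>: "a = fraction R S \<alpha> s" "\<alpha> \<in> carrier R" "s \<in> S"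
    using a unfolding regular_element_def loc_carrier by blast
  have SP': "t \<in> carrier R - P" if "t \<in> S" for t using that SP S_closed by blast
  have "regular_at R P \<alpha>"
    unfolding regular_at_def
  proof (intro conjI ballI impI \<alpha>(2))
    fix r assume r: "r \<in> carrier R" "r \<otimes> \<alpha> = \<zero>"
    have "a \<otimes>\<^bsub>L\<^esub> fraction R S r \<one> = fraction R S \<zero> s"
      unfolding \<alpha>(1) using loc_mult[OF \<alpha>(2,3) r(1) one_S] r \<alpha>(2,3) S_closed by (simp add: m_comm)
    also have "\<dots> = \<zero>\<^bsub>L\<^esub>"
      unfolding loc_zero using loc_eq_iff[OF zero_closed \<alpha>(3) zero_closed one_S] one_S \<alpha>(3) S_closed by auto
    finally have "fraction R S r \<one> = fraction R S \<zero> \<one>"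
      using a fraction_closed[OF r(1) one_S] unfolding regular_element_def loc_zero by blast
    then obtain u where "u \<in> S" "u \<otimes> (r \<otimes> \<one>) = u \<otimes> (\<zero> \<otimes> \<one>)"
      using loc_eq_iff[OF r(1) one_S zero_closed one_S] by blast
    then show "\<exists>t\<in>carrier R - P. t \<otimes> r = \<zero>" using SP' S_closed r(1) by auto
  qed
  moreover have "(\<forall>y\<in>label G e. \<exists>s\<in>carrier R - P. \<alpha> divides (s \<otimes> y)) \<and>
      (\<exists>\<tau>\<in>carrier R - P. \<tau> \<otimes> \<alpha> \<in> label G e)"
    if e: "e \<in> edges G" "label G e \<subseteq> P" "ends G e \<subseteq> (edge_adjacency G P)\<^sup>* `` {v}" for e
  proof (intro conjI ballI)
    interpret E: ideal "label G e" R by (rule lab[OF e(1)])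
    have ext: "extended_ideal R S (label G e) = PIdl\<^bsub>L\<^esub> a"
      using I[OF inH[OF e]] Ia by (simp add: H_def D(4))
    have aL: "a \<in> carrier L" using a by (simp add: regular_element_def)
    have "a \<in> PIdl\<^bsub>L\<^esub> a" by (rule L.cgenideal_self[OF aL])
    then have "fraction R S \<alpha> s \<in> extended_ideal R S (label G e)" using ext \<alpha>(1) by simp
    then show "\<exists>\<tau>\<in>carrier R - P. \<tau> \<otimes> \<alpha> \<in> label G e"
      using extended_ideal_fraction[OF E.ideal_axioms \<alpha>(2,3)] SP' by blast
    fix y assume y: "y \<in> label G e"
    then have yR: "y \<in> carrier R" by (rule E.Icarr)
    have "fraction R S y \<one> \<in> PIdl\<^bsub>L\<^esub> a"
      using extended_ideal_self[OF E.a_subset y] ext by simp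
    then obtain z where z: "z \<in> carrier L" "fraction R S y \<one> = z \<otimes>\<^bsub>L\<^esub> a"
      unfolding cgenideal_def by blast
    obtain b w where b: "z = fraction R S b w" "b \<in> carrier R" "w \<in> S" using z(1) unfolding loc_carrier by blast
    have "fraction R S y \<one> = fraction R S (b \<otimes> \<alpha>) (w \<otimes> s)"
      unfolding z(2) b(1) \<alpha>(1) by (rule loc_mult[OF b(2,3) \<alpha>(2,3)])
    then obtain u where u: "u \<in> S" "u \<otimes> (y \<otimes> (w \<otimes> s)) = u \<otimes> (b \<otimes> \<alpha> \<otimes> \<one>)"
      using loc_eq_iff[OF yR one_S m_closed[OF b(2) \<alpha>(2)] mult_S[OF b(3) \<alpha>(3)]] by blast
    have c: "u \<in> carrier R" "w \<in> carrier R" "s \<in> carrier R" using u(1) b(3) \<alpha>(3) S_closed by auto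
    have "u \<otimes> (w \<otimes> s) \<otimes> y = u \<otimes> (y \<otimes> (w \<otimes> s))" using c yR by (simp add: m_ac)
    also have "\<dots> = \<alpha> \<otimes> (u \<otimes> b)" unfolding u(2) using c b(2) \<alpha>(2) by (simp add: m_ac)
    finally have "\<alpha> divides (u \<otimes> (w \<otimes> s) \<otimes> y)" by (rule divides_intro[OF m_closed[OF c(1) b(2)]])
    then show "\<exists>s\<in>carrier R - P. \<alpha> divides (s \<otimes> y)"
      using SP'[OF mult_S[OF u(1) mult_S[OF b(3) \<alpha>(3)]]] by blast
  qed
  ultimately show ?thesis unfolding mono_at_def by blast
qed

end

text \<open>Each alternative of the hypothesis provides a multiplicative set that misses
  \<open>P\<close>: its complement, or the powers of an \<open>f\<close> whose basic open set
  contains \<open>P\<close>.\<close>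

lemma (in cring) locally_regular_1_mono_mono_at:
  assumes "locally_regular_1_mono R G" and G: "edge_labeled_graph R G"
    and P: "primeideal P R" and v: "v \<in> verts G"
  shows "\<exists>\<alpha>. mono_at R G P v \<alpha>"
proof -
  have one: "\<one> \<notin> P"
    using primeideal.I_notcarr[OF P] ideal.one_imp_carrier[OF primeideal.axioms(1)[OF P]] by blast
  have PS: "P \<in> prime_spectrum R" using P by (simp add: prime_spectrum_def)
  have "\<exists>S. S \<subseteq> carrier R \<and> \<one> \<in> S \<and> (\<forall>s\<in>S. \<forall>t\<in>S. s \<otimes> t \<in> S) \<and> S \<inter> P = {} \<and>
      regular_1_mono (localization R S) (localized_graph R S G)"
    using assms(1) unfolding locally_regular_1_mono_def
  proof
    assume "\<forall>\<pp>\<in>prime_spectrum R.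
        regular_1_mono (localization R (carrier R - \<pp>)) (localized_graph R (carrier R - \<pp>) G)"
    then have "regular_1_mono (localization R (carrier R - P)) (localized_graph R (carrier R - P) G)"
      using PS by blast
    moreover have "\<forall>s\<in>carrier R - P. \<forall>t\<in>carrier R - P. s \<otimes> t \<in> carrier R - P"
      using primeideal.I_prime[OF P] by blast
    ultimately show ?thesis using one by (intro exI[of _ "carrier R - P"] conjI) auto
  next
    assume "\<exists>F\<subseteq>carrier R. (\<Union>f\<in>F. basic_open R f) = prime_spectrum R \<and>
        (\<forall>f\<in>F. regular_1_mono (localization R (powers_of R f)) (localized_graph R (powers_of R f) G))"
    then obtain f where f: "f \<in> carrier R" "P \<in> basic_open R f"
      "regular_1_mono (localization R (powers_of R f)) (localized_graph R (powers_of R f) G)"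
      using PS by blast
    have fP: "f \<notin> P" using f(2) by (simp add: basic_open_def)
    have "f [^] n \<notin> P" for n :: nat
    proof (induction n)
      case (Suc n)
      then show ?case using primeideal.I_prime[OF P, of "f [^] n" f] f(1) fP by auto
    qed (simp add: one)
    then have "powers_of R f \<inter> P = {}" by (auto simp: powers_of_def)
    moreover have "\<one> \<in> powers_of R f" unfolding powers_of_def by (intro CollectI exI[of _ 0]) simp
    moreover have "s \<otimes> t \<in> powers_of R f" if "s \<in> powers_of R f" "t \<in> powers_of R f" for s t
      using that nat_pow_mult[OF f(1)] unfolding powers_of_def by blast
    moreover have "powers_of R f \<subseteq> carrier R" using f(1) by (auto simp: powers_of_def)
    ultimately show ?thesis using f(3) by (intro exI[of _ "powers_of R f"] conjI ballI) auto
  qed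
  then obtain S where S: "S \<subseteq> carrier R" "\<one> \<in> S" "\<And>s t. s \<in> S \<Longrightarrow> t \<in> S \<Longrightarrow> s \<otimes> t \<in> S" "S \<inter> P = {}"
    "regular_1_mono (localization R S) (localized_graph R S G)" by blast
  interpret localization_setup R S by unfold_locales (use S in auto)
  show ?thesis by (rule regular_1_mono_mono_at[OF P S(4) G S(5) v])
qed

section \<open>Splines\<close>

locale spline_setup = cring R for R :: "('a, 'r) ring_scheme" (structure) +
  fixes G :: "('v, 'e, 'a) elgraph"
  assumes graph: "edge_labeled_graph R G"
begin

lemma minus_self: "a \<in> carrier R \<Longrightarrow> a \<ominus> a = \<zero>"
  by (simp add: minus_eq r_neg)

abbreviation "SM \<equiv> spline_ring R G"

lemma spline_algebra: "algebra R SM"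
  by (rule spline_ring_algebra[OF is_cring graph])

sublocale SM: module R SM
  using spline_algebra by (rule algebra.axioms(1))

lemma spline_simps:
  "carrier SM = splines R G"
  "x \<oplus>\<^bsub>SM\<^esub> y = (\<lambda>v\<in>verts G. x v \<oplus> y v)"
  "r \<odot>\<^bsub>SM\<^esub> x = (\<lambda>v\<in>verts G. r \<otimes> x v)"
  "\<zero>\<^bsub>SM\<^esub> = (\<lambda>v\<in>verts G. \<zero>)"
  by (simp_all add: spline_ring_def)

lemma label_ideal: "e \<in> edges G \<Longrightarrow> ideal (label G e) R"
  and ends_subset: "e \<in> edges G \<Longrightarrow> ends G e \<subseteq> verts G"
  using graph by (auto simp: edge_labeled_graph_def)

lemma spline_closed: "\<lbrakk>x \<in> splines R G; v \<in> verts G\<rbrakk> \<Longrightarrow> x v \<in> carrier R"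
  by (auto simp: splines_def)

lemma evaluation_linear: "v \<in> verts G \<Longrightarrow> linear_form R SM (\<lambda>x. x v)"
  using spline_closed by (simp add: linear_form_def spline_simps)

lemma spline_eqI:
  assumes "x \<in> carrier SM" "\<And>v. v \<in> verts G \<Longrightarrow> x v = \<zero>"
  shows "x = \<zero>\<^bsub>SM\<^esub>"
proof
  fix v
  show "x v = \<zero>\<^bsub>SM\<^esub> v"
    using assms by (cases "v \<in> verts G") (auto simp: spline_simps splines_def PiE_def extensional_def)
qed

text \<open>Loops impose no condition, because zero lies in every label.\<close>

lemma splineI:
  assumes "\<And>v. v \<in> verts G \<Longrightarrow> f v \<in> carrier R"
    and "\<And>e u w. \<lbrakk>e \<in> edges G; ends G e = {u, w}; u \<noteq> w\<rbrakk> \<Longrightarrow> f u \<ominus> f w \<in> label G e"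
  shows "(\<lambda>v\<in>verts G. f v) \<in> splines R G"
  unfolding splines_def
proof (intro CollectI conjI ballI allI impI)
  show "(\<lambda>v\<in>verts G. f v) \<in> verts G \<rightarrow>\<^sub>E carrier R" using assms(1) by auto
  fix e u w assume e: "e \<in> edges G" "ends G e = {u, w}"
  have uw: "u \<in> verts G" "w \<in> verts G" using ends_subset[OF e(1)] e(2) by auto
  interpret E: ideal "label G e" R by (rule label_ideal[OF e(1)])
  have "f u \<ominus> f w \<in> label G e"
  proof (cases "u = w")
    case True
    then show ?thesis using assms(1)[OF uw(1)] E.zero_closed by (simp add: minus_self)
  qed (rule assms(2)[OF e])
  then show "(\<lambda>v\<in>verts G. f v) u \<ominus> (\<lambda>v\<in>verts G. f v) w \<in> label G e" using uw by simp
qed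

lemma spline_edge:
  "\<lbrakk>x \<in> splines R G; e \<in> edges G; ends G e = {u, w}\<rbrakk> \<Longrightarrow> x u \<ominus> x w \<in> label G e"
  by (auto simp: splines_def)

text \<open>Edges with label not inside \<open>P\<close> become trivial at \<open>P\<close>. A value
  multiplied by this \<open>t\<close> satisfies all of them at once; finiteness of the edge set is
  what allows a single \<open>t\<close>.\<close>

lemma nontrivial_multiplier:
  assumes P: "primeideal P R"
  shows "\<exists>t\<in>carrier R - P. \<forall>e\<in>edges G. \<not> label G e \<subseteq> P \<longrightarrow> t \<in> label G e"
proof -
  have fin: "finite (edges G)" using graph by (simp add: edge_labeled_graph_def)
  have one: "\<one> \<in> carrier R - P"
    using primeideal.I_notcarr[OF P] ideal.one_imp_carrier[OF primeideal.axioms(1)[OF P]] by blast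
  show ?thesis
  proof (rule common_multiplier[OF P fin])
    show "\<exists>t\<in>carrier R - P. \<not> label G e \<subseteq> P \<longrightarrow> t \<in> label G e" if "e \<in> edges G" for e
      using one ideal.Icarr[OF label_ideal[OF that]] by blast
    show "\<not> label G e \<subseteq> P \<longrightarrow> u \<otimes> t \<in> label G e"
      if "e \<in> edges G" "u \<in> carrier R" "\<not> label G e \<subseteq> P \<longrightarrow> t \<in> label G e" for e t u
      using ideal.I_l_closed[OF label_ideal[OF that(1)]] that(2,3) by blast
  qed
qed

text \<open>Along a path from \<open>v\<close> to \<open>w\<close> each difference of neighbouring
  values is divisible by \<open>\<alpha>\<close> up to a multiplier outside \<open>P\<close>; the
  differences telescope and the multipliers are multiplied.\<close>

lemma component_multiplier:
  assumes P: "primeideal P R" and C: "C = (edge_adjacency G P)\<^sup>* `` {v}" and mono: "mono_at R G P v \<alpha>"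
    and x: "x \<in> splines R G" and v: "v \<in> verts G" and w: "w \<in> C"
  shows "w \<in> verts G \<and> (\<exists>s\<in>carrier R - P. \<alpha> divides (s \<otimes> (x v \<ominus> x w)))"
proof -
  have \<alpha>: "\<alpha> \<in> carrier R" using mono by (simp add: mono_at_def regular_at_def)
  have "(v, w) \<in> (edge_adjacency G P)\<^sup>*" using w C by simp
  then show ?thesis
  proof (induction rule: rtrancl_induct)
    case base
    have "\<one> \<in> carrier R - P"
      using primeideal.I_notcarr[OF P] ideal.one_imp_carrier[OF primeideal.axioms(1)[OF P]] by blast
    moreover have "\<alpha> divides (\<one> \<otimes> (x v \<ominus> x v))"
      using spline_closed[OF x v] divides_zero[OF \<alpha>] by (simp add: minus_self)
    ultimately show ?case using v by blast
  next
    case (step y z)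
    obtain e where e: "e \<in> edges G" "label G e \<subseteq> P" "ends G e = {y, z}"
      using step.hyps(2) by (auto simp: edge_adjacency_def)
    have z: "z \<in> verts G" using ends_subset[OF e(1)] e(3) by blast
    have y: "y \<in> verts G" using step.IH by blast
    obtain s where s: "s \<in> carrier R" "s \<notin> P" "\<alpha> divides (s \<otimes> (x v \<ominus> x y))" using step.IH by blast
    have "z \<in> C" "y \<in> C" using step.hyps C by auto
    then have "ends G e \<subseteq> C" using e(3) by simp
    then obtain t where t: "t \<in> carrier R" "t \<notin> P" "\<alpha> divides (t \<otimes> (x y \<ominus> x z))"
      using mono e(1,2) spline_edge[OF x e(1,3)] unfolding mono_at_def C by blast
    have c: "x v \<in> carrier R" "x y \<in> carrier R" "x z \<in> carrier R" using spline_closed[OF x] v y z by auto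
    have "s \<otimes> t \<otimes> (x v \<ominus> x z) = t \<otimes> (s \<otimes> (x v \<ominus> x y)) \<oplus> s \<otimes> (t \<otimes> (x y \<ominus> x z))"
      using s(1) t(1) c by algebra
    moreover have "\<alpha> divides (t \<otimes> (s \<otimes> (x v \<ominus> x y)))" "\<alpha> divides (s \<otimes> (t \<otimes> (x y \<ominus> x z)))"
      using divides_mult_right(2)[OF \<alpha>] s t by blast+
    ultimately have "\<alpha> divides (s \<otimes> t \<otimes> (x v \<ominus> x z))" using divides_add[OF \<alpha>] by simp
    moreover have "s \<otimes> t \<in> carrier R - P" using primeideal.I_prime[OF P s(1) t(1)] s t by blast
    ultimately show ?case using z by blast
  qed
qed

text \<open>At \<open>P\<close> the element \<open>t\<close> is a unit.\<close>

lemma regular_at_mult: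
  assumes P: "primeideal P R" and \<alpha>: "regular_at R P \<alpha>" and t: "t \<in> carrier R - P"
  shows "regular_at R P (t \<otimes> \<alpha>)"
  unfolding regular_at_def
proof (intro conjI ballI impI)
  have \<alpha>R: "\<alpha> \<in> carrier R" using \<alpha> by (simp add: regular_at_def)
  then show "t \<otimes> \<alpha> \<in> carrier R" using t by simp
  fix r assume r: "r \<in> carrier R" "r \<otimes> (t \<otimes> \<alpha>) = \<zero>"
  then have "r \<otimes> t \<otimes> \<alpha> = \<zero>" using t \<alpha>R by (simp add: m_assoc)
  then obtain u where u: "u \<in> carrier R - P" "u \<otimes> (r \<otimes> t) = \<zero>"
    using \<alpha> r(1) t unfolding regular_at_def by (meson DiffD1 m_closed)
  have "u \<otimes> t \<otimes> r = \<zero>" using u r(1) t by (simp add: m_ac)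
  moreover have "u \<otimes> t \<in> carrier R - P" using primeideal.I_prime[OF P, of u t] u(1) t by blast
  ultimately show "\<exists>t\<in>carrier R - P. t \<otimes> r = \<zero>" by blast
qed

text \<open>In each case an explicit spline attains the value \<open>c\<close>, and the values of
  all other splines vanishing on \<open>W\<close> are shown to be multiples of \<open>c\<close> up
  to a multiplier outside \<open>P\<close>.\<close>

lemma leading_ideal_local_generator:
  assumes P: "primeideal P R" and mono: "mono_at R G P v \<alpha>" and v: "v \<in> verts G - W"
    and W: "W \<subseteq> verts G"
  shows "\<exists>c \<in> (\<lambda>x. x v) ` SM.kernel_of (\<lambda>w x. x w) W. regular_at R P c \<and>
    (\<forall>x\<in>SM.kernel_of (\<lambda>w x. x w) W. \<exists>s\<in>carrier R - P. c divides (s \<otimes> x v))"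
proof -
  define C where "C = (edge_adjacency G P)\<^sup>* `` {v}"
  have vC: "v \<in> C" by (simp add: C_def)
  have CI: "w \<in> C" if "u \<in> C" "e \<in> edges G" "label G e \<subseteq> P" "ends G e = {u, w}" for u w e
  proof -
    have "(u, w) \<in> edge_adjacency G P" using that(2-4) unfolding edge_adjacency_def by blast
    then show ?thesis using that(1) unfolding C_def by (auto intro: rtrancl_into_rtrancl)
  qed
  have ker: "x \<in> splines R G" "\<And>w. w \<in> W \<Longrightarrow> x w = \<zero>" if "x \<in> SM.kernel_of (\<lambda>w x. x w) W" for x
    using that by (auto simp: SM.kernel_of_def spline_simps)
  have kerI: "f v \<in> (\<lambda>x. x v) ` SM.kernel_of (\<lambda>w x. x w) W"
    if "(\<lambda>v\<in>verts G. f v) \<in> splines R G" "\<And>w. w \<in> W \<Longrightarrow> f w = \<zero>" for f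
  proof (rule image_eqI)
    show "f v = (\<lambda>v\<in>verts G. f v) v" using v by simp
    show "(\<lambda>v\<in>verts G. f v) \<in> SM.kernel_of (\<lambda>w x. x w) W"
      using that W by (auto simp: SM.kernel_of_def spline_simps)
  qed
  obtain t where t: "t \<in> carrier R - P" "\<And>e. e \<in> edges G \<Longrightarrow> \<not> label G e \<subseteq> P \<Longrightarrow> t \<in> label G e"
    using nontrivial_multiplier[OF P] by blast
  have tR: "t \<in> carrier R" using t(1) by simp
  have one: "regular_at R P \<one>"
    using primeideal.I_notcarr[OF P] ideal.one_imp_carrier[OF primeideal.axioms(1)[OF P]]
    by (auto simp: regular_at_def)
  have neg: "\<zero> \<ominus> c \<in> label G e" "c \<ominus> \<zero> \<in> label G e" if "c \<in> label G e" "e \<in> edges G" for c e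
  proof -
    interpret E: ideal "label G e" R by (rule label_ideal[OF that(2)])
    show "\<zero> \<ominus> c \<in> label G e" "c \<ominus> \<zero> \<in> label G e"
      using that(1) E.Icarr[OF that(1)] E.a_inv_closed[OF that(1)] by (simp_all add: minus_eq)
  qed
  have zero: "\<zero> \<in> label G e" if "e \<in> edges G" for e
    using additive_subgroup.zero_closed[OF ideal.axioms(1)[OF label_ideal[OF that]]] .
  show ?thesis
  proof (cases "C \<inter> W = {}")
    case True
    \<comment> \<open>An edge leaving \<open>C\<close> has a label not inside \<open>P\<close> and
      thus containing \<open>t\<close>; along every other edge the difference is zero. Since
      \<open>t\<close> is a unit at \<open>P\<close>, every value at \<open>v\<close> is possible
      there.\<close>
    let ?f = "\<lambda>w. if w \<in> C then t else \<zero>"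
    have "(\<lambda>v\<in>verts G. ?f v) \<in> splines R G"
    proof (rule splineI)
      fix e u w assume e: "e \<in> edges G" "ends G e = {u, w}" "u \<noteq> w"
      have e': "ends G e = {w, u}" using e(2) by blast
      show "?f u \<ominus> ?f w \<in> label G e"
      proof (cases "label G e \<subseteq> P")
        case True
        then have "u \<in> C \<longleftrightarrow> w \<in> C" using CI[OF _ e(1) True e(2)] CI[OF _ e(1) True e'] by blast
        then show ?thesis using zero[OF e(1)] tR by (auto simp: minus_self)
      next
        case False
        then show ?thesis using t(2)[OF e(1) False] neg zero[OF e(1)] e(1) tR by (auto simp: minus_self)
      qed
    qed (use tR in auto)
    then have "?f v \<in> (\<lambda>x. x v) ` SM.kernel_of (\<lambda>w x. x w) W" using True by (intro kerI) auto
    then have "t \<in> (\<lambda>x. x v) ` SM.kernel_of (\<lambda>w x. x w) W" using vC by simp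
    moreover have "regular_at R P t" using regular_at_mult[OF P one t(1)] tR by simp
    moreover have "\<exists>s\<in>carrier R - P. t divides (s \<otimes> x v)" if "x \<in> SM.kernel_of (\<lambda>w x. x w) W" for x
      using t(1) spline_closed[OF ker(1)[OF that]] v by (intro bexI[of _ t] divides_intro[of "x v"]) auto
    ultimately show ?thesis by blast
  next
    case False
    then obtain w0 where w0: "w0 \<in> C" "w0 \<in> W" by blast
    have \<alpha>: "regular_at R P \<alpha>" using mono by (simp add: mono_at_def)
    then have \<alpha>R: "\<alpha> \<in> carrier R" by (simp add: regular_at_def)
    let ?E = "{e \<in> edges G. label G e \<subseteq> P \<and> ends G e \<subseteq> C}"
    have finE: "finite ?E" using graph by (simp add: edge_labeled_graph_def)
    have "\<exists>\<tau>\<in>carrier R - P. \<forall>e\<in>?E. \<tau> \<otimes> \<alpha> \<in> label G e"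
    proof (rule common_multiplier[OF P finE])
      show "\<exists>\<tau>\<in>carrier R - P. \<tau> \<otimes> \<alpha> \<in> label G e" if "e \<in> ?E" for e
        using mono that unfolding mono_at_def C_def by blast
      show "u \<otimes> \<tau> \<otimes> \<alpha> \<in> label G e"
        if "e \<in> ?E" "\<tau> \<in> carrier R" "u \<in> carrier R" "\<tau> \<otimes> \<alpha> \<in> label G e" for e \<tau> u
        using that \<alpha>R ideal.I_l_closed[OF label_ideal, of e "\<tau> \<otimes> \<alpha>" u] by (simp add: m_assoc)
    qed
    then obtain \<tau> where \<tau>: "\<tau> \<in> carrier R - P"
      "\<And>e. e \<in> edges G \<Longrightarrow> label G e \<subseteq> P \<Longrightarrow> ends G e \<subseteq> C \<Longrightarrow> \<tau> \<otimes> \<alpha> \<in> label G e" by blast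
    have \<tau>R: "\<tau> \<in> carrier R" using \<tau>(1) by simp
    \<comment> \<open>The spline with value \<open>c\<close> at \<open>v\<close> and zero elsewhere
      only has to satisfy the edges at \<open>v\<close>. The factor
      \<open>\<tau> \<otimes> \<alpha>\<close> lies in those labels that are inside
      \<open>P\<close>, and \<open>t\<close> lies in the remaining ones; both \<open>t\<close> and
      \<open>\<tau>\<close> are units at \<open>P\<close>, so \<open>c\<close> generates the same
      ideal there as \<open>\<alpha>\<close>.\<close>
    define c where "c = t \<otimes> (\<tau> \<otimes> \<alpha>)"
    have cR: "c \<in> carrier R" using tR \<tau>R \<alpha>R by (simp add: c_def)
    have c_label: "c \<in> label G e" if e: "e \<in> edges G" "ends G e = {v, w}" for e w
    proof -
      interpret E: ideal "label G e" R by (rule label_ideal[OF e(1)])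
      show ?thesis
      proof (cases "label G e \<subseteq> P")
        case True
        then have "ends G e \<subseteq> C" using CI[OF vC e(1) True e(2)] vC e(2) by simp
        then show ?thesis unfolding c_def using E.I_l_closed[OF \<tau>(2)[OF e(1) True] tR] by blast
      next
        case False
        then show ?thesis unfolding c_def
          using E.I_r_closed[OF t(2)[OF e(1)] m_closed[OF \<tau>R \<alpha>R]] by blast
      qed
    qed
    let ?f = "\<lambda>w. if w = v then c else \<zero>"
    have "(\<lambda>v\<in>verts G. ?f v) \<in> splines R G"
    proof (rule splineI)
      fix e u w assume e: "e \<in> edges G" "ends G e = {u, w}" "u \<noteq> w"
      have e': "ends G e = {w, u}" using e(2) by blast
      consider "u = v" "w \<noteq> v" | "w = v" "u \<noteq> v" | "u \<noteq> v" "w \<noteq> v" using e(3) by blast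
      then show "?f u \<ominus> ?f w \<in> label G e"
      proof cases
        case 1
        then have "c \<in> label G e" using c_label[OF e(1), of w] e(2) by blast
        then show ?thesis using 1 neg(2)[OF _ e(1)] by simp
      next
        case 2
        then have "c \<in> label G e" using c_label[OF e(1), of u] e' by blast
        then show ?thesis using 2 neg(1)[OF _ e(1)] by simp
      next
        case 3
        then show ?thesis using zero[OF e(1)] by (simp add: minus_self)
      qed
    qed (use cR in auto)
    then have "?f v \<in> (\<lambda>x. x v) ` SM.kernel_of (\<lambda>w x. x w) W" using v by (intro kerI) auto
    then have "c \<in> (\<lambda>x. x v) ` SM.kernel_of (\<lambda>w x. x w) W" by simp
    moreover have "regular_at R P c"
      unfolding c_def by (intro regular_at_mult[OF P] \<alpha> \<tau>(1) t(1))
    moreover have "\<exists>s\<in>carrier R - P. c divides (s \<otimes> x v)" if x: "x \<in> SM.kernel_of (\<lambda>w x. x w) W" for x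
    proof -
      have xv: "x v \<in> carrier R" using spline_closed[OF ker(1)[OF x]] v by blast
      obtain s where s: "s \<in> carrier R" "s \<notin> P" "\<alpha> divides (s \<otimes> (x v \<ominus> x w0))"
        using component_multiplier[OF P C_def mono ker(1)[OF x] _ w0(1)] v by blast
      \<comment> \<open>Here the component meets \<open>W\<close>: the spline vanishes at
        \<open>w0\<close>, so its value at \<open>v\<close> equals a difference inside the component
        and is divisible by \<open>\<alpha>\<close> up to \<open>s\<close>.\<close>
      have "x v \<ominus> x w0 = x v" using ker(2)[OF x w0(2)] xv by (simp add: minus_eq)
      then have "\<alpha> divides (s \<otimes> x v)" using s(3) by simp
      then have "(t \<otimes> (\<tau> \<otimes> \<alpha>)) divides (t \<otimes> (\<tau> \<otimes> (s \<otimes> x v)))"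
        using divides_mult[OF \<alpha>R \<tau>R] divides_mult[OF m_closed[OF \<tau>R \<alpha>R] tR] by blast
      moreover have "t \<otimes> (\<tau> \<otimes> (s \<otimes> x v)) = t \<otimes> (\<tau> \<otimes> s) \<otimes> x v" using tR \<tau>R s(1) xv by (simp add: m_assoc)
      ultimately have "c divides (t \<otimes> (\<tau> \<otimes> s) \<otimes> x v)" unfolding c_def by simp
      moreover have "\<tau> \<otimes> s \<in> carrier R - P" using primeideal.I_prime[OF P \<tau>R s(1)] \<tau>(1) s by blast
      then have "t \<otimes> (\<tau> \<otimes> s) \<in> carrier R - P" using primeideal.I_prime[OF P tR, of "\<tau> \<otimes> s"] t(1) by blast
      ultimately show ?thesis by blast
    qed
    ultimately show ?thesis by blast
  qed
qed

text \<open>The ideal is the image of a kernel that is not assumed finitely generated. Because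
  \<open>\<rho>\<close> maps the whole spline module onto this kernel and fixes it, the form
  \<open>?f\<close> has the same image on the finitely generated spline module, where the uniform
  multiplier is available.\<close>

lemma leading_ideal_locally_principal:
  assumes fg: "fin_gen_module R SM" and lrm: "locally_regular_1_mono R G"
    and W: "W \<subseteq> verts G" and v: "v \<in> verts G - W"
    and split: "SM.splitting (\<lambda>w x. x w) W B \<phi> \<rho>"
  shows "locally_principal R ((\<lambda>x. x v) ` SM.kernel_of (\<lambda>w x. x w) W)"
proof -
  let ?K = "SM.kernel_of (\<lambda>w x. x w) W"
  let ?f = "\<lambda>x. \<rho> x v"
  have \<rho>: "\<rho> \<in> module_hom R SM SM" and \<rho>K: "\<And>x. x \<in> carrier SM \<Longrightarrow> \<rho> x \<in> ?K"
    using split unfolding SM.splitting_def by blast+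
  have KM: "x \<in> carrier SM" if "x \<in> ?K" for x using that by (simp add: SM.kernel_of_def)
  have ev: "linear_form R SM (\<lambda>x. x v)" using v by (intro evaluation_linear) simp
  have f: "linear_form R SM ?f"
    using linear_formD[OF ev] module_homD[OF \<rho>] unfolding linear_form_def by simp
  have img: "?f ` carrier SM = (\<lambda>x. x v) ` ?K"
  proof (intro equalityI subsetI)
    fix y assume "y \<in> ?f ` carrier SM"
    then show "y \<in> (\<lambda>x. x v) ` ?K" using \<rho>K by blast
  next
    fix y assume "y \<in> (\<lambda>x. x v) ` ?K"
    then obtain x where x: "y = x v" "x \<in> ?K" by (rule imageE)
    have "y = ?f x" using SM.splitting_kernel[OF split x(2)] x(1) by simp
    then show "y \<in> ?f ` carrier SM" using KM[OF x(2)] by (rule image_eqI)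
  qed
  have "locally_principal R (?f ` carrier SM)"
  proof (rule SM.fin_gen_locally_principal[OF fg f])
    fix P assume P: "primeideal P R"
    obtain \<alpha> where "mono_at R G P v \<alpha>"
      using locally_regular_1_mono_mono_at[OF lrm graph P] v by blast
    from leading_ideal_local_generator[OF P this v W]
    show "\<exists>c\<in>?f ` carrier SM. regular_at R P c \<and> (\<forall>x\<in>carrier SM. \<exists>s\<in>carrier R - P. c divides (s \<otimes> ?f x))"
      unfolding img using \<rho>K by blast
  qed
  then show ?thesis by (simp only: img)
qed

theorem spline_dual_basis:
  assumes fg: "fin_gen_module R SM" and lrm: "locally_regular_1_mono R G"
    and orth: "\<And>J. \<lbrakk>orth; locally_principal R J\<rbrakk> \<Longrightarrow> \<exists>E \<psi>. ideal_dual_basis R J E \<psi> \<and> orthonormal R E \<psi>"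
  shows "\<exists>B \<phi>. dual_basis R SM B \<phi> \<and> (orth \<longrightarrow> orthonormal R B \<phi>)"
proof (rule SM.dual_basis_exists[where V = "verts G" and e = "\<lambda>v x. x v"])
  show "finite (verts G)" using graph by (simp add: edge_labeled_graph_def)
  fix v W B \<phi> \<rho>
  assume "W \<subseteq> verts G" "v \<in> verts G - W" "SM.splitting (\<lambda>v x. x v) W B \<phi> \<rho>"
  then have "locally_principal R ((\<lambda>x. x v) ` SM.kernel_of (\<lambda>v x. x v) W)"
    by (rule leading_ideal_locally_principal[OF fg lrm])
  then show "\<exists>E \<psi>. ideal_dual_basis R ((\<lambda>x. x v) ` SM.kernel_of (\<lambda>v x. x v) W) E \<psi> \<and> (orth \<longrightarrow> orthonormal R E \<psi>)"
    using orth locally_principal_dual_basis by (cases orth) blast+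
qed (auto intro: evaluation_linear spline_eqI)

end

theorem corollary6:
  fixes R :: "('a, 'r) ring_scheme"
    and G :: "('v, 'e, 'a) elgraph"
    and A :: "('b, 's) ring_scheme"
    and n :: nat
  assumes "cring R"
    and "edge_labeled_graph R G"
    and "fin_gen_module R (spline_ring R G)"
    and "locally_regular_1_mono R G"
  shows "projective_module TYPE('n) TYPE('l) R (spline_ring R G) \<and>
         (principal_domain R \<longrightarrow> free_module R (spline_ring R G)) \<and>
         ((principal_domain A \<or> field A) \<and> R \<simeq> mpoly_ring A n \<longrightarrow>
            free_module R (spline_ring R G))"
proof -
  interpret cring R by fact
  interpret spline_setup R G by unfold_locales fact
  \<comment> \<open>With \<open>orth\<close> false the orthonormality hypothesis is vacuous, and
    every locally principal ideal has a dual basis.\<close>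
  have "projective_module TYPE('n) TYPE('l) R SM"
    using spline_dual_basis[OF assms(3,4), of False] SM.dual_basis_projective by blast
  \<comment> \<open>All hypotheses that lead to freeness enter only through unique factorization in
    \<open>R\<close>.\<close>
  moreover have free: "free_module R SM" if ufd: "ufd R"
  proof -
    interpret dom: "domain" R using ufd by (simp add: ufd_def)
    show ?thesis
      using spline_dual_basis[OF assms(3,4), of True] dom.ufd_locally_principal[OF ufd]
        SM.dual_basis_free by blast
  qed
  moreover have "ufd R" if "principal_domain R"
    by (rule principal_domain.principal_domain_ufd[OF that])
  moreover have "principal_domain A" if "principal_domain A \<or> field A"
    using that
  proof
    assume "field A"
    then interpret A: field A .
    show ?thesis by (rule A.principal_domain_axioms)
  qed
  then have "ufd R" if "(principal_domain A \<or> field A) \<and> R \<simeq> mpoly_ring A n"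
    using ufd_if_iso_mpoly_ring[OF assms(1)] that by blast
  ultimately show ?thesis by blast
qed

end
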